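(* The following are equivalent over $\mathsf{RCA}_0$: (1) $\mathsf{WKL}_0$ (weak König's lemma); (2) for every $n \in \mathbb{N}$, if $G$ is a countable bipartite graph in which each vertex has degree at most $n$, then $\chi'(G) \leq n$; (3) if $G$ is a countable bounded bipartite graph in which each vertex has degree at most $2$, then $\chi'(G) \leq 2$.
   Context: $\mathsf{RCA}_0$ is the base system of Reverse Mathematics (second-order arithmetic with $\Delta^0_1$ comprehension and $\Sigma^0_1$ induction); $\mathsf{WKL}_0$ is $\mathsf{RCA}_0$ plus weak König's lemma (every infinite subtree of $2^{<\mathbb{N}}$ has an infinite path). A countable graph has vertex set $\mathbb{N}$ and is presented by an adjacency function $E\colon\mathbb{N}\times\mathbb{N}\to\{0,1\}$. A graph is bounded if there is a function $f\colon\mathbb{N}\to\mathbb{N}$ such that whenever there is an edge between vertices $v$ and $w$, we have $w \leq f(v)$. A graph is bipartite if its vertices can be partitioned into two sets so that every edge joins the two sets. A proper edge coloring with $k$ colors assigns each edge a color in $\{1,\dots,k\}$ so that no two edges sharing a vertex receive the same color; $\chi'(G)$ is the least such $k$, and "$\chi'(G)\le k$" means such a coloring exists. *)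

theory Defs
  imports Main
begin

section \<open>Structures and formulas of second-order arithmetic\<close>

text \<open>
  A structure for the two-sorted language of second-order arithmetic: the number variables range
  over the type \<open>'m\<close>, the set variables over a collection \<open>Sets\<close> of subsets of it (Henkin semantics).
  Neither sort need be standard. That something holds ``over'' a theory means that it holds in
  all models of that theory in this sense.
\<close>

record 'm l2 =
  Zero :: 'm ("\<zero>\<index>")
  One :: 'm ("\<one>\<index>")
  Add :: "'m \<Rightarrow> 'm \<Rightarrow> 'm" (infixl "\<oplus>\<index>" 65)
  Mul :: "'m \<Rightarrow> 'm \<Rightarrow> 'm" (infixl "\<otimes>\<index>" 70)
  Less :: "'m \<Rightarrow> 'm \<Rightarrow> bool" (infix "\<prec>\<index>" 50)
  Sets :: "'m set set"

datatype tm = NVar nat | TZero | TOne | TAdd tm tm | TMul tm tm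

text \<open>
  Variables are named by natural numbers, separately for the two sorts: \<open>ExN\<close> binds a number
  variable and \<open>ExS\<close> a set variable.
\<close>

datatype fm =
    FEq tm tm
  | FLess tm tm
  | FMem tm nat
  | Neg fm
  | Conj fm fm
  | ExN nat fm
  | ExS nat fm

definition AllN :: "nat \<Rightarrow> fm \<Rightarrow> fm" where
  "AllN x \<phi> = Neg (ExN x (Neg \<phi>))"

primrec tm_vars :: "tm \<Rightarrow> nat set" where
  "tm_vars (NVar x) = {x}"
| "tm_vars TZero = {}"
| "tm_vars TOne = {}"
| "tm_vars (TAdd s t) = tm_vars s \<union> tm_vars t"
| "tm_vars (TMul s t) = tm_vars s \<union> tm_vars t"

primrec tm_val :: "'m l2 \<Rightarrow> (nat \<Rightarrow> 'm) \<Rightarrow> tm \<Rightarrow> 'm" where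
  "tm_val M e (NVar x) = e x"
| "tm_val M e TZero = \<zero>\<^bsub>M\<^esub>"
| "tm_val M e TOne = \<one>\<^bsub>M\<^esub>"
| "tm_val M e (TAdd s t) = tm_val M e s \<oplus>\<^bsub>M\<^esub> tm_val M e t"
| "tm_val M e (TMul s t) = tm_val M e s \<otimes>\<^bsub>M\<^esub> tm_val M e t"

primrec sat :: "'m l2 \<Rightarrow> (nat \<Rightarrow> 'm) \<Rightarrow> (nat \<Rightarrow> 'm set) \<Rightarrow> fm \<Rightarrow> bool" where
  "sat M e F (FEq s t) \<longleftrightarrow> tm_val M e s = tm_val M e t"
| "sat M e F (FLess s t) \<longleftrightarrow> tm_val M e s \<prec>\<^bsub>M\<^esub> tm_val M e t"
| "sat M e F (FMem t X) \<longleftrightarrow> tm_val M e t \<in> F X"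
| "sat M e F (Neg \<phi>) \<longleftrightarrow> \<not> sat M e F \<phi>"
| "sat M e F (Conj \<phi> \<psi>) \<longleftrightarrow> sat M e F \<phi> \<and> sat M e F \<psi>"
| "sat M e F (ExN x \<phi>) \<longleftrightarrow> (\<exists>a. sat M (e(x := a)) F \<phi>)"
| "sat M e F (ExS X \<phi>) \<longleftrightarrow> (\<exists>A\<in>Sets M. sat M e (F(X := A)) \<phi>)"

text \<open>
  Bounded-quantifier formulas; the bounded universal quantifier is the dual of the
  bounded existential one.
\<close>

inductive bounded_fm :: "fm \<Rightarrow> bool" where
  "bounded_fm (FEq s t)"
| "bounded_fm (FLess s t)"
| "bounded_fm (FMem t X)"
| "bounded_fm \<phi> \<Longrightarrow> bounded_fm (Neg \<phi>)"
| "bounded_fm \<phi> \<Longrightarrow> bounded_fm \<psi> \<Longrightarrow> bounded_fm (Conj \<phi> \<psi>)"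
| "bounded_fm \<phi> \<Longrightarrow> x \<notin> tm_vars t \<Longrightarrow> bounded_fm (ExN x (Conj (FLess (NVar x) t) \<phi>))"

definition Sigma01 :: "fm set" where
  "Sigma01 = {ExN x \<theta> | x \<theta>. bounded_fm \<theta>}"

definition Pi01 :: "fm set" where
  "Pi01 = {AllN x \<theta> | x \<theta>. bounded_fm \<theta>}"


section \<open>The system RCA0\<close>

definition basic_axioms :: "'m l2 \<Rightarrow> bool" where
  "basic_axioms M \<longleftrightarrow>
     (\<forall>a. a \<oplus>\<^bsub>M\<^esub> \<one>\<^bsub>M\<^esub> \<noteq> \<zero>\<^bsub>M\<^esub>) \<and>
     (\<forall>a b. a \<oplus>\<^bsub>M\<^esub> \<one>\<^bsub>M\<^esub> = b \<oplus>\<^bsub>M\<^esub> \<one>\<^bsub>M\<^esub> \<longrightarrow> a = b) \<and>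
     (\<forall>a. a \<oplus>\<^bsub>M\<^esub> \<zero>\<^bsub>M\<^esub> = a) \<and>
     (\<forall>a b. a \<oplus>\<^bsub>M\<^esub> (b \<oplus>\<^bsub>M\<^esub> \<one>\<^bsub>M\<^esub>) = (a \<oplus>\<^bsub>M\<^esub> b) \<oplus>\<^bsub>M\<^esub> \<one>\<^bsub>M\<^esub>) \<and>
     (\<forall>a. a \<otimes>\<^bsub>M\<^esub> \<zero>\<^bsub>M\<^esub> = \<zero>\<^bsub>M\<^esub>) \<and>
     (\<forall>a b. a \<otimes>\<^bsub>M\<^esub> (b \<oplus>\<^bsub>M\<^esub> \<one>\<^bsub>M\<^esub>) = (a \<otimes>\<^bsub>M\<^esub> b) \<oplus>\<^bsub>M\<^esub> a) \<and>
     (\<forall>a. \<not> a \<prec>\<^bsub>M\<^esub> \<zero>\<^bsub>M\<^esub>) \<and>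
     (\<forall>a b. a \<prec>\<^bsub>M\<^esub> b \<oplus>\<^bsub>M\<^esub> \<one>\<^bsub>M\<^esub> \<longleftrightarrow> a \<prec>\<^bsub>M\<^esub> b \<or> a = b)"

text \<open>
  In both schemes the valuations \<open>e\<close> and \<open>F\<close> supply the number and set parameters of the formulas.
\<close>

definition Sigma01_induction :: "'m l2 \<Rightarrow> bool" where
  "Sigma01_induction M \<longleftrightarrow>
     (\<forall>\<phi>\<in>Sigma01. \<forall>x e F. range F \<subseteq> Sets M \<longrightarrow>
        sat M (e(x := \<zero>\<^bsub>M\<^esub>)) F \<phi> \<longrightarrow>
        (\<forall>a. sat M (e(x := a)) F \<phi> \<longrightarrow> sat M (e(x := a \<oplus>\<^bsub>M\<^esub> \<one>\<^bsub>M\<^esub>)) F \<phi>) \<longrightarrow>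
        (\<forall>a. sat M (e(x := a)) F \<phi>))"

definition Delta01_comprehension :: "'m l2 \<Rightarrow> bool" where
  "Delta01_comprehension M \<longleftrightarrow>
     (\<forall>\<phi>\<in>Sigma01. \<forall>\<psi>\<in>Pi01. \<forall>x e F. range F \<subseteq> Sets M \<longrightarrow>
        (\<forall>a. sat M (e(x := a)) F \<phi> \<longleftrightarrow> sat M (e(x := a)) F \<psi>) \<longrightarrow>
        {a. sat M (e(x := a)) F \<phi>} \<in> Sets M)"

text \<open>
  Both sorts of a structure are nonempty. For the numbers this is built into HOL; for the sets it
  is stated here, since with \<open>Sets M = {}\<close> there would be no valuation \<open>F\<close> at all.
\<close>

definition RCA0 :: "'m l2 \<Rightarrow> bool" where
  "RCA0 M \<longleftrightarrow>
     Sets M \<noteq> {} \<and> basic_axioms M \<and> Sigma01_induction M \<and> Delta01_comprehension M"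


section \<open>Coding in a structure\<close>

text \<open>
  From here on every notion is the interpretation in the structure \<open>M\<close> of a formula of
  second-order arithmetic: functions, colorings, partitions, trees and paths are elements of
  \<open>Sets M\<close>, and finite sequences are (possibly nonstandard) elements of \<open>'m\<close>.
\<close>

definition le :: "'m l2 \<Rightarrow> 'm \<Rightarrow> 'm \<Rightarrow> bool" where
  "le M a b \<longleftrightarrow> a \<prec>\<^bsub>M\<^esub> b \<or> a = b"

definition divides :: "'m l2 \<Rightarrow> 'm \<Rightarrow> 'm \<Rightarrow> bool" where
  "divides M d a \<longleftrightarrow> (\<exists>q. a = d \<otimes>\<^bsub>M\<^esub> q)"

text \<open>The pairing map \<open>(a, b) \<mapsto> (a + b)\<^sup>2 + a\<close>.\<close>

definition pair :: "'m l2 \<Rightarrow> 'm \<Rightarrow> 'm \<Rightarrow> 'm" where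
  "pair M a b = (a \<oplus>\<^bsub>M\<^esub> b) \<otimes>\<^bsub>M\<^esub> (a \<oplus>\<^bsub>M\<^esub> b) \<oplus>\<^bsub>M\<^esub> a"

definition is_fun :: "'m l2 \<Rightarrow> 'm set \<Rightarrow> 'm set \<Rightarrow> 'm set \<Rightarrow> bool" where
  "is_fun M X Y f \<longleftrightarrow>
     f \<in> Sets M \<and> f \<subseteq> {pair M x y | x y. x \<in> X \<and> y \<in> Y} \<and>
     (\<forall>x\<in>X. \<exists>!y. pair M x y \<in> f)"

text \<open>
  Simpson's coding of finite sets: the triple \<open>(k, (m, n))\<close> represents the set of all \<open>i < k\<close> such
  that \<open>m(i + 1) + 1\<close> divides \<open>n\<close>, and the code of a finite set is the least triple representing it.
\<close>

definition is_triple :: "'m l2 \<Rightarrow> 'm \<Rightarrow> bool" where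
  "is_triple M c \<longleftrightarrow> (\<exists>k m n. c = pair M k (pair M m n))"

definition fin_elem :: "'m l2 \<Rightarrow> 'm \<Rightarrow> 'm \<Rightarrow> bool" where
  "fin_elem M c i \<longleftrightarrow>
     (\<exists>k m n. c = pair M k (pair M m n) \<and> i \<prec>\<^bsub>M\<^esub> k \<and>
        divides M (m \<otimes>\<^bsub>M\<^esub> (i \<oplus>\<^bsub>M\<^esub> \<one>\<^bsub>M\<^esub>) \<oplus>\<^bsub>M\<^esub> \<one>\<^bsub>M\<^esub>) n)"

definition fin_code :: "'m l2 \<Rightarrow> 'm \<Rightarrow> bool" where
  "fin_code M c \<longleftrightarrow>
     is_triple M c \<and>
     (\<forall>c'. c' \<prec>\<^bsub>M\<^esub> c \<longrightarrow> is_triple M c' \<longrightarrow> \<not> (\<forall>i. fin_elem M c' i \<longleftrightarrow> fin_elem M c i))"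

text \<open>A finite sequence of length \<open>l\<close> is a finite function with domain \<open>{i. i < l}\<close>.\<close>

definition entry :: "'m l2 \<Rightarrow> 'm \<Rightarrow> 'm \<Rightarrow> 'm \<Rightarrow> bool" where
  "entry M s i x \<longleftrightarrow> fin_elem M s (pair M i x)"

definition is_seq :: "'m l2 \<Rightarrow> 'm \<Rightarrow> 'm \<Rightarrow> bool" where
  "is_seq M s l \<longleftrightarrow>
     fin_code M s \<and>
     (\<forall>z. fin_elem M s z \<longrightarrow> (\<exists>i x. i \<prec>\<^bsub>M\<^esub> l \<and> z = pair M i x)) \<and>
     (\<forall>i. i \<prec>\<^bsub>M\<^esub> l \<longrightarrow> (\<exists>!x. entry M s i x))"

definition initial_segment :: "'m l2 \<Rightarrow> 'm \<Rightarrow> 'm \<Rightarrow> bool" where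
  "initial_segment M s t \<longleftrightarrow>
     (\<exists>k l. is_seq M s k \<and> is_seq M t l \<and> le M k l \<and>
        (\<forall>i. i \<prec>\<^bsub>M\<^esub> k \<longrightarrow> (\<forall>x. entry M s i x \<longleftrightarrow> entry M t i x)))"


section \<open>Weak Koenig's lemma\<close>

definition binary_seq :: "'m l2 \<Rightarrow> 'm \<Rightarrow> bool" where
  "binary_seq M s \<longleftrightarrow>
     (\<exists>l. is_seq M s l) \<and> (\<forall>i x. entry M s i x \<longrightarrow> x = \<zero>\<^bsub>M\<^esub> \<or> x = \<one>\<^bsub>M\<^esub>)"

definition binary_tree :: "'m l2 \<Rightarrow> 'm set \<Rightarrow> bool" where
  "binary_tree M T \<longleftrightarrow>
     T \<in> Sets M \<and> (\<forall>t\<in>T. binary_seq M t) \<and> (\<forall>t\<in>T. \<forall>s. initial_segment M s t \<longrightarrow> s \<in> T)"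

text \<open>Infinite in the sense of \<open>M\<close>, that is, unbounded.\<close>

definition infinite_in :: "'m l2 \<Rightarrow> 'm set \<Rightarrow> bool" where
  "infinite_in M X \<longleftrightarrow> (\<forall>k. \<exists>a\<in>X. k \<prec>\<^bsub>M\<^esub> a)"

definition infinite_path :: "'m l2 \<Rightarrow> 'm set \<Rightarrow> 'm set \<Rightarrow> bool" where
  "infinite_path M T f \<longleftrightarrow>
     is_fun M UNIV {\<zero>\<^bsub>M\<^esub>, \<one>\<^bsub>M\<^esub>} f \<and>
     (\<forall>l. \<exists>t\<in>T. is_seq M t l \<and>
        (\<forall>i. i \<prec>\<^bsub>M\<^esub> l \<longrightarrow> (\<forall>x. entry M t i x \<longleftrightarrow> pair M i x \<in> f)))"

definition weak_Koenig :: "'m l2 \<Rightarrow> bool" where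
  "weak_Koenig M \<longleftrightarrow>
     (\<forall>T. binary_tree M T \<and> infinite_in M T \<longrightarrow> (\<exists>f. infinite_path M T f))"

definition WKL0 :: "'m l2 \<Rightarrow> bool" where
  "WKL0 M \<longleftrightarrow> RCA0 M \<and> weak_Koenig M"


section \<open>Graphs and edge colorings\<close>

definition adj :: "'m l2 \<Rightarrow> 'm set \<Rightarrow> 'm \<Rightarrow> 'm \<Rightarrow> bool" where
  "adj M E v w \<longleftrightarrow> pair M (pair M v w) \<one>\<^bsub>M\<^esub> \<in> E"

definition countable_graph :: "'m l2 \<Rightarrow> 'm set \<Rightarrow> bool" where
  "countable_graph M E \<longleftrightarrow>
     is_fun M {pair M v w | v w. True} {\<zero>\<^bsub>M\<^esub>, \<one>\<^bsub>M\<^esub>} E \<and>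
     (\<forall>v w. adj M E v w \<longrightarrow> adj M E w v) \<and> (\<forall>v. \<not> adj M E v v)"

definition bounded_graph :: "'m l2 \<Rightarrow> 'm set \<Rightarrow> bool" where
  "bounded_graph M E \<longleftrightarrow>
     (\<exists>f. is_fun M UNIV UNIV f \<and>
        (\<forall>v w b. adj M E v w \<longrightarrow> pair M v b \<in> f \<longrightarrow> le M w b))"

definition bipartite :: "'m l2 \<Rightarrow> 'm set \<Rightarrow> bool" where
  "bipartite M E \<longleftrightarrow>
     (\<exists>A\<in>Sets M. \<exists>B\<in>Sets M. A \<union> B = UNIV \<and> A \<inter> B = {} \<and>
        (\<forall>v w. adj M E v w \<longrightarrow> (v \<in> A \<and> w \<in> B) \<or> (v \<in> B \<and> w \<in> A)))"

text \<open>
  The degree of \<open>v\<close> is \<open>d\<close> if some finite sequence of length \<open>d\<close> lists the neighbors of \<open>v\<close>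
  without repetition.
\<close>

definition has_degree :: "'m l2 \<Rightarrow> 'm set \<Rightarrow> 'm \<Rightarrow> 'm \<Rightarrow> bool" where
  "has_degree M E v d \<longleftrightarrow>
     (\<exists>s. is_seq M s d \<and>
        (\<forall>w. adj M E v w \<longleftrightarrow> (\<exists>i. entry M s i w)) \<and>
        (\<forall>i j w. entry M s i w \<and> entry M s j w \<longrightarrow> i = j))"

definition degrees_at_most :: "'m l2 \<Rightarrow> 'm set \<Rightarrow> 'm \<Rightarrow> bool" where
  "degrees_at_most M E n \<longleftrightarrow> (\<forall>v. \<exists>d. has_degree M E v d \<and> le M d n)"

text \<open>
  An edge is given by either of its orientations, so an edge coloring is a symmetric function on
  the pairs \<open>(v, w)\<close> of adjacent vertices, with values in \<open>{1, ..., k}\<close>.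
\<close>

definition proper_edge_coloring :: "'m l2 \<Rightarrow> 'm set \<Rightarrow> 'm \<Rightarrow> 'm set \<Rightarrow> bool" where
  "proper_edge_coloring M E k C \<longleftrightarrow>
     is_fun M {pair M v w | v w. adj M E v w} {c. le M \<one>\<^bsub>M\<^esub> c \<and> le M c k} C \<and>
     (\<forall>v w c. pair M (pair M v w) c \<in> C \<longrightarrow> pair M (pair M w v) c \<in> C) \<and>
     (\<forall>v w w' c. pair M (pair M v w) c \<in> C \<and> pair M (pair M v w') c \<in> C \<longrightarrow> w = w')"

definition chromatic_index_le :: "'m l2 \<Rightarrow> 'm set \<Rightarrow> 'm \<Rightarrow> bool" where
  "chromatic_index_le M E k \<longleftrightarrow> (\<exists>C. proper_edge_coloring M E k C)"

end

theory Submission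
  imports Defs
begin

text \<open>
  For WKL0 implying (2): binary sequences that describe colorings of finite parts of the graph form
  a binary tree. It is infinite by Koenig's edge coloring theorem for finite bipartite graphs,
  which a \<open>\<Sigma>\<^sub>1\<close> induction on the number of edges proves inside the model: to color a new edge
  \<open>vw\<close>, the colors \<open>\<alpha>\<close> free at \<open>v\<close> and \<open>\<beta>\<close> free at \<open>w\<close> are swapped on the Kempe chain from \<open>w\<close>.
  A path through the tree is a coloring of the whole graph.

  For (3) implying WKL0: a graph of degree at most 2 encodes for each \<open>x\<close> a race between witnesses
  of two disjoint \<open>\<Sigma>\<^sub>1\<close> sets. A ray and a two-way infinite line are built in parallel, and the first
  witness to appear decides which of the two ends of the line is attached to the ray. Colors alternate
  along paths, so a 2-coloring separates the two sets. Separating the nodes whose left subtree dies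
  first from those whose right subtree dies first yields a path through an infinite binary tree.
\<close>

text \<open>The model may be nonstandard, so HOL's own induction and finite sets say nothing about
  its numbers. Every object has to be a set of the model or a code in it, and every induction has to
  be \<open>\<Sigma>\<^sub>1\<close> or \<open>\<Pi>\<^sub>1\<close> over a recursive matrix. This
  is the purpose of the calculus of \<open>rec\<close> and \<open>recf\<close>: \<open>rec P\<close>
  says that the extension of \<open>P\<close> belongs to the model. Codes of finite sets come from a
  least number argument, the Kempe chain is a minimal closed finite set rather than an iteration,
  and free colors come from a pigeonhole principle inside the model.

  In the reversal the graph and its neighbor bound must be decidable before it is known whether a
  witness will ever appear. Heights on the rays act as search stages, so adjacency only inspects
  stages below the heights concerned. The middle vertex of the line forces its two arms to start
  with different colors; hence the first edge of the ray always agrees with exactly one arm, and the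
  answer can be read off at height 0 however high the attachment lies.\<close>

named_theorems rec_intro

abbreviation (input) TPair :: "tm \<Rightarrow> tm \<Rightarrow> tm" where
  "TPair s t \<equiv> TAdd (TMul (TAdd s t) (TAdd s t)) s"

text \<open>The bound \<open>t + 1\<close> lets the variable range over all values \<le>
  \<open>t\<close>: components of a pair are at most the pair, possibly equal to it.\<close>

abbreviation (input) ExB :: "nat \<Rightarrow> tm \<Rightarrow> fm \<Rightarrow> fm" where
  "ExB x t \<phi> \<equiv> ExN x (Conj (FLess (NVar x) (TAdd t TOne)) \<phi>)"

section \<open>Arithmetic in a model of RCA0\<close>


locale rca =
  fixes M :: "'m l2" (structure)
  assumes RCA0: "RCA0 M"
begin

abbreviation le_M (infix "\<preceq>" 50) where "a \<preceq> b \<equiv> le M a b"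

text \<open>Semantic form of the scheme with fixed variables: 0 is the induction variable, 1 the
  witness. A use only has to evaluate one formula by simplification to the relation
  \<open>R\<close>.\<close>

lemma sigma_induct:
  assumes "bounded_fm \<theta>" "range F \<subseteq> Sets M"
    and R: "\<And>a y. sat M (e(0 := a, 1 := y)) F \<theta> \<longleftrightarrow> R a y"
    and 0: "\<exists>y. R \<zero> y" and Suc: "\<And>a y. R a y \<Longrightarrow> \<exists>y. R (a \<oplus> \<one>) y"
  shows "\<exists>y. R a y"
proof -
  have "ExN 1 \<theta> \<in> Sigma01" using assms(1) by (auto simp: Sigma01_def)
  then have *: "sat M (e(0 := \<zero>)) F (ExN 1 \<theta>) \<longrightarrow>
      (\<forall>a. sat M (e(0 := a)) F (ExN 1 \<theta>) \<longrightarrow> sat M (e(0 := a \<oplus> \<one>)) F (ExN 1 \<theta>)) \<longrightarrow>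
      (\<forall>a. sat M (e(0 := a)) F (ExN 1 \<theta>))"
    using RCA0 assms(2) unfolding RCA0_def Sigma01_induction_def by blast
  moreover have "sat M (e(0 := a)) F (ExN 1 \<theta>) \<longleftrightarrow> (\<exists>y. R a y)" for a
    using R by (simp add: fun_upd_def)
  ultimately have "(\<exists>y. R \<zero> y) \<longrightarrow> (\<forall>a. (\<exists>y. R a y) \<longrightarrow> (\<exists>y. R (a \<oplus> \<one>) y)) \<longrightarrow> (\<forall>a. \<exists>y. R a y)"
    by (simp only: )
  then show ?thesis using 0 Suc by blast
qed

lemma delta_comprehension:
  assumes "bounded_fm \<theta>" "bounded_fm \<eta>" "range F \<subseteq> Sets M"
    and R: "\<And>a y. sat M (e(0 := a, 1 := y)) F \<theta> \<longleftrightarrow> R a y"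
    and S: "\<And>a y. sat M (e(0 := a, 1 := y)) F \<eta> \<longleftrightarrow> S a y"
    and eq: "\<And>a. (\<exists>y. R a y) \<longleftrightarrow> (\<forall>y. S a y)"
  shows "{a. \<exists>y. R a y} \<in> Sets M"
proof -
  have "ExN 1 \<theta> \<in> Sigma01" "AllN 1 \<eta> \<in> Pi01" using assms by (auto simp: Sigma01_def Pi01_def)
  then have *: "(\<forall>a. sat M (e(0 := a)) F (ExN 1 \<theta>) \<longleftrightarrow> sat M (e(0 := a)) F (AllN 1 \<eta>)) \<longrightarrow>
      {a. sat M (e(0 := a)) F (ExN 1 \<theta>)} \<in> Sets M"
    using RCA0 assms(3) unfolding RCA0_def Delta01_comprehension_def by blast
  moreover have "sat M (e(0 := a)) F (ExN 1 \<theta>) \<longleftrightarrow> (\<exists>y. R a y)" for a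
    using R by (simp add: fun_upd_def)
  moreover have "sat M (e(0 := a)) F (AllN 1 \<eta>) \<longleftrightarrow> (\<forall>y. S a y)" for a
    using S by (simp add: fun_upd_def AllN_def)
  ultimately show ?thesis using eq by (simp only: simp_thms)
qed

lemma ex_set: "\<exists>A. A \<in> Sets M"
  using RCA0 by (auto simp: RCA0_def)

text \<open>The witness variable is a dummy, and the set valuation is constant at some set, which
  exists because the set sort is nonempty.\<close>

lemma bounded_induct:
  assumes "bounded_fm \<theta>"
    and R: "\<And>F a y. sat M (e(0 := a, 1 := y)) F \<theta> \<longleftrightarrow> R a"
    and "R \<zero>" and "\<And>a. R a \<Longrightarrow> R (a \<oplus> \<one>)"
  shows "R a"
proof -
  obtain A where "A \<in> Sets M" using ex_set by blast
  then have "range (\<lambda>_. A) \<subseteq> Sets M" by blast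
  from sigma_induct[OF assms(1) this, of e "\<lambda>a y. R a"] show ?thesis
    using R assms(3,4) by blast
qed

lemma
  shows succ_neq_zero: "a \<oplus> \<one> \<noteq> \<zero>"
    and succ_inject: "a \<oplus> \<one> = b \<oplus> \<one> \<longleftrightarrow> a = b"
    and add_zero: "a \<oplus> \<zero> = a"
    and add_succ: "a \<oplus> (b \<oplus> \<one>) = (a \<oplus> b) \<oplus> \<one>"
    and mul_zero: "a \<otimes> \<zero> = \<zero>"
    and mul_succ: "a \<otimes> (b \<oplus> \<one>) = (a \<otimes> b) \<oplus> a"
    and not_less_zero: "\<not> a \<prec> \<zero>"
    and less_succ: "a \<prec> b \<oplus> \<one> \<longleftrightarrow> a \<prec> b \<or> a = b"
  using RCA0 unfolding RCA0_def basic_axioms_def by blast+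

abbreviation (input) "x0 \<equiv> NVar 0"
abbreviation (input) "x1 \<equiv> NVar 1"
abbreviation (input) "x2 \<equiv> NVar 2"
abbreviation (input) "x3 \<equiv> NVar 3"

text \<open>Variables 0 and 1 are reserved for induction variable and witness, so two number
  parameters sit at 2 and 3.\<close>

definition env :: "'m \<Rightarrow> 'm \<Rightarrow> nat \<Rightarrow> 'm" where
  "env a b = (\<lambda>i. if i = 2 then a else b)"

lemmas formula_simps = bounded_fm.intros env_def fun_upd_def

section \<open>Semiring laws\<close>

lemma add_assoc: "(a \<oplus> b) \<oplus> c = a \<oplus> (b \<oplus> c)"
  by (rule bounded_induct[where \<theta> = "FEq (TAdd (TAdd x2 x3) x0) (TAdd x2 (TAdd x3 x0))" and e = "env a b"])
    (simp_all add: formula_simps add_zero add_succ)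

lemma zero_add: "\<zero> \<oplus> a = a"
  by (rule bounded_induct[where \<theta> = "FEq (TAdd TZero x0) x0" and e = "env a b"])
    (simp_all add: formula_simps add_zero add_succ)

lemma succ_add: "(a \<oplus> \<one>) \<oplus> b = (a \<oplus> b) \<oplus> \<one>"
  by (rule bounded_induct[where \<theta> = "FEq (TAdd (TAdd x2 TOne) x0) (TAdd (TAdd x2 x0) TOne)" and e = "env a b"])
    (simp_all add: formula_simps add_zero add_succ)

lemma add_comm: "a \<oplus> b = b \<oplus> a"
  by (rule bounded_induct[where \<theta> = "FEq (TAdd x2 x0) (TAdd x0 x2)" and e = "env a b"])
    (simp_all add: formula_simps add_zero add_succ zero_add succ_add)

lemma distrib_left: "a \<otimes> (b \<oplus> c) = (a \<otimes> b) \<oplus> (a \<otimes> c)"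
  by (rule bounded_induct[where \<theta> = "FEq (TMul x2 (TAdd x3 x0)) (TAdd (TMul x2 x3) (TMul x2 x0))" and e = "env a b"])
    (simp_all add: formula_simps add_zero add_succ mul_zero mul_succ add_assoc [symmetric])

lemma zero_mul: "\<zero> \<otimes> a = \<zero>"
  by (rule bounded_induct[where \<theta> = "FEq (TMul TZero x0) TZero" and e = "env a b"])
    (simp_all add: formula_simps add_zero mul_zero mul_succ)

lemma add_left_comm: "a \<oplus> (b \<oplus> c) = b \<oplus> (a \<oplus> c)"
  by (metis add_assoc add_comm)

lemma distrib_right: "(a \<oplus> b) \<otimes> c = (a \<otimes> c) \<oplus> (b \<otimes> c)"
  by (rule bounded_induct[where \<theta> = "FEq (TMul (TAdd x2 x3) x0) (TAdd (TMul x2 x0) (TMul x3 x0))" and e = "env a b"])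
    (simp_all add: formula_simps add_zero mul_zero mul_succ, simp add: add_assoc add_left_comm)

lemma mul_one: "a \<otimes> \<one> = a"
  using mul_succ[of a \<zero>] by (simp add: zero_add mul_zero)

lemma mul_assoc: "(a \<otimes> b) \<otimes> c = a \<otimes> (b \<otimes> c)"
  by (rule bounded_induct[where \<theta> = "FEq (TMul (TMul x2 x3) x0) (TMul x2 (TMul x3 x0))" and e = "env a b" and R = "\<lambda>c. (a \<otimes> b) \<otimes> c = a \<otimes> (b \<otimes> c)"])
    (simp_all add: formula_simps mul_zero mul_one distrib_left)

lemma one_mul: "\<one> \<otimes> a = a"
  by (rule bounded_induct[where \<theta> = "FEq (TMul TOne x0) x0" and e = "env a b"])
    (simp_all add: formula_simps mul_zero mul_succ)

lemma mul_comm: "a \<otimes> b = b \<otimes> a"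
  by (rule bounded_induct[where \<theta> = "FEq (TMul x2 x0) (TMul x0 x2)" and e = "env a b"])
    (simp_all add: formula_simps mul_zero mul_succ zero_mul distrib_right one_mul)

lemma add_cancel: "a \<oplus> c = b \<oplus> c \<longleftrightarrow> a = b"
proof -
  have "a \<oplus> c = b \<oplus> c \<longrightarrow> a = b"
    by (rule bounded_induct[where \<theta> = "Neg (Conj (FEq (TAdd x2 x0) (TAdd x3 x0)) (Neg (FEq x2 x3)))" and e = "env a b"])
      (simp_all add: formula_simps add_zero add_succ succ_inject)
  then show ?thesis by auto
qed

section \<open>The order and truncated subtraction\<close>

lemma less_iff: "a \<prec> b \<longleftrightarrow> (\<exists>d. (a \<oplus> d) \<oplus> \<one> = b)"
proof
  obtain A where A: "A \<in> Sets M" using ex_set by blast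
  \<comment> \<open>The quantifier is pulled in front of the implication, which makes the induction
    formula \<open>\<Sigma>\<^sub>1\<close>.\<close>
  have "\<exists>d. (a \<prec> b \<longrightarrow> (a \<oplus> d) \<oplus> \<one> = b)"
  proof (rule sigma_induct[where \<theta> = "Neg (Conj (FLess x2 x0) (Neg (FEq (TAdd (TAdd x2 x1) TOne) x0)))" and e = "env a b" and F = "\<lambda>_. A"])
    fix b d assume "a \<prec> b \<longrightarrow> a \<oplus> d \<oplus> \<one> = b"
    then show "\<exists>d. a \<prec> b \<oplus> \<one> \<longrightarrow> a \<oplus> d \<oplus> \<one> = b \<oplus> \<one>"
      unfolding less_succ by (metis add_zero add_succ)
  qed (auto simp: formula_simps A not_less_zero)
  then show "a \<prec> b \<Longrightarrow> \<exists>d. (a \<oplus> d) \<oplus> \<one> = b" by blast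
next
  have "a \<prec> (a \<oplus> d) \<oplus> \<one>" for d
    by (rule bounded_induct[where \<theta> = "FLess x2 (TAdd (TAdd x2 x0) TOne)" and e = "env a b"])
      (simp_all add: formula_simps add_zero add_succ less_succ)
  then show "\<exists>d. (a \<oplus> d) \<oplus> \<one> = b \<Longrightarrow> a \<prec> b" by blast
qed

lemma zero_or_succ: "a = \<zero> \<or> (\<exists>b. a = b \<oplus> \<one>)"
proof -
  obtain A where A: "A \<in> Sets M" using ex_set by blast
  have "\<exists>b. a = \<zero> \<or> a = b \<oplus> \<one>"
    by (rule sigma_induct[where \<theta> = "Neg (Conj (Neg (FEq x0 TZero)) (Neg (FEq x0 (TAdd x1 TOne))))" and e = "env a a" and F = "\<lambda>_. A"])
      (auto simp: formula_simps A)
  then show ?thesis by blast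
qed

lemma less_total: "a \<prec> b \<or> a = b \<or> b \<prec> a"
proof -
  have "\<not> (\<not> a \<prec> b \<and> a \<noteq> b \<and> \<not> b \<prec> a)"
  proof (rule bounded_induct[where \<theta> = "Neg (Conj (Neg (FLess x2 x0)) (Conj (Neg (FEq x2 x0)) (Neg (FLess x0 x2))))" and e = "env a b"
        and R = "\<lambda>b. \<not> (\<not> a \<prec> b \<and> a \<noteq> b \<and> \<not> b \<prec> a)"])
    show "\<not> (\<not> a \<prec> \<zero> \<and> a \<noteq> \<zero> \<and> \<not> \<zero> \<prec> a)"
      using zero_or_succ[of a] by (metis less_iff zero_add)
    fix b assume "\<not> (\<not> a \<prec> b \<and> a \<noteq> b \<and> \<not> b \<prec> a)"
    then consider "a \<prec> b" | "a = b" | "b \<prec> a" by blast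
    then show "\<not> (\<not> a \<prec> b \<oplus> \<one> \<and> a \<noteq> b \<oplus> \<one> \<and> \<not> b \<oplus> \<one> \<prec> a)"
    proof cases
      case 3
      then obtain d where "(b \<oplus> d) \<oplus> \<one> = a" using less_iff by blast
      then show ?thesis using zero_or_succ[of d] by (metis less_iff add_zero succ_add add_succ)
    qed (auto simp: less_succ)
  qed (auto simp: formula_simps)
  then show ?thesis by blast
qed

lemma le_iff_add: "a \<preceq> b \<longleftrightarrow> (\<exists>d. a \<oplus> d = b)"
  unfolding le_def less_iff using zero_or_succ by (metis add_zero add_succ)

lemma less_irrefl: "\<not> a \<prec> a"
  unfolding less_iff by (metis succ_neq_zero add_succ add_cancel add_comm zero_add)

lemma less_trans: "a \<prec> b \<Longrightarrow> b \<prec> c \<Longrightarrow> a \<prec> c"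
  unfolding less_iff by (metis add_succ add_assoc)

text \<open>Truncated subtraction is part of the signature of \<open>linordered_semidom\<close>, so
  it must exist before that class can be interpreted.\<close>

definition minus_M (infixl "\<ominus>" 65) where
  "a \<ominus> b = (if b \<preceq> a then (THE d. b \<oplus> d = a) else \<zero>)"

lemma minus_eqI:
  assumes "b \<oplus> d = a"
  shows "a \<ominus> b = d"
proof -
  have "d' = d" if "b \<oplus> d' = a" for d'
    using add_cancel[of d' b d] assms that by (simp add: add_comm[of b])
  then have "(THE d. b \<oplus> d = a) = d" using assms by (rule the_equality[rotated])
  moreover have "b \<preceq> a" using assms le_iff_add by blast
  ultimately show ?thesis by (simp add: minus_M_def)
qed

lemma minus_zero_iff: "\<not> b \<preceq> a \<Longrightarrow> a \<ominus> b = \<zero>"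
  by (simp add: minus_M_def)

lemma less_le_M: "a \<prec> b \<longleftrightarrow> a \<preceq> b \<and> \<not> b \<preceq> a"
  unfolding le_def using less_irrefl less_trans less_total by blast

lemma minus_minus: "a \<ominus> b \<ominus> c = a \<ominus> (b \<oplus> c)"
proof (cases "b \<oplus> c \<preceq> a")
  case True
  then obtain d where "b \<oplus> c \<oplus> d = a" by (auto simp: le_iff_add)
  then have "b \<oplus> (c \<oplus> d) = a" "b \<oplus> c \<oplus> d = a" by (auto simp: add_assoc)
  then show ?thesis using minus_eqI by metis
next
  case False
  then have *: "a \<ominus> (b \<oplus> c) = \<zero>" by (rule minus_zero_iff)
  show ?thesis
  proof (cases "b \<preceq> a")
    case True
    then obtain d where d: "b \<oplus> d = a" by (auto simp: le_iff_add)
    then have "\<not> c \<preceq> d" using False by (auto simp: le_iff_add add_assoc)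
    then show ?thesis using * minus_eqI[OF d] minus_zero_iff by simp
  next
    case False
    then have "a \<ominus> b = \<zero>" by (rule minus_zero_iff)
    moreover have "\<zero> \<ominus> c = \<zero>"
      by (metis le_iff_add minus_eqI minus_zero_iff zero_or_succ add_zero add_succ succ_neq_zero)
    ultimately show ?thesis using * by simp
  qed
qed

lemma mul_less: "a \<prec> b \<Longrightarrow> \<zero> \<prec> c \<Longrightarrow> c \<otimes> a \<prec> c \<otimes> b"
proof -
  assume "a \<prec> b" "\<zero> \<prec> c"
  then obtain d f where "(a \<oplus> d) \<oplus> \<one> = b" and f: "f \<oplus> \<one> = c" by (auto simp: less_iff zero_add)
  then have "c \<otimes> b = c \<otimes> a \<oplus> (c \<otimes> d \<oplus> f) \<oplus> \<one>"
    by (metis add_assoc distrib_left mul_succ)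
  then show ?thesis unfolding less_iff by metis
qed

lemma mul_minus: "a \<otimes> (b \<ominus> c) = a \<otimes> b \<ominus> a \<otimes> c"
proof (cases "c \<preceq> b")
  case True
  then obtain d where "c \<oplus> d = b" by (auto simp: le_iff_add)
  then show ?thesis using minus_eqI by (metis distrib_left)
next
  case False
  then have 1: "b \<ominus> c = \<zero>" "b \<prec> c" using minus_zero_iff less_total le_def by metis+
  show ?thesis
  proof (cases "a = \<zero>")
    case True then show ?thesis using 1 by (simp add: zero_mul mul_zero minus_eqI zero_add)
  next
    case False
    then have "a \<otimes> b \<prec> a \<otimes> c" using mul_less[OF 1(2)] not_less_zero less_total by metis
    then show ?thesis using 1 by (metis less_le_M minus_zero_iff mul_zero)
  qed
qed

lemma mul_eq_zero: "a \<otimes> b = \<zero> \<Longrightarrow> a = \<zero> \<or> b = \<zero>"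
  using zero_or_succ[of a] zero_or_succ[of b] by (auto simp: mul_succ add_succ succ_neq_zero)

lemma zero_neq_one: "\<zero> \<noteq> \<one>"
  using succ_neq_zero[of \<zero>] by (simp add: zero_add)

lemma zero_less_one: "\<zero> \<prec> \<one>"
  using less_succ[of \<zero> \<zero>] by (simp add: zero_add)

lemma add_le_cancel: "a \<oplus> b \<preceq> a \<oplus> c \<longleftrightarrow> b \<preceq> c"
proof -
  have "a \<oplus> b \<oplus> d = a \<oplus> c \<longleftrightarrow> b \<oplus> d = c" for d
    using add_cancel[of "b \<oplus> d" a c] by (simp only: add_assoc add_comm[of _ a])
  then show ?thesis by (simp only: le_iff_add)
qed

lemma minus_add: "b \<preceq> a \<Longrightarrow> a \<ominus> b \<oplus> b = a"
  using minus_eqI[of b _ a] by (metis le_iff_add add_comm)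

lemma le_trans: "a \<preceq> b \<Longrightarrow> b \<preceq> c \<Longrightarrow> a \<preceq> c"
  unfolding le_def using less_trans by blast

lemma le_antisym: "a \<preceq> b \<Longrightarrow> b \<preceq> a \<Longrightarrow> a = b"
  unfolding le_def using less_irrefl less_trans by blast

lemma le_total: "a \<preceq> b \<or> b \<preceq> a"
  unfolding le_def using less_total by blast

text \<open>Makes the library's arithmetic and simplification rules available for the numbers of the
  model.\<close>

lemma linordered_semidom: "class.linordered_semidom (\<oplus>) (\<ominus>) (\<preceq>) (\<prec>) \<zero> (\<otimes>) \<one>"
proof
  show "a \<oplus> b \<ominus> a = b" for a b by (simp add: minus_eqI)
  show "a \<otimes> b \<noteq> \<zero>" if "a \<noteq> \<zero>" "b \<noteq> \<zero>" for a b
    using that mul_eq_zero by blast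
  show "\<zero> \<noteq> \<one>" by (rule zero_neq_one)
  show "\<zero> \<prec> \<one>" by (rule zero_less_one)
  show "c \<oplus> a \<preceq> c \<oplus> b" if "a \<preceq> b" for a b c using that by (simp only: add_le_cancel)
  show "b \<preceq> a \<Longrightarrow> a \<ominus> b \<oplus> b = a" for a b by (rule minus_add)
  show "a \<preceq> b \<or> b \<preceq> a" for a b by (rule le_total)
  show "a \<preceq> b \<Longrightarrow> b \<preceq> c \<Longrightarrow> a \<preceq> c" for a b c by (rule le_trans)
  show "a \<preceq> b \<Longrightarrow> b \<preceq> a \<Longrightarrow> a = b" for a b by (rule le_antisym)
  show "a \<ominus> b \<ominus> c = a \<ominus> (b \<oplus> c)" for a b c by (rule minus_minus)
  show "a \<otimes> (b \<ominus> c) = a \<otimes> b \<ominus> a \<otimes> c" for a b c by (rule mul_minus)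
  show "a \<prec> b \<longleftrightarrow> a \<preceq> b \<and> \<not> b \<preceq> a" for a b by (rule less_le_M)
  show "a \<prec> b \<Longrightarrow> \<zero> \<prec> c \<Longrightarrow> c \<otimes> a \<prec> c \<otimes> b" for a b c by (rule mul_less)
  show "a \<oplus> b \<oplus> c = a \<oplus> (b \<oplus> c)" for a b c by (rule add_assoc)
  show "a \<otimes> b \<otimes> c = a \<otimes> (b \<otimes> c)" for a b c by (rule mul_assoc)
  show "a \<oplus> b = b \<oplus> a" for a b by (rule add_comm)
  show "a \<otimes> b = b \<otimes> a" for a b by (rule mul_comm)
  show "(a \<oplus> b) \<otimes> c = a \<otimes> c \<oplus> b \<otimes> c" for a b c by (rule distrib_right)
qed (simp_all only: zero_add one_mul le_def zero_mul mul_zero distrib_left simp_thms)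

sublocale ar: linordered_semidom "(\<oplus>)" "(\<ominus>)" "(\<preceq>)" "(\<prec>)" \<zero> "(\<otimes>)" \<one>
  rewrites "dvd.dvd (\<otimes>) = divides M"
proof -
  show "class.linordered_semidom (\<oplus>) (\<ominus>) (\<preceq>) (\<prec>) \<zero> (\<otimes>) \<one>"
    by (rule linordered_semidom)
  show "dvd.dvd (\<otimes>) = divides M"
    by (intro ext) (simp add: divides_def dvd.dvd_def)
qed

section \<open>Recursive relations and functions\<close>

abbreviation pair_M ("\<langle>_,/ _\<rangle>") where "\<langle>a, b\<rangle> \<equiv> pair M a b"

text \<open>Otherwise simplification would turn \<open>\<one> \<oplus> \<one>\<close>, the degree
  bound of the final statement, into a numeral.\<close>

declare ar.one_add_one [simp del]

lemma less_succ_le: "a \<prec> b \<oplus> \<one> \<longleftrightarrow> a \<preceq> b"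
  by (simp add: less_succ le_def)

lemma succ_le: "a \<oplus> \<one> \<preceq> b \<longleftrightarrow> a \<prec> b"
  by (metis ar.not_less less_succ_le)

lemma zero_le [simp]: "\<zero> \<preceq> a"
  by (simp add: le_iff_add zero_add)

lemma le_add1 [simp]: "a \<preceq> a \<oplus> b" and le_add2 [simp]: "a \<preceq> b \<oplus> a"
  by (auto simp: le_iff_add add_comm)

lemma le_zero [simp]: "a \<preceq> \<zero> \<longleftrightarrow> a = \<zero>"
  using not_less_zero by (auto simp: le_def)

lemma le_mul_self: "a \<preceq> a \<otimes> a"
proof -
  from zero_or_succ[of a] consider "a = \<zero>" | b where "a = b \<oplus> \<one>" by blast
  then show ?thesis
  proof cases
    case 2
    then have "a \<otimes> a = a \<otimes> b \<oplus> a" by (simp add: mul_succ)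
    then show ?thesis by simp
  qed simp
qed

section \<open>The pairing function and its projections\<close>

lemma fst_le_pair: "a \<preceq> \<langle>a, b\<rangle>"
  by (simp add: pair_def)

lemma snd_le_pair: "b \<preceq> \<langle>a, b\<rangle>"
  unfolding pair_def using le_mul_self le_add1 le_add2 le_trans by meson

lemma pair_le:
  "a \<preceq> \<langle>a, b\<rangle>" "b \<preceq> \<langle>a, b\<rangle>" "b \<preceq> \<langle>a, \<langle>b, c\<rangle>\<rangle>" "c \<preceq> \<langle>a, \<langle>b, c\<rangle>\<rangle>"
  "a \<preceq> \<langle>\<langle>a, b\<rangle>, c\<rangle>" "b \<preceq> \<langle>\<langle>a, b\<rangle>, c\<rangle>"
  using fst_le_pair snd_le_pair le_trans by blast+

lemma pair_mono: "a \<preceq> a' \<Longrightarrow> b \<preceq> b' \<Longrightarrow> \<langle>a, b\<rangle> \<preceq> \<langle>a', b'\<rangle>"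
  unfolding pair_def by (intro ar.add_mono ar.mult_mono) simp_all

text \<open>With \<open>s = a + b\<close>, the code \<open>s * s + a\<close> lies strictly below the
  next square: the gap to it is \<open>s + b + 1\<close>. Thus pairs are ordered by their sums
  first, which also yields injectivity.\<close>

lemma pair_strict: "a \<oplus> b \<prec> c \<oplus> d \<Longrightarrow> \<langle>a, b\<rangle> \<prec> \<langle>c, d\<rangle>"
proof -
  assume "a \<oplus> b \<prec> c \<oplus> d"
  then have *: "(a \<oplus> b) \<oplus> \<one> \<preceq> c \<oplus> d" by (simp add: succ_le)
  have "\<langle>a, b\<rangle> \<prec> \<langle>a, b\<rangle> \<oplus> ((a \<oplus> b) \<oplus> b \<oplus> \<one>)"
    by (simp add: ar.add_nonneg_pos)
  also have "\<dots> = ((a \<oplus> b) \<oplus> \<one>) \<otimes> ((a \<oplus> b) \<oplus> \<one>)"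
    by (simp add: pair_def algebra_simps)
  also have "\<dots> \<preceq> (c \<oplus> d) \<otimes> (c \<oplus> d)"
    using * by (intro ar.mult_mono) simp_all
  also have "\<dots> \<preceq> \<langle>c, d\<rangle>" by (simp add: pair_def)
  finally show ?thesis .
qed

lemma pair_inject [simp]: "\<langle>a, b\<rangle> = \<langle>c, d\<rangle> \<longleftrightarrow> a = c \<and> b = d"
proof
  assume eq: "\<langle>a, b\<rangle> = \<langle>c, d\<rangle>"
  then have s: "a \<oplus> b = c \<oplus> d"
    using pair_strict[of a b c d] pair_strict[of c d a b] less_total[of "a \<oplus> b" "c \<oplus> d"] less_irrefl by metis
  then have "a = c" using eq by (simp add: pair_def)
  then show "a = c \<and> b = d" using s by simp
qed simp

text \<open>The pairing map is not onto; the value \<open>\<zero>\<close> off its range makes the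
  projections total.\<close>

definition p1 :: "'m \<Rightarrow> 'm" where
  "p1 x = (if \<exists>a b. x = \<langle>a, b\<rangle> then THE a. \<exists>b. x = \<langle>a, b\<rangle> else \<zero>)"

definition p2 :: "'m \<Rightarrow> 'm" where
  "p2 x = (if \<exists>a b. x = \<langle>a, b\<rangle> then THE b. \<exists>a. x = \<langle>a, b\<rangle> else \<zero>)"

lemma p1_pair [simp]: "p1 \<langle>a, b\<rangle> = a" and p2_pair [simp]: "p2 \<langle>a, b\<rangle> = b"
  by (auto simp: p1_def p2_def)

lemma
  assumes "\<nexists>a b. x = \<langle>a, b\<rangle>"
  shows p1_nonpair: "p1 x = \<zero>" and p2_nonpair: "p2 x = \<zero>"
  using assms by (simp_all add: p1_def p2_def)

lemma p1_le: "p1 x \<preceq> x"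
proof (cases "\<exists>a b. x = \<langle>a, b\<rangle>")
  case True then show ?thesis using fst_le_pair by auto
next
  case False then show ?thesis by (simp add: p1_def)
qed

text \<open>
  Relations and functions of several arguments are treated as unary ones by means of \<open>p1\<close> and \<open>p2\<close>,
  so that formulas are needed only for the base cases of one set of closure rules.
\<close>

definition rec :: "('m \<Rightarrow> bool) \<Rightarrow> bool" where
  "rec P \<longleftrightarrow> {x. P x} \<in> Sets M"

definition recf :: "('m \<Rightarrow> 'm) \<Rightarrow> bool" where
  "recf f \<longleftrightarrow> rec (\<lambda>p. \<exists>x. p = \<langle>x, f x\<rangle>)"

abbreviation rec2 :: "('m \<Rightarrow> 'm \<Rightarrow> bool) \<Rightarrow> bool" where
  "rec2 R \<equiv> rec (\<lambda>p. R (p1 p) (p2 p))"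

lemma tm_val_pair: "(a \<oplus> b) \<otimes> (a \<oplus> b) \<oplus> a = \<langle>a, b\<rangle>"
  by (simp add: pair_def)

lemma bounded_comprehension:
  assumes "bounded_fm \<theta>" "range F \<subseteq> Sets M"
    and R: "\<And>a y. sat M (e(0 := a, 1 := y)) F \<theta> \<longleftrightarrow> R a"
  shows "rec R"
  using delta_comprehension[OF assms(1,1,2), of e "\<lambda>a y. R a" "\<lambda>a y. R a"] R
  by (simp add: rec_def)

lemma env_simps [simp]: "env a b 2 = a" "env a b 3 = b"
  by (simp_all add: env_def)

definition senv :: "'m set \<Rightarrow> 'm set \<Rightarrow> nat \<Rightarrow> 'm set" where
  "senv A B i = (if i = 0 then A else B)"

lemma senv_simps [simp]: "senv A B 0 = A" "senv A B 1 = B" "senv A B (Suc 0) = B"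
  by (simp_all add: senv_def)

lemma senv_range: "A \<in> Sets M \<Longrightarrow> B \<in> Sets M \<Longrightarrow> range (senv A B) \<subseteq> Sets M"
  by (auto simp: senv_def)

lemmas fm_simps = bounded_fm.intros tm_val_pair less_succ_le

lemma rec_bounded:
  assumes "bounded_fm \<theta>" "rec P" "rec Q"
    and R: "\<And>a y. sat M ((env b c)(0 := a, 1 := y)) (senv {x. P x} {x. Q x}) \<theta> \<longleftrightarrow> R a"
  shows "rec R"
  using bounded_comprehension[OF assms(1) senv_range R] assms(2,3) by (simp add: rec_def)

lemma rec_delta:
  assumes "bounded_fm \<theta>" "bounded_fm \<eta>" "rec P" "rec Q"
    and "\<And>a y. sat M ((env b c)(0 := a, 1 := y)) (senv {x. P x} {x. Q x}) \<theta> \<longleftrightarrow> R a y"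
    and "\<And>a y. sat M ((env b c)(0 := a, 1 := y)) (senv {x. P x} {x. Q x}) \<eta> \<longleftrightarrow> S a y"
    and "\<And>a. (\<exists>y. R a y) \<longleftrightarrow> (\<forall>y. S a y)"
  shows "rec (\<lambda>a. \<exists>y. R a y)"
  using delta_comprehension[OF assms(1,2) senv_range assms(5-)] assms(3,4) by (simp add: rec_def)

lemma ex_rec: "\<exists>P. rec P"
  using ex_set unfolding rec_def by (metis Collect_mem_eq)

lemma rec_cong: "rec P \<Longrightarrow> (\<And>x. P x \<longleftrightarrow> Q x) \<Longrightarrow> rec Q"
  by (simp add: rec_def)

section \<open>Closure rules for recursive relations and functions\<close>

lemma rec_not [rec_intro]: "rec P \<Longrightarrow> rec (\<lambda>x. \<not> P x)"
  by (rule rec_bounded[where \<theta> = "Neg (FMem x0 0)"]) (auto simp: fm_simps)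

lemma rec_conj [rec_intro]: "rec P \<Longrightarrow> rec Q \<Longrightarrow> rec (\<lambda>x. P x \<and> Q x)"
  by (rule rec_bounded[where \<theta> = "Conj (FMem x0 0) (FMem x0 1)"]) (auto simp: fm_simps)

lemma rec_disj [rec_intro]: "rec P \<Longrightarrow> rec Q \<Longrightarrow> rec (\<lambda>x. P x \<or> Q x)"
  using rec_not[OF rec_conj[OF rec_not rec_not], of P Q] by simp

lemma rec_imp [rec_intro]: "rec P \<Longrightarrow> rec Q \<Longrightarrow> rec (\<lambda>x. P x \<longrightarrow> Q x)"
  using rec_disj[OF rec_not, of P Q] by simp

lemma rec_iff [rec_intro]: "rec P \<Longrightarrow> rec Q \<Longrightarrow> rec (\<lambda>x. P x \<longleftrightarrow> Q x)"
  using rec_conj[OF rec_imp[of P Q] rec_imp[of Q P]] by (simp add: iff_conv_conj_imp)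

text \<open>\<open>P (f x)\<close> is \<open>\<Delta>\<^sub>1\<close>: some value \<open>y\<close>
  of \<open>f\<close> at \<open>x\<close> satisfies \<open>P\<close>, equivalently every such
  \<open>y\<close> does. The same device handles the intermediate value in a composition.\<close>

lemma rec_subst: 
  assumes "rec P" "recf f"
  shows "rec (\<lambda>x. P (f x))"
proof -
  have "rec (\<lambda>x. \<exists>y. y = f x \<and> P y)"
  proof (rule rec_delta[where \<theta> = "Conj (FMem (TPair x0 x1) 0) (FMem x1 1)"
        and \<eta> = "Neg (Conj (FMem (TPair x0 x1) 0) (Neg (FMem x1 1)))"])
    show "rec (\<lambda>p. \<exists>x. p = \<langle>x, f x\<rangle>)" "rec P" using assms by (auto simp: recf_def)
  qed (auto simp: fm_simps)
  then show ?thesis by simp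
qed

lemma rec_const [rec_intro]: "rec (\<lambda>x. Q)"
proof -
  obtain P where P: "rec P" using ex_rec by blast
  show ?thesis
    using rec_disj[OF P rec_not[OF P]] rec_conj[OF P rec_not[OF P]] by (cases Q) simp_all
qed

lemma recf_id [rec_intro]: "recf (\<lambda>x. x)"
  unfolding recf_def
  by (rule rec_bounded[where \<theta> = "ExB 2 x0 (FEq x0 (TPair x2 x2))", OF _ rec_const rec_const])
     (auto simp: fm_simps pair_le)

lemma recf_const [rec_intro]: "recf (\<lambda>x. c)"
  unfolding recf_def
  by (rule rec_bounded[where \<theta> = "ExB 2 x0 (FEq x0 (TPair x2 x3))" and c = c, OF _ rec_const rec_const])
     (auto simp: fm_simps pair_le)

lemma recf_pair [rec_intro]:
  assumes "recf f" "recf g" shows "recf (\<lambda>x. \<langle>f x, g x\<rangle>)"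
  unfolding recf_def
proof (rule rec_bounded[where \<theta> = "ExB 2 x0 (ExB 3 x0 (ExB 4 x0 (Conj (FEq x0 (TPair x2 (TPair x3 (NVar 4))))
      (Conj (FMem (TPair x2 x3) 0) (FMem (TPair x2 (NVar 4)) 1)))))"])
  show "rec (\<lambda>p. \<exists>x. p = \<langle>x, f x\<rangle>)" "rec (\<lambda>p. \<exists>x. p = \<langle>x, g x\<rangle>)" using assms by (auto simp: recf_def)
qed (auto simp: fm_simps pair_le)

lemma recf_comp:
  assumes "recf g" "recf f" shows "recf (\<lambda>x. g (f x))"
proof -
  have "rec (\<lambda>p. \<exists>y. \<exists>x. y = f x \<and> p = \<langle>x, g y\<rangle>)"
  proof (rule rec_delta[where \<theta> = "ExB 2 x0 (ExB 3 x0 (Conj (FEq x0 (TPair x2 x3)) (Conj (FMem (TPair x2 x1) 0) (FMem (TPair x1 x3) 1))))"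
        and \<eta> = "ExB 2 x0 (ExB 3 x0 (Conj (FEq x0 (TPair x2 x3)) (Neg (Conj (FMem (TPair x2 x1) 0) (Neg (FMem (TPair x1 x3) 1))))))"])
    show "rec (\<lambda>p. \<exists>x. p = \<langle>x, f x\<rangle>)" "rec (\<lambda>p. \<exists>x. p = \<langle>x, g x\<rangle>)" using assms by (auto simp: recf_def)
    show "(\<exists>y x. y = f x \<and> p = \<langle>x, g y\<rangle>) \<longleftrightarrow> (\<forall>y. \<exists>x z. p = \<langle>x, z\<rangle> \<and> (y = f x \<longrightarrow> z = g y))" for p
      by (metis pair_inject)
  qed (auto simp: fm_simps pair_le)
  then show ?thesis by (simp add: recf_def)
qed

text \<open>Pieces of the graphs of \<open>p1\<close> and \<open>p2\<close>: the values on pairs,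
  the default \<open>\<zero>\<close>, and the arguments that the default must avoid.\<close>

lemma rec_projections:
  shows "rec (\<lambda>p. \<exists>a b. p = \<langle>\<langle>a, b\<rangle>, a\<rangle>)" "rec (\<lambda>p. \<exists>a b. p = \<langle>\<langle>a, b\<rangle>, b\<rangle>)"
    "rec (\<lambda>p. \<exists>x. p = \<langle>x, \<zero>\<rangle>)" "rec (\<lambda>p. \<exists>a b c. p = \<langle>\<langle>a, b\<rangle>, c\<rangle>)"
proof -
  show "rec (\<lambda>p. \<exists>a b. p = \<langle>\<langle>a, b\<rangle>, a\<rangle>)"
    by (rule rec_bounded[where \<theta> = "ExB 2 x0 (ExB 3 x0 (FEq x0 (TPair (TPair x2 x3) x2)))", OF _ rec_const rec_const])
       (auto simp: fm_simps pair_le)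
  show "rec (\<lambda>p. \<exists>a b. p = \<langle>\<langle>a, b\<rangle>, b\<rangle>)"
    by (rule rec_bounded[where \<theta> = "ExB 2 x0 (ExB 3 x0 (FEq x0 (TPair (TPair x2 x3) x3)))", OF _ rec_const rec_const])
       (auto simp: fm_simps pair_le)
  show "rec (\<lambda>p. \<exists>x. p = \<langle>x, \<zero>\<rangle>)"
    by (rule rec_bounded[where \<theta> = "ExB 2 x0 (FEq x0 (TPair x2 TZero))", OF _ rec_const rec_const])
       (auto simp: fm_simps pair_def intro: exI conjI le_add2)
  show "rec (\<lambda>p. \<exists>a b c. p = \<langle>\<langle>a, b\<rangle>, c\<rangle>)"
    by (rule rec_bounded[where \<theta> = "ExB 2 x0 (ExB 3 x0 (ExB 4 x0 (FEq x0 (TPair (TPair x2 x3) (NVar 4)))))", OF _ rec_const rec_const])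
       (auto simp: fm_simps pair_le)
qed

lemma recf_p1 [rec_intro]: "recf f \<Longrightarrow> recf (\<lambda>x. p1 (f x))"
proof (rule recf_comp[of p1])
  have "rec (\<lambda>p. (\<exists>a b. p = \<langle>\<langle>a, b\<rangle>, a\<rangle>) \<or> (\<exists>x. p = \<langle>x, \<zero>\<rangle>) \<and> \<not> (\<exists>a b c. p = \<langle>\<langle>a, b\<rangle>, c\<rangle>))"
    by (intro rec_intro rec_projections)
  then show "recf p1" unfolding recf_def
  proof (rule rec_cong)
    fix p
    show "((\<exists>a b. p = \<langle>\<langle>a, b\<rangle>, a\<rangle>) \<or> (\<exists>x. p = \<langle>x, \<zero>\<rangle>) \<and> \<not> (\<exists>a b c. p = \<langle>\<langle>a, b\<rangle>, c\<rangle>)) \<longleftrightarrow> (\<exists>x. p = \<langle>x, p1 x\<rangle>)"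
    proof
      assume "(\<exists>a b. p = \<langle>\<langle>a, b\<rangle>, a\<rangle>) \<or> (\<exists>x. p = \<langle>x, \<zero>\<rangle>) \<and> \<not> (\<exists>a b c. p = \<langle>\<langle>a, b\<rangle>, c\<rangle>)"
      then show "\<exists>x. p = \<langle>x, p1 x\<rangle>"
      proof (elim disjE conjE exE)
        fix x assume "p = \<langle>x, \<zero>\<rangle>" "\<nexists>a b c. p = \<langle>\<langle>a, b\<rangle>, c\<rangle>"
        then show ?thesis using p1_nonpair[of x] by auto
      qed auto
    next
      assume "\<exists>x. p = \<langle>x, p1 x\<rangle>"
      then obtain x where x: "p = \<langle>x, p1 x\<rangle>" by blast
      show "(\<exists>a b. p = \<langle>\<langle>a, b\<rangle>, a\<rangle>) \<or> (\<exists>x. p = \<langle>x, \<zero>\<rangle>) \<and> \<not> (\<exists>a b c. p = \<langle>\<langle>a, b\<rangle>, c\<rangle>)"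
        using x p1_nonpair[of x] by (cases "\<exists>a b. x = \<langle>a, b\<rangle>") auto
    qed
  qed
qed

lemma recf_p2 [rec_intro]: "recf f \<Longrightarrow> recf (\<lambda>x. p2 (f x))"
proof (rule recf_comp[of p2])
  have "rec (\<lambda>p. (\<exists>a b. p = \<langle>\<langle>a, b\<rangle>, b\<rangle>) \<or> (\<exists>x. p = \<langle>x, \<zero>\<rangle>) \<and> \<not> (\<exists>a b c. p = \<langle>\<langle>a, b\<rangle>, c\<rangle>))"
    by (intro rec_intro rec_projections)
  then show "recf p2" unfolding recf_def
  proof (rule rec_cong)
    fix p
    show "((\<exists>a b. p = \<langle>\<langle>a, b\<rangle>, b\<rangle>) \<or> (\<exists>x. p = \<langle>x, \<zero>\<rangle>) \<and> \<not> (\<exists>a b c. p = \<langle>\<langle>a, b\<rangle>, c\<rangle>)) \<longleftrightarrow> (\<exists>x. p = \<langle>x, p2 x\<rangle>)"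
    proof
      assume "(\<exists>a b. p = \<langle>\<langle>a, b\<rangle>, b\<rangle>) \<or> (\<exists>x. p = \<langle>x, \<zero>\<rangle>) \<and> \<not> (\<exists>a b c. p = \<langle>\<langle>a, b\<rangle>, c\<rangle>)"
      then show "\<exists>x. p = \<langle>x, p2 x\<rangle>"
      proof (elim disjE conjE exE)
        fix x assume "p = \<langle>x, \<zero>\<rangle>" "\<nexists>a b c. p = \<langle>\<langle>a, b\<rangle>, c\<rangle>"
        then show ?thesis using p2_nonpair[of x] by auto
      qed auto
    next
      assume "\<exists>x. p = \<langle>x, p2 x\<rangle>"
      then obtain x where x: "p = \<langle>x, p2 x\<rangle>" by blast
      show "(\<exists>a b. p = \<langle>\<langle>a, b\<rangle>, b\<rangle>) \<or> (\<exists>x. p = \<langle>x, \<zero>\<rangle>) \<and> \<not> (\<exists>a b c. p = \<langle>\<langle>a, b\<rangle>, c\<rangle>)"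
        using x p2_nonpair[of x] by (cases "\<exists>a b. x = \<langle>a, b\<rangle>") auto
    qed
  qed
qed

lemma rec_eq [rec_intro]:
  assumes "recf f" "recf g" shows "rec (\<lambda>x. f x = g x)"
proof -
  have "rec (\<lambda>p. \<exists>a. p = \<langle>a, a\<rangle>)"
    by (rule rec_bounded[where \<theta> = "ExB 2 x0 (FEq x0 (TPair x2 x2))", OF _ rec_const rec_const])
       (auto simp: fm_simps pair_le)
  from rec_subst[OF this recf_pair[OF assms]] show ?thesis by (rule rec_cong) auto
qed

lemma rec_less [rec_intro]:
  assumes "recf f" "recf g" shows "rec (\<lambda>x. f x \<prec> g x)"
proof -
  have "rec (\<lambda>p. \<exists>a b. p = \<langle>a, b\<rangle> \<and> a \<prec> b)"
    by (rule rec_bounded[where \<theta> = "ExB 2 x0 (ExB 3 x0 (Conj (FEq x0 (TPair x2 x3)) (FLess x2 x3)))", OF _ rec_const rec_const])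
       (auto simp: fm_simps pair_le)
  from rec_subst[OF this recf_pair[OF assms]] show ?thesis by simp
qed

lemma rec_le [rec_intro]:
  assumes "recf f" "recf g" shows "rec (\<lambda>x. f x \<preceq> g x)"
  unfolding le_def by (intro rec_intro assms)

lemma rec_mem [rec_intro]: "A \<in> Sets M \<Longrightarrow> recf f \<Longrightarrow> rec (\<lambda>x. f x \<in> A)"
  by (rule rec_subst) (simp_all add: rec_def)

lemma recfI:
  assumes "rec (\<lambda>p. p2 p = f (p1 p))" shows "recf f"
proof -
  have "rec (\<lambda>p. p = \<langle>p1 p, p2 p\<rangle> \<and> p2 p = f (p1 p))"
    by (intro rec_intro assms)
  then show ?thesis unfolding recf_def by (rule rec_cong) (metis p1_pair p2_pair)
qed

lemma recf_add [rec_intro]: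
  assumes "recf f" "recf g" shows "recf (\<lambda>x. f x \<oplus> g x)"
proof (rule recfI)
  have "rec (\<lambda>p. \<exists>a b c. p = \<langle>a, \<langle>b, c\<rangle>\<rangle> \<and> a = b \<oplus> c)"
    by (rule rec_bounded[where \<theta> = "ExB 2 x0 (ExB 3 x0 (ExB 4 x0 (Conj (FEq x0 (TPair x2 (TPair x3 (NVar 4)))) (FEq x2 (TAdd x3 (NVar 4))))))", OF _ rec_const rec_const])
       (auto simp: fm_simps pair_le)
  moreover have "recf (\<lambda>p. \<langle>p2 p, \<langle>f (p1 p), g (p1 p)\<rangle>\<rangle>)"
    by (intro rec_intro recf_comp[OF assms(1)] recf_comp[OF assms(2)])
  ultimately show "rec (\<lambda>p. p2 p = f (p1 p) \<oplus> g (p1 p))"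
    using rec_subst by fastforce
qed

lemma recf_mul [rec_intro]:
  assumes "recf f" "recf g" shows "recf (\<lambda>x. f x \<otimes> g x)"
proof (rule recfI)
  have "rec (\<lambda>p. \<exists>a b c. p = \<langle>a, \<langle>b, c\<rangle>\<rangle> \<and> a = b \<otimes> c)"
    by (rule rec_bounded[where \<theta> = "ExB 2 x0 (ExB 3 x0 (ExB 4 x0 (Conj (FEq x0 (TPair x2 (TPair x3 (NVar 4)))) (FEq x2 (TMul x3 (NVar 4))))))", OF _ rec_const rec_const])
       (auto simp: fm_simps pair_le)
  moreover have "recf (\<lambda>p. \<langle>p2 p, \<langle>f (p1 p), g (p1 p)\<rangle>\<rangle>)"
    by (intro rec_intro recf_comp[OF assms(1)] recf_comp[OF assms(2)])
  ultimately show "rec (\<lambda>p. p2 p = f (p1 p) \<otimes> g (p1 p))"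
    using rec_subst by fastforce
qed

text \<open>The bound is a function value and not a term, so it is first named by a quantified
  variable \<open>w\<close>, and \<open>\<Delta>\<^sub>1\<close> comprehension removes the name
  again.\<close>

lemma rec_bex [rec_intro]:
  assumes "rec2 P" "recf t" shows "rec (\<lambda>x. \<exists>y. y \<prec> t x \<and> P x y)"
proof -
  have "rec (\<lambda>x. \<exists>w. w = t x \<and> (\<exists>y. y \<prec> w \<and> P x y))"
  proof (rule rec_delta[where \<theta> = "Conj (FMem (TPair x0 x1) 0) (ExN 2 (Conj (FLess x2 x1) (FMem (TPair x0 x2) 1)))"
        and \<eta> = "Neg (Conj (FMem (TPair x0 x1) 0) (Neg (ExN 2 (Conj (FLess x2 x1) (FMem (TPair x0 x2) 1)))))"])
    show "rec (\<lambda>p. \<exists>x. p = \<langle>x, t x\<rangle>)" "rec2 P" using assms by (auto simp: recf_def)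
  qed (auto simp: fm_simps)
  then show ?thesis by simp
qed

lemma rec_ball [rec_intro]:
  assumes "rec2 P" "recf t" shows "rec (\<lambda>x. \<forall>y. y \<prec> t x \<longrightarrow> P x y)"
proof -
  have "rec (\<lambda>x. \<not> (\<exists>y. y \<prec> t x \<and> \<not> P x y))" by (intro rec_intro assms)
  then show ?thesis by (rule rec_cong) auto
qed

lemma rec_bex_le [rec_intro]:
  assumes "rec2 P" "recf t" shows "rec (\<lambda>x. \<exists>y. y \<preceq> t x \<and> P x y)"
  using rec_bex[OF assms(1) recf_add[OF assms(2) recf_const[of \<one>]]] by (simp only: less_succ_le)

lemma rec_subst2:
  assumes "rec2 P" "recf f" "recf g" shows "rec (\<lambda>x. P (f x) (g x))"
  using rec_subst[OF assms(1) recf_pair[OF assms(2,3)]] by simp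

lemma rec_exI:
  assumes "rec2 R" "rec2 S" and eq: "\<And>a. (\<exists>y. R a y) \<longleftrightarrow> (\<forall>y. S a y)"
  shows "rec (\<lambda>a. \<exists>y. R a y)"
  by (rule rec_delta[where \<theta> = "FMem (TPair x0 x1) 0" and \<eta> = "FMem (TPair x0 x1) 1", OF _ _ assms(1,2)])
    (auto simp: fm_simps eq)

lemma recf_if [rec_intro]:
  assumes "rec P" "recf f" "recf g" shows "recf (\<lambda>x. if P x then f x else g x)"
proof (rule recfI)
  have "rec (\<lambda>p. (P (p1 p) \<and> p2 p = f (p1 p)) \<or> (\<not> P (p1 p) \<and> p2 p = g (p1 p)))"
    by (intro rec_intro assms rec_subst[OF assms(1)] recf_comp[OF assms(2)] recf_comp[OF assms(3)])
  then show "rec (\<lambda>p. p2 p = (if P (p1 p) then f (p1 p) else g (p1 p)))"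
    by (rule rec_cong) auto
qed

lemma recf_minus [rec_intro]:
  assumes "recf f" "recf g" shows "recf (\<lambda>x. f x \<ominus> g x)"
proof (rule recfI)
  have "rec (\<lambda>p. (g (p1 p) \<preceq> f (p1 p) \<and> g (p1 p) \<oplus> p2 p = f (p1 p)) \<or> (\<not> g (p1 p) \<preceq> f (p1 p) \<and> p2 p = \<zero>))"
    by (intro rec_intro recf_comp[OF assms(1)] recf_comp[OF assms(2)])
  then show "rec (\<lambda>p. p2 p = f (p1 p) \<ominus> g (p1 p))"
    by (rule rec_cong) (use minus_eqI minus_zero_iff le_iff_add in metis)
qed

text \<open>The matrix is a set of the model, so membership in it is an atomic formula. From here on
  syntax disappears: recursiveness is derived by the closure rules.\<close>

lemma sig_induct [consumes 1, case_names zero succ]: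
  assumes "rec2 R" and "\<exists>y. R \<zero> y" and "\<And>a y. R a y \<Longrightarrow> \<exists>y. R (a \<oplus> \<one>) y"
  shows "\<exists>y. R a y"
proof -
  have S: "range (senv {p. R (p1 p) (p2 p)} {p. R (p1 p) (p2 p)}) \<subseteq> Sets M"
    using assms(1) by (intro senv_range) (simp_all add: rec_def)
  show ?thesis
    by (rule sigma_induct[where \<theta> = "FMem (TPair x0 x1) 0" and R = R and e = "env a a", OF _ S])
      (use assms(2,3) in \<open>simp_all add: fm_simps\<close>)
qed

lemma rec_induct [consumes 1, case_names zero succ]:
  assumes "rec R" and "R \<zero>" and "\<And>a. R a \<Longrightarrow> R (a \<oplus> \<one>)"
  shows "R a"
proof -
  have "rec2 (\<lambda>a y. R a)" by (intro rec_intro rec_subst[OF assms(1)])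
  from sig_induct[OF this] assms(2,3) show ?thesis by blast
qed

text \<open>By \<open>\<Sigma>\<^sub>1\<close> induction on \<open>b\<close>, a counterexample at \<open>a\<close> descends to one at \<open>a - b\<close>.\<close>

lemma pi_induct [consumes 1, case_names zero succ]:
  assumes "rec2 R" and "\<And>y. R \<zero> y" and step: "\<And>a. (\<And>y. R a y) \<Longrightarrow> (\<And>y. R (a \<oplus> \<one>) y)"
  shows "R a y"
proof (rule ccontr)
  assume neg: "\<not> R a y"
  have rec: "rec2 (\<lambda>b y. a \<prec> b \<or> \<not> R (a \<ominus> b) y)"
    by (intro rec_intro rec_subst2[OF assms(1)])
  have "\<exists>y. a \<prec> b \<or> \<not> R (a \<ominus> b) y" for b
    using rec
  proof (induct b rule: sig_induct)
    case zero
    then show ?case using neg minus_eqI[of \<zero> a a] by (auto simp: zero_add)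
  next
    case (succ b y)
    show ?case
    proof (cases "a \<prec> b \<oplus> \<one>")
      case False
      then obtain d where d: "(b \<oplus> \<one>) \<oplus> d = a" using le_iff_add[of "b \<oplus> \<one>" a] ar.not_less by blast
      then have "b \<oplus> (d \<oplus> \<one>) = a" by (simp add: algebra_simps)
      then have "a \<ominus> b = d \<oplus> \<one>" "a \<ominus> (b \<oplus> \<one>) = d" using d minus_eqI by blast+
      moreover have "\<not> a \<prec> b" using False less_succ by blast
      ultimately show ?thesis using succ step[of d] by auto
    qed auto
  qed
  from this[of a] obtain y where "\<not> R (a \<ominus> a) y" using less_irrefl by blast
  then show False using assms(2) minus_eqI[of a \<zero> a] by (simp add: add_zero)
qed

section \<open>Least witnesses\<close>

lemma rec_least:
  assumes "rec P" "P x"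
  obtains y where "P y" "\<And>z. z \<prec> y \<Longrightarrow> \<not> P z"
proof -
  have "\<exists>y. P y \<and> (\<forall>z. z \<prec> y \<longrightarrow> \<not> P z)"
  proof (rule ccontr)
    assume *: "\<not> ?thesis"
    have rec: "rec (\<lambda>x. \<forall>z. z \<prec> x \<longrightarrow> \<not> P z)"
      by (intro rec_intro rec_subst[OF assms(1)])
    have "\<forall>z. z \<prec> a \<longrightarrow> \<not> P z" for a
      using rec
    proof (induct a rule: rec_induct)
      case (succ a) then show ?case using * less_succ by blast
    qed (simp add: not_less_zero)
    then show False using assms(2) less_succ by blast
  qed
  then show thesis using that by blast
qed

definition mu :: "('m \<Rightarrow> bool) \<Rightarrow> 'm" where
  "mu P = (THE y. P y \<and> (\<forall>z. z \<prec> y \<longrightarrow> \<not> P z))"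

lemma mu_unique:
  assumes "P y" "\<And>z. z \<prec> y \<Longrightarrow> \<not> P z" shows "mu P = y"
  unfolding mu_def by (rule the_equality) (use assms less_total in blast)+

lemma
  assumes "rec P" "P x"
  shows muI: "P (mu P)" and not_less_mu: "z \<prec> mu P \<Longrightarrow> \<not> P z"
  using rec_least[OF assms] mu_unique[of P] by metis+

lemma mu_le: "rec P \<Longrightarrow> P x \<Longrightarrow> mu P \<preceq> x"
  using not_less_mu ar.not_less by blast

lemma recf_mu:
  assumes "rec2 R" "\<And>x. \<exists>y. R x y" shows "recf (\<lambda>x. mu (R x))"
proof (rule recfI)
  have R: "rec (R x)" for x by (rule rec_subst2[OF assms(1)]) (intro rec_intro)+
  have "rec (\<lambda>p. R (p1 p) (p2 p) \<and> (\<forall>z. z \<prec> p2 p \<longrightarrow> \<not> R (p1 p) z))"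
    by (intro rec_intro rec_subst2[OF assms(1)])
  then show "rec (\<lambda>p. p2 p = mu (R (p1 p)))"
    by (rule rec_cong) (metis R assms(2) muI not_less_mu mu_unique)
qed

section \<open>Codes of finite sets and sequences\<close>

abbreviation mem where "mem \<equiv> fin_elem M"
abbreviation divs (infix "divs" 50) where "a divs b \<equiv> divides M a b"

text \<open>Bounding the quotient makes divisibility, and with it membership in a code, a recursive
  relation.\<close>

lemma divides_bounded: "d divs a \<longleftrightarrow> (\<exists>q. q \<preceq> a \<and> a = d \<otimes> q)"
proof
  assume "d divs a"
  then obtain q where q: "a = d \<otimes> q" by (auto simp: divides_def)
  from zero_or_succ[of d] show "\<exists>q. q \<preceq> a \<and> a = d \<otimes> q"
  proof (elim disjE exE)
    assume "d = \<zero>"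
    then show ?thesis using q by (auto simp: zero_mul)
  next
    fix e assume "d = e \<oplus> \<one>"
    then have "a = e \<otimes> q \<oplus> q" using q by (simp add: distrib_right one_mul)
    then have "q \<preceq> a" by simp
    then show ?thesis using q by blast
  qed
qed (auto simp: divides_def)

lemma rec_divides [rec_intro]: "recf f \<Longrightarrow> recf g \<Longrightarrow> rec (\<lambda>x. f x divs g x)"
  by (rule rec_subst2) (unfold divides_bounded, intro rec_intro)

lemma triple_iff: "is_triple M c \<longleftrightarrow> c = \<langle>p1 c, \<langle>p1 (p2 c), p2 (p2 c)\<rangle>\<rangle>"
  unfolding is_triple_def by (metis p1_pair p2_pair)

lemma rec_triple [rec_intro]: "recf f \<Longrightarrow> rec (\<lambda>x. is_triple M (f x))"
  unfolding triple_iff by (intro rec_intro)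

lemma mem_pair: "mem \<langle>k, \<langle>m, n\<rangle>\<rangle> i \<longleftrightarrow> i \<prec> k \<and> (m \<otimes> (i \<oplus> \<one>) \<oplus> \<one>) divs n"
  by (auto simp: fin_elem_def)

lemma mem_iff: "mem c i \<longleftrightarrow> is_triple M c \<and> i \<prec> p1 c \<and> (p1 (p2 c) \<otimes> (i \<oplus> \<one>) \<oplus> \<one>) divs p2 (p2 c)"
  by (metis fin_elem_def is_triple_def mem_pair p1_pair p2_pair)

lemma rec_fin_elem [rec_intro]: "recf f \<Longrightarrow> recf g \<Longrightarrow> rec (\<lambda>x. mem (f x) (g x))"
  unfolding mem_iff by (intro rec_intro)

lemma mem_less: "mem c i \<Longrightarrow> i \<prec> c"
  unfolding mem_iff using p1_le[of c] ar.less_le_trans by blast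

lemma mem_eq_iff:
  "d \<preceq> c \<Longrightarrow> (\<forall>i. i \<prec> c \<longrightarrow> (mem d i \<longleftrightarrow> mem c i)) \<longleftrightarrow> (\<forall>i. mem d i \<longleftrightarrow> mem c i)"
  using mem_less ar.less_le_trans by blast

text \<open>A \<open>\<Sigma>\<^sub>1\<close> induction multiplies one more value at each step; only
  the existence of some common multiple is claimed, so no product function has to be
  defined.\<close>

lemma common_multiple:
  assumes "recf f" "\<And>i. \<zero> \<prec> f i"
  shows "\<exists>N. \<zero> \<prec> N \<and> (\<forall>i. i \<prec> k \<longrightarrow> f i divs N)"
proof -
  have "rec2 (\<lambda>k N. \<zero> \<prec> N \<and> (\<forall>i. i \<prec> k \<longrightarrow> f i divs N))"
    by (intro rec_intro recf_comp[OF assms(1)])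
  then show ?thesis
  proof (induct k rule: sig_induct)
    case zero
    then show ?case using not_less_zero ar.zero_less_one by blast
  next
    case (succ k N)
    then have "\<zero> \<prec> N \<otimes> f k" "\<forall>i. i \<prec> k \<oplus> \<one> \<longrightarrow> f i divs (N \<otimes> f k)"
      using assms(2)[of k] by (auto simp: less_succ)
    then show ?case by blast
  qed
qed

text \<open>Data for Goedel's beta function in the pair \<open>b = \<langle>m, N\<rangle>\<close>:
  \<open>m\<close> is a multiple of 1, ..., \<open>K\<close>, which makes the moduli
  \<open>m(i + 1) + 1\<close> for \<open>i < K\<close> pairwise coprime, and \<open>N\<close> is a
  multiple of all these moduli.\<close>

definition good :: "'m \<Rightarrow> 'm \<Rightarrow> bool" where
  "good K b \<longleftrightarrow> \<zero> \<prec> p1 b \<and> \<zero> \<prec> p2 b \<and> (\<forall>i. i \<prec> K \<longrightarrow> (i \<oplus> \<one>) divs p1 b) \<and>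
     (\<forall>i. i \<prec> K \<longrightarrow> (p1 b \<otimes> (i \<oplus> \<one>) \<oplus> \<one>) divs p2 b)"

lemma rec_good [rec_intro]: "recf f \<Longrightarrow> recf g \<Longrightarrow> rec (\<lambda>x. good (f x) (g x))"
  by (rule rec_subst2) (unfold good_def, intro rec_intro)

lemma succ_pos [simp]: "\<zero> \<prec> a \<oplus> \<one>"
  by (simp add: less_succ_le)

lemma ex_good: "\<exists>b. good K b"
proof -
  have "recf (\<lambda>i. i \<oplus> \<one>)" by (intro rec_intro)
  from common_multiple[OF this, of K]
  obtain m where m: "\<zero> \<prec> m" "\<forall>i. i \<prec> K \<longrightarrow> (i \<oplus> \<one>) divs m" by auto
  have "recf (\<lambda>i. m \<otimes> (i \<oplus> \<one>) \<oplus> \<one>)" by (intro rec_intro)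
  from common_multiple[OF this, of K]
  obtain N where "\<zero> \<prec> N" "\<forall>i. i \<prec> K \<longrightarrow> (m \<otimes> (i \<oplus> \<one>) \<oplus> \<one>) divs N" by auto
  then have "good K \<langle>m, N\<rangle>" using m by (simp add: good_def)
  then show ?thesis ..
qed

text \<open>The modulus is 1 modulo \<open>m\<close>, so \<open>m\<close> is invertible modulo it;
  the identity for \<open>x \<otimes> ?d\<close> carries this out without inverses.\<close>

lemma divides_cancel_modulus:
  assumes "(m \<otimes> (i \<oplus> \<one>) \<oplus> \<one>) divs (x \<otimes> m)"
  shows "(m \<otimes> (i \<oplus> \<one>) \<oplus> \<one>) divs x"
proof -
  let ?d = "m \<otimes> (i \<oplus> \<one>) \<oplus> \<one>"
  have "x \<otimes> ?d = x \<otimes> m \<otimes> (i \<oplus> \<one>) \<oplus> x" by (simp add: algebra_simps)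
  moreover have "?d divs (x \<otimes> ?d)" by simp
  ultimately show ?thesis using assms by (metis ar.dvd_add_right_iff ar.dvd_mult2)
qed

text \<open>Coprimality in the form of Euclid's lemma. Two moduli differ by
  \<open>(e + 1) * m\<close> with \<open>e + 1\<close> the distance of the indices. The factor
  \<open>m\<close> cancels; then \<open>e + 1\<close> is enlarged to its multiple \<open>m\<close>,
  which cancels again.\<close>

lemma moduli_coprime:
  assumes m: "\<forall>i. i \<prec> K \<longrightarrow> (i \<oplus> \<one>) divs m"
    and "i \<prec> K" "j \<prec> K" "i \<noteq> j"
    and div: "(m \<otimes> (i \<oplus> \<one>) \<oplus> \<one>) divs (n \<otimes> (m \<otimes> (j \<oplus> \<one>) \<oplus> \<one>))"
  shows "(m \<otimes> (i \<oplus> \<one>) \<oplus> \<one>) divs n"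
proof -
  let ?d = "m \<otimes> (i \<oplus> \<one>) \<oplus> \<one>"
  have "\<exists>e. e \<prec> K \<and> ?d divs (n \<otimes> (e \<oplus> \<one>) \<otimes> m)"
    using less_total[of i j] assms(4)
  proof (elim disjE)
    assume "i \<prec> j"
    then obtain e where e: "(i \<oplus> e) \<oplus> \<one> = j" using less_iff by blast
    then have "n \<otimes> (m \<otimes> (j \<oplus> \<one>) \<oplus> \<one>) = n \<otimes> ?d \<oplus> n \<otimes> (e \<oplus> \<one>) \<otimes> m"
      by (auto simp: algebra_simps)
    moreover have "?d divs (n \<otimes> ?d)" by simp
    ultimately have "?d divs (n \<otimes> (e \<oplus> \<one>) \<otimes> m)" using div by (metis ar.dvd_add_right_iff)
    moreover have "e \<preceq> j" using e by (metis le_add1 le_add2 le_trans)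
    ultimately show ?thesis using assms(3) ar.le_less_trans by blast
  next
    assume "j \<prec> i"
    then obtain e where e: "(j \<oplus> e) \<oplus> \<one> = i" using less_iff by blast
    then have "n \<otimes> ?d = n \<otimes> (m \<otimes> (j \<oplus> \<one>) \<oplus> \<one>) \<oplus> n \<otimes> (e \<oplus> \<one>) \<otimes> m"
      by (auto simp: algebra_simps)
    moreover have "?d divs (n \<otimes> ?d)" by simp
    ultimately have "?d divs (n \<otimes> (e \<oplus> \<one>) \<otimes> m)" using div by (metis ar.dvd_add_right_iff)
    moreover have "e \<preceq> i" using e by (metis le_add1 le_add2 le_trans)
    ultimately show ?thesis using assms(2) ar.le_less_trans by blast
  qed blast
  then obtain e where e: "e \<prec> K" "?d divs (n \<otimes> (e \<oplus> \<one>) \<otimes> m)" by auto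
  from e(2) have "?d divs (n \<otimes> (e \<oplus> \<one>))" by (rule divides_cancel_modulus)
  moreover obtain t where "m = (e \<oplus> \<one>) \<otimes> t" using m e(1) by (auto simp: divides_def)
  ultimately have "?d divs (n \<otimes> m)" by (metis ar.dvd_mult2 mul_assoc)
  then show ?thesis by (rule divides_cancel_modulus)
qed

text \<open>Divide \<open>n\<close> by the modulus of \<open>x\<close>: the other moduli are coprime
  to it and keep their status. Nothing is said about \<open>x\<close> itself, which survives if its
  modulus divides \<open>n\<close> twice; what counts is that \<open>n\<close> becomes
  smaller.\<close>

lemma remove_element:
  assumes m: "\<forall>i. i \<prec> K \<longrightarrow> (i \<oplus> \<one>) divs m" and pos: "\<zero> \<prec> m" "\<zero> \<prec> n"
    and x: "mem \<langle>K, \<langle>m, n\<rangle>\<rangle> x"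
  obtains q where "\<zero> \<prec> q" "q \<prec> n"
    "\<And>i. i \<noteq> x \<Longrightarrow> mem \<langle>K, \<langle>m, q\<rangle>\<rangle> i \<longleftrightarrow> mem \<langle>K, \<langle>m, n\<rangle>\<rangle> i"
proof -
  obtain q where q: "n = (m \<otimes> (x \<oplus> \<one>) \<oplus> \<one>) \<otimes> q" and xK: "x \<prec> K"
    using x by (auto simp: mem_pair divides_def)
  have q0: "\<zero> \<prec> q" using q pos(2) by (metis less_total less_irrefl mul_zero not_less_zero)
  have "n = (m \<otimes> (x \<oplus> \<one>)) \<otimes> q \<oplus> q" using q by (simp add: algebra_simps)
  moreover have "\<zero> \<prec> m \<otimes> (x \<oplus> \<one>) \<otimes> q" using pos(1) q0 by simp
  ultimately have "q \<prec> n" by simp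
  moreover have "mem \<langle>K, \<langle>m, q\<rangle>\<rangle> i \<longleftrightarrow> mem \<langle>K, \<langle>m, n\<rangle>\<rangle> i" if "i \<noteq> x" for i
  proof
    assume "mem \<langle>K, \<langle>m, n\<rangle>\<rangle> i"
    then have "i \<prec> K" "(m \<otimes> (i \<oplus> \<one>) \<oplus> \<one>) divs (q \<otimes> (m \<otimes> (x \<oplus> \<one>) \<oplus> \<one>))"
      unfolding mem_pair q mul_comm[of q] by blast+
    then show "mem \<langle>K, \<langle>m, q\<rangle>\<rangle> i"
      using moduli_coprime[OF m _ xK that] by (simp only: mem_pair)
  next
    assume "mem \<langle>K, \<langle>m, q\<rangle>\<rangle> i"
    then show "mem \<langle>K, \<langle>m, n\<rangle>\<rangle> i"
      unfolding mem_pair q using ar.dvd_mult by blast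
  qed
  ultimately show thesis using that q0 by blast
qed

text \<open>
  The least \<open>n\<close> whose code contains all required elements contains no others: the modulus of a superfluous
  element could be divided out of \<open>n\<close>. So an upper bound for codes exists without exponentiation.
\<close>

lemma code_below:
  assumes P: "rec P" and b: "good K b"
  obtains n where "\<zero> \<prec> n" "n \<preceq> p2 b" "\<And>i. mem \<langle>K, \<langle>p1 b, n\<rangle>\<rangle> i \<longleftrightarrow> i \<prec> K \<and> P i"
proof -
  let ?Q = "\<lambda>n. \<zero> \<prec> n \<and> (\<forall>i. i \<prec> K \<longrightarrow> P i \<longrightarrow> mem \<langle>K, \<langle>p1 b, n\<rangle>\<rangle> i)"
  have Q: "rec ?Q" by (intro rec_intro rec_subst[OF P])
  have N: "?Q (p2 b)" using b by (simp add: good_def mem_pair)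
  let ?n = "mu ?Q"
  have n: "?Q ?n" using muI[OF Q N] .
  have "P i" if i: "mem \<langle>K, \<langle>p1 b, ?n\<rangle>\<rangle> i" for i
  proof (rule ccontr)
    assume "\<not> P i"
    have g: "\<forall>i. i \<prec> K \<longrightarrow> (i \<oplus> \<one>) divs p1 b" "\<zero> \<prec> p1 b" using b by (simp_all add: good_def)
    obtain q where q: "\<zero> \<prec> q" "q \<prec> ?n"
      "\<And>j. j \<noteq> i \<Longrightarrow> mem \<langle>K, \<langle>p1 b, q\<rangle>\<rangle> j \<longleftrightarrow> mem \<langle>K, \<langle>p1 b, ?n\<rangle>\<rangle> j"
      by (rule remove_element[OF g(1,2) _ i]) (use n in blast)+
    have "mem \<langle>K, \<langle>p1 b, q\<rangle>\<rangle> j" if "j \<prec> K" "P j" for j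
    proof -
      have "j \<noteq> i" using that \<open>\<not> P i\<close> by blast
      then show ?thesis using q(3) n that by blast
    qed
    then have "?Q q" using q(1) by blast
    then show False using not_less_mu[OF Q N q(2)] by blast
  qed
  then have "mem \<langle>K, \<langle>p1 b, ?n\<rangle>\<rangle> i \<longleftrightarrow> i \<prec> K \<and> P i" for i
    using n mem_pair by blast
  moreover have "\<zero> \<prec> ?n" using n by blast
  ultimately show thesis using that mu_le[OF Q N] by blast
qed

text \<open>A recursive bound for the codes of all subsets of \<open>{i. i < K}\<close>: the triple
  for the full set, which dominates in each component the triples found by
  \<open>code_below\<close>. It turns quantifiers over finite sets into bounded ones.\<close>

definition code_bound :: "'m \<Rightarrow> 'm" where
  "code_bound K = \<langle>K, \<langle>p1 (mu (good K)), p2 (mu (good K))\<rangle>\<rangle>"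

lemma recf_code_bound [rec_intro]: "recf f \<Longrightarrow> recf (\<lambda>x. code_bound (f x))"
proof -
  have "recf (\<lambda>K. mu (good K))" by (intro recf_mu rec_intro ex_good)
  then show "recf f \<Longrightarrow> recf (\<lambda>x. code_bound (f x))"
    unfolding code_bound_def by (intro rec_intro recf_comp[OF \<open>recf (\<lambda>K. mu (good K))\<close>])
qed

lemma good_mu: "good K (mu (good K))"
proof -
  obtain b where "good K b" using ex_good by blast
  moreover have "rec (good K)" by (intro rec_intro)
  ultimately show ?thesis by (rule muI[rotated])
qed

lemma ex_fin_code:
  assumes P: "rec P" and K: "\<And>i. P i \<Longrightarrow> i \<prec> K"
  obtains c where "fin_code M c" "c \<preceq> code_bound K" "\<And>i. mem c i \<longleftrightarrow> P i"
proof -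
  obtain n where n: "n \<preceq> p2 (mu (good K))"
    and "\<And>i. mem \<langle>K, \<langle>p1 (mu (good K)), n\<rangle>\<rangle> i \<longleftrightarrow> i \<prec> K \<and> P i"
    using code_below[OF P good_mu] by blast
  then obtain d where d: "\<And>i. mem d i \<longleftrightarrow> P i" "is_triple M d" "d \<preceq> code_bound K"
    using that[of "\<langle>K, \<langle>p1 (mu (good K)), n\<rangle>\<rangle>"] K
    by (metis is_triple_def code_bound_def pair_mono ar.order_refl)
  \<comment> \<open>Elements are smaller than their code, so comparing below
    \<open>c \<oplus> d\<close> is full extensional equality, in recursive form.\<close>
  let ?Q = "\<lambda>c. is_triple M c \<and> (\<forall>i. i \<prec> c \<oplus> d \<longrightarrow> (mem c i \<longleftrightarrow> mem d i))"
  have eq: "?Q c \<longleftrightarrow> is_triple M c \<and> (\<forall>i. mem c i \<longleftrightarrow> mem d i)" for c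
    using mem_less[of c] mem_less[of d] le_add1[of c d] le_add2[of d c] ar.less_le_trans by blast
  have Q: "rec ?Q" by (intro rec_intro)
  have Qd: "?Q d" using d by simp
  show thesis
  proof (rule that[of "mu ?Q"])
    show mu: "mem (mu ?Q) i \<longleftrightarrow> P i" for i using muI[OF Q Qd] eq d(1) by blast
    show "mu ?Q \<preceq> code_bound K" using mu_le[OF Q Qd] d(3) le_trans by blast
    show "fin_code M (mu ?Q)" unfolding fin_code_def
      using muI[OF Q Qd] not_less_mu[OF Q Qd] unfolding eq by blast
  qed
qed

lemma ex_code:
  "rec P \<Longrightarrow> (\<And>i. P i \<Longrightarrow> i \<prec> K) \<Longrightarrow> \<exists>c. \<forall>i. mem c i \<longleftrightarrow> P i"
  using ex_fin_code by metis

lemma fin_code_unique: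
  "fin_code M c \<Longrightarrow> fin_code M d \<Longrightarrow> (\<And>i. mem c i \<longleftrightarrow> mem d i) \<Longrightarrow> c = d"
  using less_total[of c d] unfolding fin_code_def by blast

lemma fin_code_le_bound:
  assumes "fin_code M c" "\<And>i. mem c i \<Longrightarrow> i \<prec> K"
  shows "c \<preceq> code_bound K"
proof -
  have "rec (mem c)" by (intro rec_intro)
  then obtain d where "fin_code M d" "d \<preceq> code_bound K" "\<And>i. mem d i \<longleftrightarrow> mem c i"
    using ex_fin_code assms(2) by metis
  then show ?thesis using fin_code_unique assms(1) by metis
qed

text \<open>Replaces an iteration when the smallest set with a closure property is needed.\<close>

lemma minimal_set:
  assumes Q: "rec Q" and "Q c"
    and ext: "\<And>c d. (\<And>i. mem c i \<longleftrightarrow> mem d i) \<Longrightarrow> Q c \<Longrightarrow> Q d"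
  obtains d where "Q d" "\<And>d' x. mem d x \<Longrightarrow> (\<And>i. mem d' i \<longleftrightarrow> mem d i \<and> i \<noteq> x) \<Longrightarrow> \<not> Q d'"
proof -
  have "rec (mem c)" by (intro rec_intro)
  then obtain n where n: "\<zero> \<prec> n" "\<And>i. mem \<langle>c, \<langle>p1 (mu (good c)), n\<rangle>\<rangle> i \<longleftrightarrow> i \<prec> c \<and> mem c i"
    using code_below[OF _ good_mu] by blast
  let ?m = "p1 (mu (good c))"
  let ?Q = "\<lambda>n. \<zero> \<prec> n \<and> Q \<langle>c, \<langle>?m, n\<rangle>\<rangle>"
  have rQ: "rec ?Q" by (intro rec_intro rec_subst[OF Q])
  have "Q \<langle>c, \<langle>?m, n\<rangle>\<rangle>" by (rule ext[OF _ \<open>Q c\<close>]) (use n(2) mem_less in blast)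
  then have Qn: "?Q n" using n(1) by blast
  let ?n = "mu ?Q"
  have mu: "?Q ?n" using muI[OF rQ Qn] .
  show thesis
  proof (rule that[of "\<langle>c, \<langle>?m, ?n\<rangle>\<rangle>"])
    show "Q \<langle>c, \<langle>?m, ?n\<rangle>\<rangle>" using mu by blast
    fix d x assume x: "mem \<langle>c, \<langle>?m, ?n\<rangle>\<rangle> x" and d: "\<And>i. mem d i \<longleftrightarrow> mem \<langle>c, \<langle>?m, ?n\<rangle>\<rangle> i \<and> i \<noteq> x"
    have g: "\<forall>i. i \<prec> c \<longrightarrow> (i \<oplus> \<one>) divs ?m" "\<zero> \<prec> ?m" using good_mu[of c] by (simp_all add: good_def)
    obtain q where q: "\<zero> \<prec> q" "q \<prec> ?n"
      "\<And>j. j \<noteq> x \<Longrightarrow> mem \<langle>c, \<langle>?m, q\<rangle>\<rangle> j \<longleftrightarrow> mem \<langle>c, \<langle>?m, ?n\<rangle>\<rangle> j"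
      by (rule remove_element[OF g(1,2) _ x]) (use mu in blast)+
    show "\<not> Q d"
    proof
      assume "Q d"
      have "Q \<langle>c, \<langle>?m, q\<rangle>\<rangle>"
      \<comment> \<open>If \<open>x\<close> survives the division, the set is unchanged; if not, it
        has the same elements as \<open>d\<close>. In both cases the smaller \<open>q\<close>
        contradicts the choice of \<open>?n\<close>.\<close>
      proof (cases "mem \<langle>c, \<langle>?m, q\<rangle>\<rangle> x")
        case True
        then have "mem \<langle>c, \<langle>?m, ?n\<rangle>\<rangle> i \<longleftrightarrow> mem \<langle>c, \<langle>?m, q\<rangle>\<rangle> i" for i using q(3) x by (cases "i = x") auto
        then show ?thesis using ext mu by blast
      next
        case False
        then have "mem d i \<longleftrightarrow> mem \<langle>c, \<langle>?m, q\<rangle>\<rangle> i" for i using q(3) d by (cases "i = x") auto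
        then show ?thesis using ext \<open>Q d\<close> by blast
      qed
      then show False using not_less_mu[OF rQ Qn q(2)] q(1) by blast
    qed
  qed
qed

section \<open>Bounded forms of the notions of code and sequence\<close>

lemma fin_code_iff: "fin_code M c \<longleftrightarrow> is_triple M c \<and>
    (\<forall>d. d \<prec> c \<longrightarrow> is_triple M d \<longrightarrow> \<not> (\<forall>i. i \<prec> c \<longrightarrow> (mem d i \<longleftrightarrow> mem c i)))"
  unfolding fin_code_def using mem_eq_iff[of _ c] le_def by meson

lemma rec_fin_code [rec_intro]: "recf f \<Longrightarrow> rec (\<lambda>x. fin_code M (f x))"
  by (rule rec_subst) (unfold fin_code_iff, intro rec_intro)

lemma rec_entry [rec_intro]: "recf f \<Longrightarrow> recf g \<Longrightarrow> recf h \<Longrightarrow> rec (\<lambda>x. entry M (f x) (g x) (h x))"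
  unfolding entry_def by (intro rec_intro)

lemma entry_less: "entry M s i x \<Longrightarrow> i \<prec> s" "entry M s i x \<Longrightarrow> x \<prec> s"
  unfolding entry_def
  using ar.le_less_trans[OF fst_le_pair mem_less] ar.le_less_trans[OF snd_le_pair mem_less] by blast+

lemma is_seq_bounded: "is_seq M s l \<longleftrightarrow> fin_code M s \<and>
  (\<forall>z. z \<prec> s \<longrightarrow> mem s z \<longrightarrow> p1 z \<prec> l \<and> z = \<langle>p1 z, p2 z\<rangle>) \<and>
  (\<forall>i. i \<prec> l \<longrightarrow> (\<exists>x. x \<prec> s \<and> entry M s i x \<and> (\<forall>y. y \<prec> s \<longrightarrow> entry M s i y \<longrightarrow> y = x)))"
proof -
  have "(\<forall>z. mem s z \<longrightarrow> (\<exists>i x. i \<prec> l \<and> z = \<langle>i, x\<rangle>)) \<longleftrightarrow>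
    (\<forall>z. z \<prec> s \<longrightarrow> mem s z \<longrightarrow> p1 z \<prec> l \<and> z = \<langle>p1 z, p2 z\<rangle>)"
    by (metis mem_less p1_pair p2_pair)
  moreover have "(\<exists>!x. entry M s i x) \<longleftrightarrow>
    (\<exists>x. x \<prec> s \<and> entry M s i x \<and> (\<forall>y. y \<prec> s \<longrightarrow> entry M s i y \<longrightarrow> y = x))" for i
    using entry_less by metis
  ultimately show ?thesis unfolding is_seq_def by simp
qed

lemma rec_is_seq [rec_intro]: "recf f \<Longrightarrow> recf g \<Longrightarrow> rec (\<lambda>x. is_seq M (f x) (g x))"
  by (rule rec_subst2) (unfold is_seq_bounded, intro rec_intro)

lemma is_seqD:
  assumes "is_seq M s l"
  shows "fin_code M s" "entry M s i x \<Longrightarrow> i \<prec> l" "entry M s i x \<Longrightarrow> entry M s i y \<Longrightarrow> x = y"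
    "i \<prec> l \<Longrightarrow> \<exists>x. entry M s i x" "mem s z \<Longrightarrow> \<exists>i x. i \<prec> l \<and> z = \<langle>i, x\<rangle>"
proof -
  show "fin_code M s" "mem s z \<Longrightarrow> \<exists>i x. i \<prec> l \<and> z = \<langle>i, x\<rangle>" "i \<prec> l \<Longrightarrow> \<exists>x. entry M s i x"
    using assms unfolding is_seq_def by blast+
  show *: "entry M s i x \<Longrightarrow> i \<prec> l" for x
    using assms unfolding is_seq_def entry_def by (metis pair_inject)
  show "entry M s i x \<Longrightarrow> entry M s i y \<Longrightarrow> x = y"
    using assms * unfolding is_seq_def by blast
qed

lemma is_seq_length_unique: "is_seq M s k \<Longrightarrow> is_seq M s l \<Longrightarrow> k = l"
  using less_total[of k l] is_seqD less_irrefl by metis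

lemma ex_seq:
  assumes f: "recf f" and b: "\<And>i. i \<prec> l \<Longrightarrow> f i \<prec> b"
  obtains s where "is_seq M s l" "\<And>i x. entry M s i x \<longleftrightarrow> i \<prec> l \<and> x = f i"
proof -
  have P: "rec (\<lambda>z. \<exists>i. i \<prec> l \<and> z = \<langle>i, f i\<rangle>)" by (intro rec_intro recf_comp[OF f])
  have "\<langle>i, f i\<rangle> \<prec> \<langle>l, b\<rangle>" if "i \<prec> l" for i
    by (rule pair_strict) (use that b in \<open>simp add: ar.add_strict_mono\<close>)
  then have "z \<prec> \<langle>l, b\<rangle>" if "\<exists>i. i \<prec> l \<and> z = \<langle>i, f i\<rangle>" for z using that by auto
  from ex_fin_code[OF P this]
  obtain s where s: "fin_code M s" "\<And>z. mem s z \<longleftrightarrow> (\<exists>i. i \<prec> l \<and> z = \<langle>i, f i\<rangle>)" by metis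
  have e: "entry M s i x \<longleftrightarrow> i \<prec> l \<and> x = f i" for i x
    by (auto simp: entry_def s(2))
  show thesis
    by (rule that[of s]) (use s e in \<open>auto simp: is_seq_def\<close>)
qed

section \<open>Compactness and the pigeonhole principle\<close>

lemma is_seq_length_le: "is_seq M s l \<Longrightarrow> l \<preceq> s"
  using is_seqD(4)[of s l s] entry_less(1)[of s s] less_irrefl ar.not_less by blast

lemma ex_binary_seq:
  assumes P: "rec P"
  obtains s where "is_seq M s l" "\<And>i. i \<prec> l \<Longrightarrow> entry M s i \<one> \<longleftrightarrow> P i"
    "\<And>i. i \<prec> l \<Longrightarrow> entry M s i \<zero> \<longleftrightarrow> \<not> P i" "binary_seq M s"
proof -
  have "recf (\<lambda>i. if P i then \<one> else \<zero>)" by (intro rec_intro P)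
  then obtain s where s: "is_seq M s l" and e: "\<And>i x. entry M s i x \<longleftrightarrow> i \<prec> l \<and> x = (if P i then \<one> else \<zero>)"
    by (rule ex_seq[of _ l "\<one> \<oplus> \<one>"]) simp_all
  have "binary_seq M s" using s e by (auto simp: binary_seq_def)
  then show thesis using that s e by (metis zero_neq_one)
qed

text \<open>Weak Koenig's lemma for predicates: \<open>Q P l\<close> constrains only the first
  \<open>l\<close> bits of \<open>P\<close> and weakens as \<open>l\<close> decreases, so the binary
  sequences satisfying it form a tree. If every finite stage has a recursive solution, a path solves
  all stages at once.\<close>

theorem compactness:
  assumes wkl: "weak_Koenig M" and Q: "rec2 (\<lambda>s l. Q (\<lambda>i. entry M s i \<one>) l)"
    and ext: "\<And>P P' l. (\<And>i. i \<prec> l \<Longrightarrow> P i \<longleftrightarrow> P' i) \<Longrightarrow> Q P l \<Longrightarrow> Q P' l"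
    and mono: "\<And>P k l. k \<preceq> l \<Longrightarrow> Q P l \<Longrightarrow> Q P k"
    and ex: "\<And>l. \<exists>P. rec P \<and> Q P l"
  obtains X where "rec X" "\<And>l. Q X l"
proof -
  define T where "T = {s. \<exists>l. l \<preceq> s \<and> is_seq M s l \<and> (\<forall>i. i \<prec> l \<longrightarrow> entry M s i \<zero> \<or> entry M s i \<one>)
      \<and> Q (\<lambda>i. entry M s i \<one>) l}"
  have T: "T \<in> Sets M"
    unfolding T_def rec_def[symmetric] by (intro rec_intro rec_subst2[OF Q])
  have T_iff: "s \<in> T \<longleftrightarrow> binary_seq M s \<and> Q (\<lambda>i. entry M s i \<one>) l" if s: "is_seq M s l" for s l
  proof -
    have "(\<exists>l. is_seq M s l) \<and> (\<forall>i x. entry M s i x \<longrightarrow> x = \<zero> \<or> x = \<one>) \<longleftrightarrow>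
        (\<forall>i. i \<prec> l \<longrightarrow> entry M s i \<zero> \<or> entry M s i \<one>)"
      using is_seqD[OF s] s by metis
    then show ?thesis
      unfolding T_def binary_seq_def mem_Collect_eq using s is_seq_length_unique is_seq_length_le by blast
  qed
  have T_binary: "binary_seq M s" if "s \<in> T" for s
    using that T_iff unfolding T_def by blast
  have "binary_tree M T"
    unfolding binary_tree_def
  proof (intro conjI ballI allI impI)
    fix t s assume t: "t \<in> T" and "initial_segment M s t"
    then obtain k l where kl: "is_seq M s k" "is_seq M t l" "k \<preceq> l"
      "\<And>i x. i \<prec> k \<Longrightarrow> entry M s i x \<longleftrightarrow> entry M t i x"
      unfolding initial_segment_def by blast
    have "Q (\<lambda>i. entry M t i \<one>) l" and bt: "binary_seq M t" using t T_iff[OF kl(2)] by blast+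
    then have "Q (\<lambda>i. entry M t i \<one>) k" using mono kl(3) by blast
    then have "Q (\<lambda>i. entry M s i \<one>) k" using ext kl(4) by (metis (no_types, lifting))
    moreover have "binary_seq M s"
      using bt kl(1,4) is_seqD(2)[OF kl(1)] unfolding binary_seq_def by metis
    ultimately show "s \<in> T" using T_iff[OF kl(1)] by blast
  qed (use T T_binary in blast)+
  moreover have "infinite_in M T"
    unfolding infinite_in_def
  proof
    fix k
    obtain P where P: "rec P" "Q P (k \<oplus> \<one>)" using ex by blast
    obtain s where s: "is_seq M s (k \<oplus> \<one>)" "\<And>i. i \<prec> k \<oplus> \<one> \<Longrightarrow> entry M s i \<one> \<longleftrightarrow> P i" "binary_seq M s"
      using ex_binary_seq[OF P(1)] by metis
    have "Q (\<lambda>i. entry M s i \<one>) (k \<oplus> \<one>)" by (rule ext[OF _ P(2)]) (use s(2) in blast)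
    then have "s \<in> T" using T_iff[OF s(1)] s(3) by blast
    \<comment> \<open>Infinite means unbounded codes, hence length \<open>k + 1\<close>: its last
      position \<open>k\<close> is an index, and indices are below the code.\<close>
    moreover have "k \<prec> s" using is_seqD(4)[OF s(1), of k] entry_less(1) less_succ by blast
    ultimately show "\<exists>s\<in>T. k \<prec> s" by blast
  qed
  ultimately obtain f where f: "infinite_path M T f" using wkl unfolding weak_Koenig_def by blast
  show thesis
  proof (rule that)
    have "f \<in> Sets M" using f unfolding infinite_path_def is_fun_def by blast
    then show "rec (\<lambda>i. \<langle>i, \<one>\<rangle> \<in> f)" by (intro rec_intro)
    fix l
    obtain t where t: "t \<in> T" "is_seq M t l" "\<And>i x. i \<prec> l \<Longrightarrow> entry M t i x \<longleftrightarrow> \<langle>i, x\<rangle> \<in> f"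
      using f unfolding infinite_path_def by blast
    have "Q (\<lambda>i. entry M t i \<one>) l" using T_iff t by blast
    then show "Q (\<lambda>i. \<langle>i, \<one>\<rangle> \<in> f) l" by (rule ext[rotated]) (rule t(3))
  qed
qed

section \<open>The pigeonhole principle\<close>

lemma ex_relation_code:
  assumes R: "rec2 R"
  obtains c where "\<And>i j. mem c \<langle>i, j\<rangle> \<longleftrightarrow> i \<prec> a \<and> j \<prec> b \<and> R i j"
proof -
  have P: "rec (\<lambda>z. z = \<langle>p1 z, p2 z\<rangle> \<and> p1 z \<prec> a \<and> p2 z \<prec> b \<and> R (p1 z) (p2 z))"
    by (intro rec_intro R)
  have "\<langle>i, j\<rangle> \<prec> \<langle>a, b\<rangle>" if "i \<prec> a" "j \<prec> b" for i j
    by (rule pair_strict) (use that in \<open>simp add: ar.add_strict_mono\<close>)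
  then have "z \<prec> \<langle>a, b\<rangle>" if "z = \<langle>p1 z, p2 z\<rangle> \<and> p1 z \<prec> a \<and> p2 z \<prec> b \<and> R (p1 z) (p2 z)" for z
    using that by metis
  from ex_fin_code[OF P this] obtain c where
    "\<And>z. mem c z \<longleftrightarrow> z = \<langle>p1 z, p2 z\<rangle> \<and> p1 z \<prec> a \<and> p2 z \<prec> b \<and> R (p1 z) (p2 z)" by blast
  then have "mem c \<langle>i, j\<rangle> \<longleftrightarrow> i \<prec> a \<and> j \<prec> b \<and> R i j" for i j by simp
  then show thesis by (rule that)
qed

text \<open>Coding the relation as a number \<open>c\<close> makes the principle, for all
  \<open>c\<close>, a \<open>\<Pi>\<^sub>1\<close> statement about \<open>n\<close>. The relation
  may be multivalued; injectivity means that distinct arguments share no value.\<close>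

lemma pigeonhole_code:
  "\<not> ((\<forall>i. i \<prec> n \<oplus> \<one> \<longrightarrow> (\<exists>j. j \<prec> n \<and> mem c \<langle>i, j\<rangle>)) \<and>
      (\<forall>i. i \<prec> n \<oplus> \<one> \<longrightarrow> (\<forall>i'. i' \<prec> n \<oplus> \<one> \<longrightarrow> (\<forall>j. j \<prec> n \<longrightarrow> mem c \<langle>i, j\<rangle> \<longrightarrow> mem c \<langle>i', j\<rangle> \<longrightarrow> i = i'))))"
    (is "\<not> ?P n c")
proof -
  have "rec2 (\<lambda>n c. \<not> ?P n c)" by (intro rec_intro)
  then show ?thesis
  proof (induct n c rule: pi_induct)
    case (zero c)
    then show ?case using not_less_zero succ_pos by blast
  next
    case (succ n c)
    show ?case
    proof
      assume "?P (n \<oplus> \<one>) c"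
      then have tot: "\<And>i. i \<prec> n \<oplus> \<one> \<oplus> \<one> \<Longrightarrow> \<exists>j. j \<prec> n \<oplus> \<one> \<and> mem c \<langle>i, j\<rangle>"
        and inj: "\<And>i i' j. i \<prec> n \<oplus> \<one> \<oplus> \<one> \<Longrightarrow> i' \<prec> n \<oplus> \<one> \<oplus> \<one> \<Longrightarrow> j \<prec> n \<oplus> \<one> \<Longrightarrow>
          mem c \<langle>i, j\<rangle> \<Longrightarrow> mem c \<langle>i', j\<rangle> \<Longrightarrow> i = i'" by blast+
      \<comment> \<open>Whatever is sent to the value \<open>n\<close> is redirected to the value of \<open>n + 1\<close>.\<close>
      have "rec2 (\<lambda>i j. mem c \<langle>i, j\<rangle> \<or> mem c \<langle>i, n\<rangle> \<and> mem c \<langle>n \<oplus> \<one>, j\<rangle>)" by (intro rec_intro)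
      then obtain d where d: "\<And>i j. mem d \<langle>i, j\<rangle> \<longleftrightarrow> i \<prec> n \<oplus> \<one> \<and> j \<prec> n \<and>
          (mem c \<langle>i, j\<rangle> \<or> mem c \<langle>i, n\<rangle> \<and> mem c \<langle>n \<oplus> \<one>, j\<rangle>)"
        by (rule ex_relation_code[of _ "n \<oplus> \<one>" n]) blast
      have lt: "i \<prec> n \<oplus> \<one> \<oplus> \<one>" if "i \<prec> n \<oplus> \<one>" for i using that less_succ by blast
      have top: "n \<oplus> \<one> \<prec> n \<oplus> \<one> \<oplus> \<one>" "n \<prec> n \<oplus> \<one>" using less_succ by blast+
      have "?P n d"
      proof (intro conjI allI impI)
        fix i assume i: "i \<prec> n \<oplus> \<one>"
        obtain j where j: "j \<prec> n \<oplus> \<one>" "mem c \<langle>i, j\<rangle>" using tot lt i by blast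
        show "\<exists>j. j \<prec> n \<and> mem d \<langle>i, j\<rangle>"
        proof (cases "j = n")
          case False
          then have "j \<prec> n" using j(1) less_succ by blast
          then show ?thesis using d i j(2) by blast
        next
          case True
          obtain j' where j': "j' \<prec> n \<oplus> \<one>" "mem c \<langle>n \<oplus> \<one>, j'\<rangle>" using tot top by blast
          have "j' \<noteq> n" using inj[OF lt[OF i] top(1,2)] j(2) j'(2) i less_irrefl True by blast
          then have "j' \<prec> n" using j'(1) less_succ by blast
          then show ?thesis using d i j(2) j'(2) True by blast
        qed
      next
        fix i i' j assume ii: "i \<prec> n \<oplus> \<one>" "i' \<prec> n \<oplus> \<one>" and "j \<prec> n" and m: "mem d \<langle>i, j\<rangle>" "mem d \<langle>i', j\<rangle>"
        then have j: "j \<prec> n \<oplus> \<one>" using less_succ by blast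
        note inj = inj[OF lt[OF ii(1)] lt[OF ii(2)]] inj[OF lt[OF ii(1)] top(1) j] inj[OF lt[OF ii(2)] top(1) j]
        then show "i = i'" using m d j top(2) ii less_irrefl by blast
      qed
      then show False using succ by blast
    qed
  qed
qed

lemma pigeonhole:
  assumes R: "rec2 R" and tot: "\<And>i. i \<prec> n \<Longrightarrow> \<exists>j. j \<prec> d \<and> R i j"
    and inj: "\<And>i i' j. i \<prec> n \<Longrightarrow> i' \<prec> n \<Longrightarrow> R i j \<Longrightarrow> R i' j \<Longrightarrow> i = i'"
  shows "n \<preceq> d"
proof (rule ccontr)
  assume "\<not> n \<preceq> d"
  then have "d \<oplus> \<one> \<preceq> n" by (simp add: succ_le)
  then have lt: "i \<prec> n" if "i \<prec> d \<oplus> \<one>" for i using that ar.less_le_trans by blast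
  obtain c where c: "\<And>i j. mem c \<langle>i, j\<rangle> \<longleftrightarrow> i \<prec> d \<oplus> \<one> \<and> j \<prec> d \<and> R i j"
    using ex_relation_code[OF R] by metis
  show False using pigeonhole_code[of d c] unfolding c using tot inj lt by blast
qed

lemma rec_adj [rec_intro]:
  assumes "E \<in> Sets M" "recf f" "recf g" shows "rec (\<lambda>x. adj M E (f x) (g x))"
  unfolding adj_def by (intro rec_intro assms)

end

section \<open>Edge colorings of bipartite graphs\<close>

locale bipartite_rca = rca +
  fixes E A B n
  assumes graph: "countable_graph M E"
    and parts: "A \<in> Sets M" "B \<in> Sets M" "A \<inter> B = {}"
    and adj_parts: "\<And>v w. adj M E v w \<Longrightarrow> (v \<in> A \<and> w \<in> B) \<or> (v \<in> B \<and> w \<in> A)"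
    and degree: "degrees_at_most M E n"
begin

lemma E_set: "E \<in> Sets M"
  using graph by (simp add: countable_graph_def is_fun_def)

lemma adj_sym: "adj M E v w \<Longrightarrow> adj M E w v"
  using graph by (simp add: countable_graph_def)

text \<open>\<open>R k x\<close> stands for: the edge from \<open>v\<close> to \<open>x\<close> has
  color \<open>k\<close>. Keeping \<open>R\<close> abstract allows the use at either end of an edge,
  where the stored orientation differs.\<close>

lemma free_color:
  assumes R: "rec2 R" and u: "adj M E v u"
    and nbr: "\<And>k x. R k x \<Longrightarrow> adj M E v x \<and> x \<noteq> u"
    and inj: "\<And>k k' x. R k x \<Longrightarrow> R k' x \<Longrightarrow> k = k'"
  shows "\<exists>\<alpha>. \<one> \<preceq> \<alpha> \<and> \<alpha> \<preceq> n \<and> (\<forall>x. \<not> R \<alpha> x)"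
proof (rule ccontr)
  assume "\<not> ?thesis"
  then have used: "\<exists>x. R k x" if "\<one> \<preceq> k" "k \<preceq> n" for k using that by blast
  obtain d s where s: "is_seq M s d" and d: "d \<preceq> n" and list: "\<And>w. adj M E v w \<longleftrightarrow> (\<exists>i. entry M s i w)"
    using degree unfolding degrees_at_most_def has_degree_def by meson
  \<comment> \<open>The edge to \<open>u\<close> takes the unused color 0, which gives \<open>n + 1\<close> colors on at most \<open>n\<close> edges.\<close>
  let ?R = "\<lambda>k i. \<exists>x. x \<prec> s \<and> entry M s i x \<and> (k = \<zero> \<and> x = u \<or> \<zero> \<prec> k \<and> R k x)"
  have "n \<oplus> \<one> \<preceq> d"
  proof (rule pigeonhole[of ?R])
    show "rec2 ?R" by (intro rec_intro rec_subst2[OF R])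
  next
    fix k assume "k \<prec> n \<oplus> \<one>"
    then have k: "k \<preceq> n" by (simp add: less_succ_le)
    have "\<exists>x. (k = \<zero> \<and> x = u \<or> \<zero> \<prec> k \<and> R k x) \<and> adj M E v x"
    proof (cases "k = \<zero>")
      case False
      then have "\<zero> \<prec> k" using less_total not_less_zero by blast
      then have "\<one> \<preceq> k" using succ_le[of \<zero> k] by (simp add: zero_add)
      then show ?thesis using used k nbr \<open>\<zero> \<prec> k\<close> by blast
    qed (use u in blast)
    then show "\<exists>i. i \<prec> d \<and> ?R k i" using list is_seqD(2)[OF s] entry_less(2) by blast
  next
    fix k k' i assume "?R k i" "?R k' i"
    then obtain x where "k = \<zero> \<and> x = u \<or> \<zero> \<prec> k \<and> R k x" "k' = \<zero> \<and> x = u \<or> \<zero> \<prec> k' \<and> R k' x"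
      using is_seqD(3)[OF s] by blast
    then show "k = k'" using inj nbr by blast
  qed
  then show False using d succ_le less_irrefl ar.less_le_trans by blast
qed

text \<open>Edges are stored only in the orientation from \<open>A\<close> to \<open>B\<close>, so
  each edge is one number and can be reached by induction.\<close>

definition edge :: "'a \<Rightarrow> bool" where
  "edge p \<longleftrightarrow> p = \<langle>p1 p, p2 p\<rangle> \<and> p1 p \<in> A \<and> p2 p \<in> B \<and> adj M E (p1 p) (p2 p)"

lemma rec_edge [rec_intro]: "recf f \<Longrightarrow> rec (\<lambda>x. edge (f x))"
  unfolding edge_def by (intro rec_intro parts E_set)

lemma edge_pair: "edge \<langle>v, w\<rangle> \<longleftrightarrow> v \<in> A \<and> w \<in> B \<and> adj M E v w"
  by (simp add: edge_def)

definition valid :: "'a \<Rightarrow> bool" where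
  "valid z \<longleftrightarrow> z = \<langle>p1 z, p2 z\<rangle> \<and> edge (p1 z) \<and> \<one> \<preceq> p2 z \<and> p2 z \<preceq> n"

lemma rec_valid [rec_intro]: "recf f \<Longrightarrow> rec (\<lambda>x. valid (f x))"
  unfolding valid_def by (intro rec_intro)

lemma validD:
  assumes "valid \<langle>\<langle>v, w\<rangle>, k\<rangle>"
  shows "v \<in> A" "w \<in> B" "v \<notin> B" "w \<notin> A" "adj M E v w" "\<one> \<preceq> k" "k \<preceq> n"
  using assms parts(3) by (auto simp: valid_def edge_pair)

text \<open>Two demands in one: equal edges have equal colors, so the color is unique, and different
  edges with a common end have different colors.\<close>

definition compatible :: "'a \<Rightarrow> 'a \<Rightarrow> bool" where
  "compatible y z \<longleftrightarrow> (p1 (p1 y) = p1 (p1 z) \<or> p2 (p1 y) = p2 (p1 z) \<longrightarrow> (p1 y = p1 z \<longleftrightarrow> p2 y = p2 z))"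

lemma rec_compatible [rec_intro]: "recf f \<Longrightarrow> recf g \<Longrightarrow> rec (\<lambda>x. compatible (f x) (g x))"
  unfolding compatible_def by (intro rec_intro)

lemma compatible_triples:
  "compatible \<langle>\<langle>a, b\<rangle>, k\<rangle> \<langle>\<langle>a', b'\<rangle>, k'\<rangle> \<longleftrightarrow> (a = a' \<or> b = b' \<longrightarrow> (a = a' \<and> b = b' \<longleftrightarrow> k = k'))"
  by (simp add: compatible_def)

text \<open>A coloring of the edges whose number is below \<open>j\<close>; passing to
  \<open>j + 1\<close> adds at most the one edge \<open>j\<close>.\<close>

definition partial_coloring :: "('a \<Rightarrow> bool) \<Rightarrow> 'a \<Rightarrow> bool" where
  "partial_coloring Y j \<longleftrightarrow> (\<forall>z. Y z \<longrightarrow> valid z \<and> p1 z \<prec> j) \<and>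
     (\<forall>y z. Y y \<longrightarrow> Y z \<longrightarrow> compatible y z) \<and>
     (\<forall>p. p \<prec> j \<longrightarrow> edge p \<longrightarrow> (\<exists>k. k \<preceq> n \<and> Y \<langle>p, k\<rangle>))"

lemma partial_coloring_code: "partial_coloring (mem c) j \<longleftrightarrow>
    (\<forall>z. z \<prec> c \<longrightarrow> mem c z \<longrightarrow> valid z \<and> p1 z \<prec> j) \<and>
     (\<forall>y. y \<prec> c \<longrightarrow> (\<forall>z. z \<prec> c \<longrightarrow> mem c y \<longrightarrow> mem c z \<longrightarrow> compatible y z)) \<and>
     (\<forall>p. p \<prec> j \<longrightarrow> edge p \<longrightarrow> (\<exists>k. k \<preceq> n \<and> mem c \<langle>p, k\<rangle>))"
  unfolding partial_coloring_def using mem_less by blast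

lemma rec_partial_coloring: "rec2 (\<lambda>j c. partial_coloring (mem c) j)"
  unfolding partial_coloring_code by (intro rec_intro)

lemma valid_triple: "valid z \<Longrightarrow> \<exists>a b k. z = \<langle>\<langle>a, b\<rangle>, k\<rangle>"
  unfolding valid_def edge_def by metis

text \<open>Bipartiteness directs the chain that starts at \<open>w\<close> in \<open>B\<close>: it
  goes from \<open>B\<close> to \<open>A\<close> along \<open>\<alpha>\<close> and from
  \<open>A\<close> to \<open>B\<close> along \<open>\<beta>\<close>. So \<open>v\<close> in
  \<open>A\<close> could be entered only along \<open>\<alpha>\<close>, which is free at
  \<open>v\<close>. The forward closure condition is \<open>Q\<close>.\<close>

lemma kempe_chain:
  assumes Y: "partial_coloring (mem c) j"
    and free: "\<And>b. \<not> mem c \<langle>\<langle>v, b\<rangle>, \<alpha>\<rangle>" "\<And>a. \<not> mem c \<langle>\<langle>a, w\<rangle>, \<beta>\<rangle>"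
    and vw: "v \<in> A" "w \<in> B"
  obtains K where "rec K" "K w" "\<not> K v"
    "\<And>a b k. mem c \<langle>\<langle>a, b\<rangle>, k\<rangle> \<Longrightarrow> k = \<alpha> \<or> k = \<beta> \<Longrightarrow> K a \<longleftrightarrow> K b"
proof -
  have valid: "mem c z \<Longrightarrow> valid z" and comp: "mem c y \<Longrightarrow> mem c z \<Longrightarrow> compatible y z" for y z
    using Y unfolding partial_coloring_def by blast+
  note vD = validD[OF valid]
  define Q where "Q d \<longleftrightarrow> mem d w \<and> (\<forall>z. z \<prec> c \<longrightarrow> mem c z \<longrightarrow>
      (p2 z = \<alpha> \<longrightarrow> mem d (p2 (p1 z)) \<longrightarrow> mem d (p1 (p1 z))) \<and>
      (p2 z = \<beta> \<longrightarrow> mem d (p1 (p1 z)) \<longrightarrow> mem d (p2 (p1 z))))" for d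
  have Q_iff: "Q d \<longleftrightarrow> mem d w \<and> (\<forall>a b. mem c \<langle>\<langle>a, b\<rangle>, \<alpha>\<rangle> \<longrightarrow> mem d b \<longrightarrow> mem d a) \<and>
      (\<forall>a b. mem c \<langle>\<langle>a, b\<rangle>, \<beta>\<rangle> \<longrightarrow> mem d a \<longrightarrow> mem d b)" (is "_ \<longleftrightarrow> ?Q d") for d
  proof
    assume "Q d"
    then have w: "mem d w" and z: "\<And>a b k. mem c \<langle>\<langle>a, b\<rangle>, k\<rangle> \<Longrightarrow> (k = \<alpha> \<longrightarrow> mem d b \<longrightarrow> mem d a) \<and> (k = \<beta> \<longrightarrow> mem d a \<longrightarrow> mem d b)"
      unfolding Q_def using mem_less by (auto dest!: spec[of _ "\<langle>\<langle>_, _\<rangle>, _\<rangle>"])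
    then show "?Q d" by blast
  next
    assume q: "?Q d"
    have "(p2 z = \<alpha> \<longrightarrow> mem d (p2 (p1 z)) \<longrightarrow> mem d (p1 (p1 z))) \<and>
      (p2 z = \<beta> \<longrightarrow> mem d (p1 (p1 z)) \<longrightarrow> mem d (p2 (p1 z)))" if z: "mem c z" for z
    proof -
      obtain a b k where "z = \<langle>\<langle>a, b\<rangle>, k\<rangle>" using valid_triple[OF valid[OF z]] by blast
      then show ?thesis using q z by auto
    qed
    then show "Q d" unfolding Q_def using q by blast
  qed
  have rQ: "rec Q" unfolding Q_def by (intro rec_intro)
  \<comment> \<open>Some finite closed set is needed to start the minimization: all numbers up to
    \<open>w \<oplus> c\<close> include \<open>w\<close> and every vertex occurring in
    \<open>c\<close>.\<close>
  have "rec (\<lambda>i. i \<prec> w \<oplus> c \<oplus> \<one>)" by (intro rec_intro)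
  from ex_code[OF this, of "w \<oplus> c \<oplus> \<one>"]
  obtain d0 where d0: "\<And>i. mem d0 i \<longleftrightarrow> i \<prec> w \<oplus> c \<oplus> \<one>" by blast
  have "a \<prec> w \<oplus> c \<oplus> \<one> \<and> b \<prec> w \<oplus> c \<oplus> \<one>" if "mem c \<langle>\<langle>a, b\<rangle>, k\<rangle>" for a b k
  proof -
    have "\<langle>\<langle>a, b\<rangle>, k\<rangle> \<preceq> w \<oplus> c" using mem_less[OF that] le_add2[of c w] ar.less_imp_le le_trans by blast
    then show ?thesis unfolding less_succ_le using pair_le(5,6)[of a b k] pair_le(6)[of b a k] le_trans by blast
  qed
  then have "Q d0" unfolding Q_iff d0 by (auto simp: less_succ_le)
  have "\<exists>d. Q d \<and> (\<forall>d' x. mem d x \<longrightarrow> (\<forall>i. mem d' i \<longleftrightarrow> mem d i \<and> i \<noteq> x) \<longrightarrow> \<not> Q d')"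
  proof (rule minimal_set[OF rQ \<open>Q d0\<close>])
    show "Q d'" if "\<And>i. mem d i \<longleftrightarrow> mem d' i" "Q d" for d d'
      using that(2) unfolding Q_iff that(1) .
    show ?thesis if "Q d" "\<And>d' x. mem d x \<Longrightarrow> (\<And>i. mem d' i \<longleftrightarrow> mem d i \<and> i \<noteq> x) \<Longrightarrow> \<not> Q d'" for d
      using that by blast
  qed
  then obtain d where Qd: "Q d" and min: "\<And>d' x. mem d x \<Longrightarrow> (\<forall>i. mem d' i \<longleftrightarrow> mem d i \<and> i \<noteq> x) \<Longrightarrow> \<not> Q d'"
    by blast
  \<comment> \<open>By minimality every element but \<open>w\<close> has a predecessor; hence the set is closed backwards as well.\<close>
  have pred: "(\<exists>b. mem c \<langle>\<langle>x, b\<rangle>, \<alpha>\<rangle> \<and> mem d b) \<or> (\<exists>a. mem c \<langle>\<langle>a, x\<rangle>, \<beta>\<rangle> \<and> mem d a)"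
    if x: "mem d x" "x \<noteq> w" for x
  proof -
    have "rec (\<lambda>i. mem d i \<and> i \<noteq> x)" by (intro rec_intro)
    from ex_code[OF this, of d]
    obtain d' where d': "\<forall>i. mem d' i \<longleftrightarrow> mem d i \<and> i \<noteq> x" using mem_less by blast
    from min[OF x(1) this] Qd x(2) show ?thesis unfolding Q_iff d'[rule_format] by blast
  qed
  have w: "mem d w" and cl: "\<And>a b. mem c \<langle>\<langle>a, b\<rangle>, \<alpha>\<rangle> \<Longrightarrow> mem d b \<Longrightarrow> mem d a"
      "\<And>a b. mem c \<langle>\<langle>a, b\<rangle>, \<beta>\<rangle> \<Longrightarrow> mem d a \<Longrightarrow> mem d b"
    using Qd unfolding Q_iff by blast+
  have back1: "mem d a" if "mem c \<langle>\<langle>a, b\<rangle>, \<beta>\<rangle>" "mem d b" for a b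
  proof -
    have "b \<noteq> w" using that(1) free(2) by blast
    from pred[OF that(2) this] vD(4)[OF that(1)] vD(1)[of b]
    obtain a' where a': "mem c \<langle>\<langle>a', b\<rangle>, \<beta>\<rangle>" "mem d a'" by blast
    then have "a' = a" using comp[OF a'(1) that(1)] by (auto simp: compatible_triples)
    then show ?thesis using a' by blast
  qed
  have back2: "mem d b" if "mem c \<langle>\<langle>a, b\<rangle>, \<alpha>\<rangle>" "mem d a" for a b
  proof -
    have "a \<noteq> w" using vD(3)[OF that(1)] vw(2) by blast
    from pred[OF that(2) this] vD(3)[OF that(1)] vD(2)[of _ a]
    obtain b' where b': "mem c \<langle>\<langle>a, b'\<rangle>, \<alpha>\<rangle>" "mem d b'" by blast
    then have "b' = b" using comp[OF b'(1) that(1)] by (auto simp: compatible_triples)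
    then show ?thesis using b' by blast
  qed
  show thesis
  proof (rule that[of "mem d"])
    show "rec (mem d)" by (intro rec_intro)
    show "mem d w" by (rule w)
    show "\<not> mem d v"
    proof
      assume "mem d v"
      moreover have "v \<noteq> w" using vw parts(3) by blast
      ultimately show False using pred free(1) vD(2)[of _ v] vw(1) parts(3) by blast
    qed
    show "mem d a \<longleftrightarrow> mem d b" if "mem c \<langle>\<langle>a, b\<rangle>, k\<rangle>" "k = \<alpha> \<or> k = \<beta>" for a b k
      using that cl back1 back2 by blast
  qed
qed

lemma extend_coloring:
  assumes Y: "partial_coloring (mem c) j" and j: "edge j"
  shows "\<exists>d. partial_coloring (mem d) (j \<oplus> \<one>)"
proof -
  have valid: "mem c z \<Longrightarrow> valid z" and comp: "mem c y \<Longrightarrow> mem c z \<Longrightarrow> compatible y z"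
    and below: "mem c z \<Longrightarrow> p1 z \<prec> j" for y z
    using Y unfolding partial_coloring_def by blast+
  note vD = validD[OF valid]
  obtain v w where vw: "j = \<langle>v, w\<rangle>" "v \<in> A" "w \<in> B" "adj M E v w"
    using j unfolding edge_def by blast
  have new: "\<not> mem c \<langle>\<langle>v, w\<rangle>, k\<rangle>" for k using below vw(1) less_irrefl by force
  have "rec2 (\<lambda>k x. mem c \<langle>\<langle>v, x\<rangle>, k\<rangle>)" by (intro rec_intro)
  then have "\<exists>\<alpha>. \<one> \<preceq> \<alpha> \<and> \<alpha> \<preceq> n \<and> (\<forall>x. \<not> mem c \<langle>\<langle>v, x\<rangle>, \<alpha>\<rangle>)"
  proof (rule free_color[OF _ vw(4)])
    show "k = k'" if "mem c \<langle>\<langle>v, x\<rangle>, k\<rangle>" "mem c \<langle>\<langle>v, x\<rangle>, k'\<rangle>" for k k' x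
      using comp[OF that] by (simp add: compatible_triples)
    show "adj M E v x \<and> x \<noteq> w" if "mem c \<langle>\<langle>v, x\<rangle>, k\<rangle>" for k x
      using vD(5)[OF that] that new by blast
  qed
  then obtain \<alpha> where \<alpha>: "\<one> \<preceq> \<alpha>" "\<alpha> \<preceq> n" "\<And>x. \<not> mem c \<langle>\<langle>v, x\<rangle>, \<alpha>\<rangle>" by blast
  have "rec2 (\<lambda>k x. mem c \<langle>\<langle>x, w\<rangle>, k\<rangle>)" by (intro rec_intro)
  then have "\<exists>\<beta>. \<one> \<preceq> \<beta> \<and> \<beta> \<preceq> n \<and> (\<forall>x. \<not> mem c \<langle>\<langle>x, w\<rangle>, \<beta>\<rangle>)"
  proof (rule free_color[OF _ adj_sym[OF vw(4)]])
    show "k = k'" if "mem c \<langle>\<langle>x, w\<rangle>, k\<rangle>" "mem c \<langle>\<langle>x, w\<rangle>, k'\<rangle>" for k k' x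
      using comp[OF that] by (simp add: compatible_triples)
    show "adj M E w x \<and> x \<noteq> v" if "mem c \<langle>\<langle>x, w\<rangle>, k\<rangle>" for k x
      using adj_sym[OF vD(5)[OF that]] that new by blast
  qed
  then obtain \<beta> where \<beta>: "\<one> \<preceq> \<beta>" "\<beta> \<preceq> n" "\<And>x. \<not> mem c \<langle>\<langle>x, w\<rangle>, \<beta>\<rangle>" by blast
  obtain K where K: "rec K" "K w" "\<not> K v"
    "\<And>a b k. mem c \<langle>\<langle>a, b\<rangle>, k\<rangle> \<Longrightarrow> k = \<alpha> \<or> k = \<beta> \<Longrightarrow> K a \<longleftrightarrow> K b"
    using kempe_chain[OF Y \<alpha>(3) \<beta>(3) vw(2,3)] by blast
  \<comment> \<open>Testing only the end \<open>a\<close> in \<open>A\<close> suffices, since both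
    ends of an edge colored \<open>\<alpha>\<close> or \<open>\<beta>\<close> agree about
    \<open>K\<close>. After the swap \<open>\<alpha>\<close> is free at \<open>w\<close> and still
    free at \<open>v\<close>.\<close>
  define sw where "sw a k = (if K a then if k = \<alpha> then \<beta> else if k = \<beta> then \<alpha> else k else k)" for a k
  have sw_sw: "sw a (sw a k) = k" for a k by (simp add: sw_def)
  have sw_range: "\<one> \<preceq> sw a k \<and> sw a k \<preceq> n \<longleftrightarrow> \<one> \<preceq> k \<and> k \<preceq> n" for a k
    using \<alpha> \<beta> by (auto simp: sw_def)
  have rec_sw: "recf f \<Longrightarrow> recf g \<Longrightarrow> recf (\<lambda>x. sw (f x) (g x))" for f g
    unfolding sw_def by (intro rec_intro rec_subst[OF K(1)])
  \<comment> \<open>The recolored set is written as a preimage under \<open>sw\<close>, which equals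
    the image because \<open>sw\<close> is an involution; the new edge receives
    \<open>\<alpha>\<close>.\<close>
  define Y' where "Y' z \<longleftrightarrow> z = \<langle>\<langle>p1 (p1 z), p2 (p1 z)\<rangle>, p2 z\<rangle> \<and> mem c \<langle>p1 z, sw (p1 (p1 z)) (p2 z)\<rangle> \<or>
    z = \<langle>\<langle>v, w\<rangle>, \<alpha>\<rangle>" for z
  have Y'_iff: "Y' \<langle>\<langle>a, b\<rangle>, k\<rangle> \<longleftrightarrow> mem c \<langle>\<langle>a, b\<rangle>, sw a k\<rangle> \<or> a = v \<and> b = w \<and> k = \<alpha>" for a b k
    by (simp add: Y'_def)
  have Y'_triple: "Y' z \<Longrightarrow> \<exists>a b k. z = \<langle>\<langle>a, b\<rangle>, k\<rangle>" for z by (auto simp: Y'_def)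
  have rY': "rec Y'" unfolding Y'_def by (intro rec_intro rec_sw)
  have valid': "valid z \<and> p1 z \<prec> j \<oplus> \<one>" if "Y' z" for z
  proof -
    from Y'_triple[OF that] obtain a b k where z: "z = \<langle>\<langle>a, b\<rangle>, k\<rangle>" by blast
    from that[unfolded z Y'_iff] show ?thesis
    proof (elim disjE conjE)
      assume m: "mem c \<langle>\<langle>a, b\<rangle>, sw a k\<rangle>"
      then have "\<langle>a, b\<rangle> \<prec> j" using below by force
      then show ?thesis using vD[OF m] sw_range[of a k] z by (simp add: valid_def edge_pair less_succ)
    next
      assume "a = v" "b = w" "k = \<alpha>"
      then show ?thesis using z j vw(1) \<alpha> by (simp add: valid_def less_succ)
    qed
  qed
  have comp_new: "k \<noteq> \<alpha>" if m: "mem c \<langle>\<langle>a, b\<rangle>, sw a k\<rangle>" and share: "a = v \<or> b = w" for a b k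
  proof
    assume k: "k = \<alpha>"
    from share show False
    proof
      assume "a = v" then show False using m \<alpha>(3) K(3) k by (simp add: sw_def)
    next
      assume b: "b = w"
      show False
      proof (cases "K a")
        case True then show False using m \<beta>(3) k b by (simp add: sw_def)
      next
        case False then show False using m K(2) K(4)[of a w \<alpha>] k b by (simp add: sw_def)
      qed
    qed
  qed
  have comp': "compatible y z" if yz: "Y' y" "Y' z" for y z
  proof -
    obtain a b k where y: "y = \<langle>\<langle>a, b\<rangle>, k\<rangle>" using Y'_triple yz by blast
    obtain a' b' k' where z: "z = \<langle>\<langle>a', b'\<rangle>, k'\<rangle>" using Y'_triple yz by blast
    from yz(1)[unfolded y Y'_iff] yz(2)[unfolded z Y'_iff] show ?thesis
    proof (elim disjE conjE)
      assume m: "mem c \<langle>\<langle>a, b\<rangle>, sw a k\<rangle>" "mem c \<langle>\<langle>a', b'\<rangle>, sw a' k'\<rangle>"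
      have "sw a k = sw a' k' \<longleftrightarrow> k = k'" if "a = a' \<or> b = b'"
      proof (cases "K a \<longleftrightarrow> K a'")
        case True
        then have "sw a = sw a'" by (auto simp: sw_def)
        then show ?thesis using sw_sw by metis
      next
        \<comment> \<open>The edges meet at \<open>b\<close>, but only one of them starts in
          \<open>K\<close>. An edge colored \<open>\<alpha>\<close> or \<open>\<beta>\<close> would
          tie \<open>b\<close> to its other end, so at most one of the two has such a color;
          swapping keeps that color within \<open>{\<alpha>, \<beta>}\<close> and leaves the other
          color alone.\<close>
        case False
        then have b: "b = b'" using that by blast
        show ?thesis
        proof (cases "sw a k = \<alpha> \<or> sw a k = \<beta>")
          case True
          then have "K a \<longleftrightarrow> K b" using K(4)[OF m(1)] by blast
          then have "\<not> (sw a' k' = \<alpha> \<or> sw a' k' = \<beta>)" using K(4)[OF m(2)] False b by blast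
          then show ?thesis using True by (auto simp: sw_def split: if_splits)
        next
          case False
          show ?thesis
          proof (cases "sw a' k' = \<alpha> \<or> sw a' k' = \<beta>")
            case True
            then show ?thesis using False by (auto simp: sw_def split: if_splits)
          next
            case False': False
            then show ?thesis using False by (auto simp: sw_def split: if_splits)
          qed
        qed
      qed
      then show ?thesis using comp[OF m] unfolding y z compatible_triples by blast
    next
      assume "mem c \<langle>\<langle>a, b\<rangle>, sw a k\<rangle>" "a' = v" "b' = w" "k' = \<alpha>"
      then show ?thesis unfolding y z compatible_triples using comp_new new by blast
    next
      assume "mem c \<langle>\<langle>a', b'\<rangle>, sw a' k'\<rangle>" "a = v" "b = w" "k = \<alpha>"
      then show ?thesis unfolding y z compatible_triples using comp_new new by blast
    qed (auto simp: y z compatible_triples)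
  qed
  have total': "\<exists>k. k \<preceq> n \<and> Y' \<langle>p, k\<rangle>" if "p \<prec> j \<oplus> \<one>" "edge p" for p
  proof (cases "p = j")
    case True
    then show ?thesis using \<alpha> vw(1) Y'_iff by blast
  next
    case False
    then have "p \<prec> j" using that(1) less_succ by blast
    with that(2) Y have "\<exists>k. mem c \<langle>p, k\<rangle>" unfolding partial_coloring_def by blast
    then obtain k where k: "mem c \<langle>p, k\<rangle>" by blast
    from that(2) obtain a b where p: "p = \<langle>a, b\<rangle>" unfolding edge_def by blast
    have "Y' \<langle>p, sw a k\<rangle>" using k p by (simp add: Y'_iff sw_sw)
    moreover have "sw a k \<preceq> n" using vD(6,7)[of a b k] k p sw_range[of a k] by blast
    ultimately show ?thesis by blast
  qed
  have "z \<prec> \<langle>j \<oplus> \<one>, n\<rangle> \<oplus> \<one>" if "Y' z" for z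
  proof -
    have "z = \<langle>p1 z, p2 z\<rangle>" "p1 z \<preceq> j \<oplus> \<one>" "p2 z \<preceq> n"
      using valid'[OF that] unfolding valid_def by (auto intro: ar.less_imp_le)
    then show ?thesis unfolding less_succ_le using pair_mono by metis
  qed
  from ex_code[OF rY' this] obtain d where d: "\<And>i. mem d i \<longleftrightarrow> Y' i" by blast
  have "mem d = Y'" using d by blast
  then have "partial_coloring (mem d) (j \<oplus> \<one>)"
    unfolding partial_coloring_def using valid' comp' total' by simp
  then show ?thesis ..
qed

lemma ex_partial_coloring: "\<exists>c. partial_coloring (mem c) j"
  using rec_partial_coloring
proof (induct j rule: sig_induct)
  case zero
  have "rec (\<lambda>i. False)" by (intro rec_intro)
  from ex_code[OF this, of \<zero>] obtain c where c: "\<And>i. mem c i \<longleftrightarrow> False" by blast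
  have "partial_coloring (mem c) \<zero>"
    unfolding partial_coloring_def c using not_less_zero by blast
  then show ?case ..
next
  case (succ j c)
  show ?case
  proof (cases "edge j")
    case True
    then show ?thesis using extend_coloring succ by blast
  next
    case False
    then have "partial_coloring (mem c) (j \<oplus> \<one>)"
      using succ unfolding partial_coloring_def less_succ by blast
    then show ?thesis ..
  qed
qed

theorem chromatic_index:
  assumes wkl: "weak_Koenig M"
  shows "chromatic_index_le M E n"
proof -
  \<comment> \<open>Totality is demanded for \<open>p\<close> only once
    \<open>\<langle>p, n\<rangle> < l\<close>: then every candidate
    \<open>\<langle>p, k\<rangle>\<close> with \<open>k \<le> n\<close> is among the first
    \<open>l\<close> bits, as compactness requires.\<close>
  define Q where "Q Y l \<longleftrightarrow> (\<forall>z. z \<prec> l \<longrightarrow> Y z \<longrightarrow> valid z) \<and>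
     (\<forall>y. y \<prec> l \<longrightarrow> (\<forall>z. z \<prec> l \<longrightarrow> Y y \<longrightarrow> Y z \<longrightarrow> compatible y z)) \<and>
     (\<forall>p. p \<prec> l \<longrightarrow> edge p \<longrightarrow> \<langle>p, n\<rangle> \<prec> l \<longrightarrow> (\<exists>k. k \<preceq> n \<and> Y \<langle>p, k\<rangle>))" for Y l
  have "\<exists>X. rec X \<and> (\<forall>l. Q X l)"
  proof (rule compactness[OF wkl, of Q])
    show "rec2 (\<lambda>s l. Q (\<lambda>i. entry M s i \<one>) l)" unfolding Q_def by (intro rec_intro)
    show "Q P' l" if eq: "\<And>i. i \<prec> l \<Longrightarrow> P i \<longleftrightarrow> P' i" and Q: "Q P l" for P P' l
    proof -
      have lt: "\<langle>p, k\<rangle> \<prec> l" if "\<langle>p, n\<rangle> \<prec> l" "k \<preceq> n" for p k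
        using pair_mono[OF ar.order_refl that(2)] that(1) ar.le_less_trans by blast
      show ?thesis unfolding Q_def
      proof (intro conjI allI impI)
        show "valid z" if "z \<prec> l" "P' z" for z using that Q eq[OF that(1)] unfolding Q_def by blast
        show "compatible y z" if "y \<prec> l" "z \<prec> l" "P' y" "P' z" for y z
          using that Q eq[OF that(1)] eq[OF that(2)] unfolding Q_def by blast
        fix p assume p: "p \<prec> l" "edge p" "\<langle>p, n\<rangle> \<prec> l"
        then obtain k where k: "k \<preceq> n" "P \<langle>p, k\<rangle>" using Q unfolding Q_def by blast
        then show "\<exists>k. k \<preceq> n \<and> P' \<langle>p, k\<rangle>" using eq[OF lt[OF p(3) k(1)]] by blast
      qed
    qed
    show "Q P k" if "k \<preceq> l" "Q P l" for P k l
    proof -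
      have lt: "z \<prec> l" if "z \<prec> k" for z using that \<open>k \<preceq> l\<close> ar.less_le_trans by blast
      show ?thesis unfolding Q_def
      proof (intro conjI allI impI)
        show "valid z" if "z \<prec> k" "P z" for z
          using that lt[OF that(1)] \<open>Q P l\<close> unfolding Q_def by blast
        show "compatible y z" if "y \<prec> k" "z \<prec> k" "P y" "P z" for y z
          using that lt[OF that(1)] lt[OF that(2)] \<open>Q P l\<close> unfolding Q_def by blast
        show "\<exists>i. i \<preceq> n \<and> P \<langle>p, i\<rangle>" if "p \<prec> k" "edge p" "\<langle>p, n\<rangle> \<prec> k" for p
          using that lt[OF that(1)] lt[OF that(3)] \<open>Q P l\<close> unfolding Q_def by blast
      qed
    qed
    show "\<exists>P. rec P \<and> Q P l" for l
    proof -
      obtain c where c: "partial_coloring (mem c) l" using ex_partial_coloring by blast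
      have "rec (mem c)" by (intro rec_intro)
      moreover have "Q (mem c) l" using c unfolding Q_def partial_coloring_def by blast
      ultimately show ?thesis by blast
    qed
  qed blast
  then obtain X where X: "rec X" "\<And>l. Q X l" by blast
  have valid: "valid z" if "X z" for z
    using X(2)[of "z \<oplus> \<one>"] that less_succ unfolding Q_def by blast
  have comp: "compatible y z" if "X y" "X z" for y z
  proof -
    have "y \<prec> y \<oplus> z \<oplus> \<one>" "z \<prec> y \<oplus> z \<oplus> \<one>" by (simp_all add: less_succ_le)
    then show ?thesis using X(2)[of "y \<oplus> z \<oplus> \<one>"] that unfolding Q_def by blast
  qed
  have total: "\<exists>k. X \<langle>p, k\<rangle>" if "edge p" for p
  proof -
    have "p \<prec> \<langle>p, n\<rangle> \<oplus> \<one>" "\<langle>p, n\<rangle> \<prec> \<langle>p, n\<rangle> \<oplus> \<one>" by (simp_all add: less_succ_le pair_le)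
    then show ?thesis using X(2)[of "\<langle>p, n\<rangle> \<oplus> \<one>"] that unfolding Q_def by blast
  qed
  note vD = validD[OF valid]
  \<comment> \<open>Adding the reversed orientation gives the required symmetric function. The two
    orientations cannot interfere, since no vertex lies in both parts.\<close>
  define C where "C = {z. z = \<langle>\<langle>p1 (p1 z), p2 (p1 z)\<rangle>, p2 z\<rangle> \<and> (X z \<or> X \<langle>\<langle>p2 (p1 z), p1 (p1 z)\<rangle>, p2 z\<rangle>)}"
  have C: "C \<in> Sets M" unfolding C_def rec_def[symmetric] by (intro rec_intro X(1) rec_subst[OF X(1)])
  have C_iff: "\<langle>\<langle>v, w\<rangle>, k\<rangle> \<in> C \<longleftrightarrow> X \<langle>\<langle>v, w\<rangle>, k\<rangle> \<or> X \<langle>\<langle>w, v\<rangle>, k\<rangle>" for v w k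
    by (simp add: C_def)
  have X_comp: "a = a' \<and> b = b' \<longleftrightarrow> k = k'" if "X \<langle>\<langle>a, b\<rangle>, k\<rangle>" "X \<langle>\<langle>a', b'\<rangle>, k'\<rangle>" "a = a' \<or> b = b'" for a a' b b' k k'
    using comp[OF that(1,2)] that(3) by (simp add: compatible_triples)
  have X_disj: False if "X \<langle>\<langle>v, w\<rangle>, k\<rangle>" "X \<langle>\<langle>w', v\<rangle>, k'\<rangle>" for v w w' k k'
    using vD(1)[OF that(1)] vD(4)[OF that(2)] by blast
  have C_uniq: "k = k'" if "\<langle>\<langle>v, w\<rangle>, k\<rangle> \<in> C" "\<langle>\<langle>v, w\<rangle>, k'\<rangle> \<in> C" for v w k k'
    using that[unfolded C_iff] X_comp[of v w k v w k'] X_comp[of w v k w v k'] X_disj by blast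
  have C_proper: "w = w'" if "\<langle>\<langle>v, w\<rangle>, k\<rangle> \<in> C" "\<langle>\<langle>v, w'\<rangle>, k\<rangle> \<in> C" for v w w' k
    using that[unfolded C_iff] X_comp[of v w k v w' k] X_comp[of w v k w' v k] X_disj by blast
  have "is_fun M {pair M v w | v w. adj M E v w} {c. le M \<one> c \<and> le M c n} C"
    unfolding is_fun_def
  proof (intro conjI ballI)
    show "C \<in> Sets M" by (rule C)
    show "C \<subseteq> {\<langle>x, y\<rangle> | x y. x \<in> {pair M v w | v w. adj M E v w} \<and> y \<in> {c. \<one> \<preceq> c \<and> c \<preceq> n}}"
    proof
      fix z assume z: "z \<in> C"
      then obtain v w k where "z = \<langle>\<langle>v, w\<rangle>, k\<rangle>" unfolding C_def by blast
      moreover from z[unfolded this C_iff] have "adj M E v w" "\<one> \<preceq> k" "k \<preceq> n"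
        using vD(5-7)[of v w k] vD(5-7)[of w v k] adj_sym[of w v] by blast+
      ultimately show "z \<in> {\<langle>x, y\<rangle> | x y. x \<in> {pair M v w | v w. adj M E v w} \<and> y \<in> {c. \<one> \<preceq> c \<and> c \<preceq> n}}"
        by blast
    qed
    fix x assume "x \<in> {pair M v w | v w. adj M E v w}"
    then obtain v w where x: "x = \<langle>v, w\<rangle>" "adj M E v w" by blast
    then have "edge \<langle>v, w\<rangle> \<or> edge \<langle>w, v\<rangle>" using adj_parts adj_sym edge_pair by blast
    then obtain k where "\<langle>\<langle>v, w\<rangle>, k\<rangle> \<in> C" using total C_iff by blast
    then show "\<exists>!y. \<langle>x, y\<rangle> \<in> C" using C_uniq x(1) by blast
  qed
  then have "proper_edge_coloring M E n C"
    unfolding proper_edge_coloring_def using C_proper C_iff by blast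
  then show ?thesis unfolding chromatic_index_le_def ..
qed

end

lemma (in rca) weak_Koenig_imp_chromatic_index:
  assumes "weak_Koenig M" "countable_graph M E" "bipartite M E" "degrees_at_most M E n"
  shows "chromatic_index_le M E n"
proof -
  obtain A B where AB: "A \<in> Sets M" "B \<in> Sets M" "A \<inter> B = {}"
    "\<And>v w. adj M E v w \<Longrightarrow> (v \<in> A \<and> w \<in> B) \<or> (v \<in> B \<and> w \<in> A)"
    using assms(3) unfolding bipartite_def by blast
  interpret bipartite_rca M E A B n by standard (use assms AB in blast)+
  show ?thesis by (rule chromatic_index[OF assms(1)])
qed

context rca
begin

section \<open>From two-colorings of bounded graphs to separation\<close>

definition even_M :: "'m \<Rightarrow> bool" where
  "even_M i \<longleftrightarrow> (\<exists>q. q \<preceq> i \<and> i = q \<oplus> q)"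

lemma rec_even [rec_intro]: "recf f \<Longrightarrow> rec (\<lambda>x. even_M (f x))"
  by (rule rec_subst) (unfold even_M_def, intro rec_intro)

lemma even_iff: "even_M i \<longleftrightarrow> (\<exists>q. i = q \<oplus> q)"
  unfolding even_M_def using le_add1 by metis

lemma even_zero: "even_M \<zero>"
  unfolding even_iff using add_zero by metis

lemma double_neq: "q \<oplus> q \<noteq> s \<oplus> s \<oplus> \<one>"
proof
  assume eq: "q \<oplus> q = s \<oplus> s \<oplus> \<one>"
  show False
  proof (cases "q \<preceq> s")
    case True
    then have "q \<oplus> q \<preceq> s \<oplus> s" by (simp add: ar.add_mono)
    then show False unfolding eq succ_le using less_irrefl by blast
  next
    case False
    then have "s \<oplus> \<one> \<preceq> q" by (simp add: succ_le)
    then have "(s \<oplus> \<one>) \<oplus> (s \<oplus> \<one>) \<preceq> q \<oplus> q" by (simp add: ar.add_mono)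
    then have "(s \<oplus> s \<oplus> \<one>) \<oplus> \<one> \<preceq> s \<oplus> s \<oplus> \<one>" unfolding eq by (simp add: algebra_simps)
    then show False unfolding succ_le using less_irrefl by blast
  qed
qed

lemma even_or_odd: "even_M i \<or> even_M (i \<oplus> \<one>)"
proof -
  have "rec (\<lambda>i. even_M i \<or> even_M (i \<oplus> \<one>))" by (intro rec_intro)
  then show ?thesis
  proof (induct i rule: rec_induct)
    case zero show ?case using even_zero by blast
  next
    case (succ i)
    show ?case
    proof (cases "even_M i")
      case True
      then obtain q where "i = q \<oplus> q" unfolding even_iff by blast
      then have "i \<oplus> \<one> \<oplus> \<one> = (q \<oplus> \<one>) \<oplus> (q \<oplus> \<one>)" by (simp add: algebra_simps)
      then show ?thesis unfolding even_iff by blast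
    qed (use succ in blast)
  qed
qed

lemma even_succ: "even_M (i \<oplus> \<one>) \<longleftrightarrow> \<not> even_M i"
  using even_or_odd[of i] double_neq unfolding even_iff by metis

text \<open>\<open>has_degree\<close> wants an exact list without repetition, whereas
  \<open>a\<close> and \<open>b\<close> only include the neighbors; hence the cases by which of them
  are neighbors and whether they differ.\<close>

lemma degree_le_two:
  assumes E: "E \<in> Sets M" and nbr: "\<And>w. adj M E v w \<Longrightarrow> w = a \<or> w = b"
  shows "\<exists>d. has_degree M E v d \<and> d \<preceq> \<one> \<oplus> \<one>"
proof -
  have list: "has_degree M E v d" if f: "recf f" and fin: "\<And>i. i \<prec> d \<Longrightarrow> f i \<preceq> a \<oplus> b"
    and inj: "\<And>i j. i \<prec> d \<Longrightarrow> j \<prec> d \<Longrightarrow> f i = f j \<Longrightarrow> i = j"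
    and all: "\<And>w. adj M E v w \<longleftrightarrow> (\<exists>i. i \<prec> d \<and> w = f i)" for f d
  proof -
    have "f i \<prec> a \<oplus> b \<oplus> \<one>" if "i \<prec> d" for i using fin that by (simp add: less_succ_le)
    from ex_seq[OF f this] obtain s where "is_seq M s d" "\<And>i x. entry M s i x \<longleftrightarrow> i \<prec> d \<and> x = f i"
      by metis
    then show ?thesis unfolding has_degree_def using inj all by metis
  qed
  have le: "a \<preceq> a \<oplus> b" "b \<preceq> a \<oplus> b" by simp_all
  have one: "i \<prec> \<one> \<longleftrightarrow> i = \<zero>" for i
    using less_succ[of i \<zero>] not_less_zero by (simp add: zero_add)
  have two: "i \<prec> \<one> \<oplus> \<one> \<longleftrightarrow> i = \<zero> \<or> i = \<one>" for i
    using less_succ[of i \<one>] one by blast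
  consider "\<not> adj M E v a" "\<not> adj M E v b" | "adj M E v a" "\<not> adj M E v b \<or> a = b"
    | "\<not> adj M E v a" "adj M E v b" | "adj M E v a" "adj M E v b" "a \<noteq> b" by blast
  then show ?thesis
  proof cases
    case 1
    have "has_degree M E v \<zero>"
    proof (rule list[OF recf_const[of a]])
      show "adj M E v w \<longleftrightarrow> (\<exists>i. i \<prec> \<zero> \<and> w = a)" for w
        using 1 nbr[of w] by (auto simp: not_less_zero)
    qed (auto simp: not_less_zero)
    then show ?thesis by auto
  next
    case 2
    have "has_degree M E v \<one>"
    proof (rule list[OF recf_const[of a]])
      show "adj M E v w \<longleftrightarrow> (\<exists>i. i \<prec> \<one> \<and> w = a)" for w
        using 2 nbr[of w] by (auto simp: one)
    qed (auto simp: one)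
    then show ?thesis by auto
  next
    case 3
    have "has_degree M E v \<one>"
    proof (rule list[OF recf_const[of b]])
      show "adj M E v w \<longleftrightarrow> (\<exists>i. i \<prec> \<one> \<and> w = b)" for w
        using 3 nbr[of w] by (auto simp: one)
    qed (auto simp: one)
    then show ?thesis by auto
  next
    case 4
    have "recf (\<lambda>i. if i = \<zero> then a else b)" by (intro rec_intro)
    then have "has_degree M E v (\<one> \<oplus> \<one>)"
    proof (rule list)
      show "adj M E v w \<longleftrightarrow> (\<exists>i. i \<prec> \<one> \<oplus> \<one> \<and> w = (if i = \<zero> then a else b))" for w
      proof -
        have e: "(\<exists>i. (i = \<zero> \<or> i = \<one>) \<and> w = (if i = \<zero> then a else b)) \<longleftrightarrow> w = a \<or> w = b"
          using zero_neq_one by metis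
        show ?thesis unfolding two e using nbr[of w] 4 by blast
      qed
    qed (use 4 in \<open>auto simp: two split: if_splits\<close>)
    then show ?thesis by auto
  qed
qed

theorem separation:
  assumes coloring: "\<forall>E. countable_graph M E \<and> bounded_graph M E \<and> bipartite M E
      \<and> degrees_at_most M E (\<one> \<oplus> \<one>) \<longrightarrow> chromatic_index_le M E (\<one> \<oplus> \<one>)"
    and R0: "rec2 R0" and R1: "rec2 R1" and disj: "\<And>x y z. R0 x y \<Longrightarrow> R1 x z \<Longrightarrow> False"
  shows "\<exists>S. rec S \<and> (\<forall>x y. R0 x y \<longrightarrow> S x) \<and> (\<forall>x y. R1 x y \<longrightarrow> \<not> S x)"
proof -
  define two where "two = \<one> \<oplus> \<one>"
  define three where "three = two \<oplus> \<one>"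
  have less1: "i \<prec> \<one> \<longleftrightarrow> i = \<zero>" for i
    using less_succ[of i \<zero>] not_less_zero by (simp add: zero_add)
  have less2: "i \<prec> two \<longleftrightarrow> i = \<zero> \<or> i = \<one>" for i
    unfolding two_def using less_succ[of i \<one>] less1 by blast
  have less3: "i \<prec> three \<longleftrightarrow> i = \<zero> \<or> i = \<one> \<or> i = two" for i
    unfolding three_def using less_succ[of i two] less2 by blast
  have neq [simp]: "\<zero> \<noteq> \<one>" "\<zero> \<noteq> two" "\<zero> \<noteq> three" "\<one> \<noteq> two" "\<one> \<noteq> three" "two \<noteq> three"
    "\<one> \<noteq> \<zero>" "two \<noteq> \<zero>" "three \<noteq> \<zero>" "two \<noteq> \<one>" "three \<noteq> \<one>" "three \<noteq> two"
    using less1 less2 less3 less_irrefl by metis+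
  define alive where "alive x i \<longleftrightarrow> (\<forall>j. j \<prec> i \<longrightarrow> \<not> R0 x j \<and> \<not> R1 x j)" for x i
  have rec_alive: "recf f \<Longrightarrow> recf g \<Longrightarrow> rec (\<lambda>x. alive (f x) (g x))" for f g
    unfolding alive_def by (rule rec_subst2[of "\<lambda>x i. \<forall>j. j \<prec> i \<longrightarrow> \<not> R0 x j \<and> \<not> R1 x j"])
      (intro rec_intro rec_subst2[OF R0] rec_subst2[OF R1])
  have alive_zero: "alive x \<zero>" for x unfolding alive_def using not_less_zero by blast
  have alive_mono: "alive x (i \<oplus> \<one>) \<Longrightarrow> alive x i" for x i
    unfolding alive_def less_succ by blast
  \<comment> \<open>Here \<open>j\<close> is the first witness: the rays still contain the edge from
    \<open>j\<close> to \<open>j + 1\<close> but stop there, so \<open>i = j + 1\<close> is the last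
    height and a connecting edge keeps the degree at most 2.\<close>
  define join where "join R x i \<longleftrightarrow> (\<exists>j. j \<prec> i \<and> i = j \<oplus> \<one> \<and> alive x j \<and> R x j)"
    for R :: "'m \<Rightarrow> 'm \<Rightarrow> bool" and x i
  have rec_join: "recf f \<Longrightarrow> recf g \<Longrightarrow> rec (\<lambda>x. join R (f x) (g x))" if "rec2 R" for f g R
    unfolding join_def
    by (rule rec_subst2[of "\<lambda>x i. \<exists>j. j \<prec> i \<and> i = j \<oplus> \<one> \<and> alive x j \<and> R x j"])
      (intro rec_intro rec_alive rec_subst2[OF that])
  have join0: "R0 x (i \<ominus> \<one>)" "\<not> alive x i" if "join R0 x i" for x i
    using that minus_eqI[of \<one> _ i] unfolding join_def alive_def by (auto simp: add_comm)
  have join1: "\<not> R0 x (i \<ominus> \<one>)" "\<not> alive x i" if "join R1 x i" for x i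
    using that disj minus_eqI[of \<one> _ i] unfolding join_def alive_def by (auto simp: add_comm)
  \<comment> \<open>For \<open>r < 3\<close> the vertices \<open>\<langle>x, \<langle>r, i\<rangle>\<rangle>\<close> form ray \<open>r\<close> of the component of \<open>x\<close>, cut off at the first witness;
    \<open>\<langle>x, \<langle>3, 0\<rangle>\<rangle>\<close> joins rays 1 and 2 to a line. The first witness \<open>j\<close> connects ray 0 at
    height \<open>j + 1\<close> to ray 1 if it is one for \<open>R0\<close>, and to ray 2 if it is one for \<open>R1\<close>.\<close>
  define D where "D x r i r' i' \<longleftrightarrow>
      (r = \<zero> \<or> r = \<one> \<or> r = two) \<and> r' = r \<and> i' = i \<oplus> \<one> \<and> alive x i \<or>
      r = three \<and> i = \<zero> \<and> i' = \<zero> \<and> (r' = \<one> \<or> r' = two) \<or>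
      r = \<zero> \<and> r' = \<one> \<and> i' = i \<and> join R0 x i \<or>
      r = \<zero> \<and> r' = two \<and> i' = i \<and> join R1 x i" for x r i r' i'
  define N where "N v w \<longleftrightarrow> v = \<langle>p1 v, \<langle>p1 (p2 v), p2 (p2 v)\<rangle>\<rangle> \<and> w = \<langle>p1 w, \<langle>p1 (p2 w), p2 (p2 w)\<rangle>\<rangle> \<and> p1 v = p1 w \<and>
      (D (p1 v) (p1 (p2 v)) (p2 (p2 v)) (p1 (p2 w)) (p2 (p2 w)) \<or>
       D (p1 v) (p1 (p2 w)) (p2 (p2 w)) (p1 (p2 v)) (p2 (p2 v)))" for v w
  have rec_N: "recf f \<Longrightarrow> recf g \<Longrightarrow> rec (\<lambda>x. N (f x) (g x))" for f g
    by (rule rec_subst2) (unfold N_def D_def, intro rec_intro rec_alive rec_join R0 R1)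
  have N_sym: "N v w \<Longrightarrow> N w v" for v w unfolding N_def by (elim conjE disjE) simp_all
  have N_pair: "N \<langle>x, \<langle>r, i\<rangle>\<rangle> \<langle>x, \<langle>r', i'\<rangle>\<rangle> \<longleftrightarrow> D x r i r' i' \<or> D x r' i' r i" for x r i r' i'
    unfolding N_def by simp
  have N_cases: "\<exists>x r i r' i'. v = \<langle>x, \<langle>r, i\<rangle>\<rangle> \<and> w = \<langle>x, \<langle>r', i'\<rangle>\<rangle> \<and> (D x r i r' i' \<or> D x r' i' r i)" if "N v w" for v w
    using that unfolding N_def by metis
  define E where "E = {z. z = \<langle>\<langle>p1 (p1 z), p2 (p1 z)\<rangle>, p2 z\<rangle> \<and>
     (p2 z = \<one> \<and> N (p1 (p1 z)) (p2 (p1 z)) \<or> p2 z = \<zero> \<and> \<not> N (p1 (p1 z)) (p2 (p1 z)))}"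
  have E: "E \<in> Sets M" unfolding E_def rec_def[symmetric] by (intro rec_intro rec_N)
  have E_iff: "\<langle>\<langle>v, w\<rangle>, b\<rangle> \<in> E \<longleftrightarrow> b = \<one> \<and> N v w \<or> b = \<zero> \<and> \<not> N v w" for v w b
    unfolding E_def by simp
  have adj: "adj M E v w \<longleftrightarrow> N v w" for v w
    unfolding adj_def E_iff by simp
  \<comment> \<open>The bipartition: even heights on ray 0 and the middle vertex lie on the side of
    the odd heights of rays 1 and 2. The opposite parity convention is what lets connecting edges
    stay at one height.\<close>
  have D_parity: "((r = \<zero> \<or> r = three) \<longleftrightarrow> even_M i) \<longleftrightarrow> \<not> ((r' = \<zero> \<or> r' = three) \<longleftrightarrow> even_M i')"
    if "D x r i r' i'" for x r i r' i'
    using that unfolding D_def by (elim disjE conjE) (simp_all add: even_succ even_zero)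
  have graph: "countable_graph M E"
    unfolding countable_graph_def is_fun_def
  proof (intro conjI allI impI ballI)
    show "E \<in> Sets M" by (rule E)
    show "E \<subseteq> {\<langle>x, y\<rangle> | x y. x \<in> {pair M v w | v w. True} \<and> y \<in> {\<zero>, \<one>}}" unfolding E_def by blast
    show "\<exists>!y. \<langle>x, y\<rangle> \<in> E" if "x \<in> {pair M v w | v w. True}" for x
    proof -
      from that obtain v w where x: "x = \<langle>v, w\<rangle>" by blast
      show ?thesis unfolding x E_iff by (cases "N v w") auto
    qed
    show "adj M E w v" if "adj M E v w" for v w using that N_sym unfolding adj by blast
    show "\<not> adj M E v v" for v
    proof
      assume "adj M E v v"
      then obtain x r i where "D x r i r i" using N_cases[of v v] unfolding adj by auto
      from D_parity[OF this] show False by blast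
    qed
  qed
  have "bounded_graph M E"
    unfolding bounded_graph_def
  proof (intro exI conjI allI impI)
    \<comment> \<open>Whichever ray is attached, neighbors stay in component \<open>x\<close>, have
      ray index at most \<open>three\<close> and height at most one more, so pairing monotonicity
      gives a bound without knowing the outcome of the race.\<close>
    let ?f = "\<lambda>v. \<langle>p1 v, \<langle>three, p2 (p2 v) \<oplus> \<one>\<rangle>\<rangle>"
    have "recf ?f" by (intro rec_intro)
    then show "is_fun M UNIV UNIV {p. \<exists>v. p = \<langle>v, ?f v\<rangle>}"
      unfolding is_fun_def recf_def rec_def by auto
    fix v w b assume "adj M E v w" and b: "\<langle>v, b\<rangle> \<in> {p. \<exists>v. p = \<langle>v, ?f v\<rangle>}"
    then obtain x r i r' i' where vw: "v = \<langle>x, \<langle>r, i\<rangle>\<rangle>" "w = \<langle>x, \<langle>r', i'\<rangle>\<rangle>" "D x r i r' i' \<or> D x r' i' r i"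
      using N_cases[of v w] unfolding adj by blast
    have "D x r i r' i' \<Longrightarrow> r \<preceq> three \<and> r' \<preceq> three \<and> i' \<preceq> i \<oplus> \<one> \<and> i \<preceq> i' \<oplus> \<one>" for r i r' i'
      using less3 unfolding D_def le_def[of _ _ three] by (elim disjE conjE) (simp_all add: ar.add_increasing2)
    then have "r' \<preceq> three" "i' \<preceq> i \<oplus> \<one>" using vw(3) by blast+
    then show "w \<preceq> b" using b vw by (auto intro!: pair_mono)
  qed
  moreover have "bipartite M E"
  proof -
    let ?A = "\<lambda>v. (p1 (p2 v) = \<zero> \<or> p1 (p2 v) = three) \<longleftrightarrow> even_M (p2 (p2 v))"
    have A: "rec ?A" by (intro rec_intro)
    have sets: "{v. ?A v} \<in> Sets M" "{v. \<not> ?A v} \<in> Sets M"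
      using A rec_not[OF A] unfolding rec_def by simp_all
    have sides: "v \<in> {v. ?A v} \<and> w \<in> {v. \<not> ?A v} \<or> v \<in> {v. \<not> ?A v} \<and> w \<in> {v. ?A v}"
      if "adj M E v w" for v w
    proof -
      from N_cases[of v w] that obtain x r i r' i'
        where vw: "v = \<langle>x, \<langle>r, i\<rangle>\<rangle>" "w = \<langle>x, \<langle>r', i'\<rangle>\<rangle>" "D x r i r' i' \<or> D x r' i' r i"
        unfolding adj by blast
      have "?A v \<longleftrightarrow> \<not> ?A w" using vw(3) D_parity unfolding vw(1,2) p1_pair p2_pair by blast
      then show ?thesis by blast
    qed
    have "{v. ?A v} \<union> {v. \<not> ?A v} = UNIV" "{v. ?A v} \<inter> {v. \<not> ?A v} = {}" by blast+
    then show ?thesis unfolding bipartite_def using sets sides by blast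
  qed
  moreover have "degrees_at_most M E (\<one> \<oplus> \<one>)"
    unfolding degrees_at_most_def
  proof
    fix v
    have "\<exists>a b. \<forall>w. N v w \<longrightarrow> w = a \<or> w = b"
    proof (cases "\<exists>x r i. v = \<langle>x, \<langle>r, i\<rangle>\<rangle>")
      case False
      then show ?thesis unfolding N_def by blast
    next
      case True
      then obtain x r i where v: "v = \<langle>x, \<langle>r, i\<rangle>\<rangle>" by blast
      have star: "\<exists>a b. \<forall>r' i'. D x r i r' i' \<or> D x r' i' r i \<longrightarrow> \<langle>x, \<langle>r', i'\<rangle>\<rangle> = a \<or> \<langle>x, \<langle>r', i'\<rangle>\<rangle> = b"
      proof (cases "r = three")
        case True
        have "\<langle>x, \<langle>r', i'\<rangle>\<rangle> = \<langle>x, \<langle>\<one>, \<zero>\<rangle>\<rangle> \<or> \<langle>x, \<langle>r', i'\<rangle>\<rangle> = \<langle>x, \<langle>two, \<zero>\<rangle>\<rangle>"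
          if "D x r i r' i' \<or> D x r' i' r i" for r' i'
          using that True unfolding D_def by auto
        then show ?thesis by blast
      next
        case False
        \<comment> \<open>\<open>a\<close> is the candidate towards the middle, \<open>b\<close> the
          one outwards, which is the partner on another ray when the own ray has stopped. They need
          only include all neighbors; for instance, on ray 0 at height 0 the value of
          \<open>a\<close> is not a neighbor.\<close>
        define a where "a = (if i = \<zero> then \<langle>x, \<langle>three, \<zero>\<rangle>\<rangle> else \<langle>x, \<langle>r, i \<ominus> \<one>\<rangle>\<rangle>)"
        define b where "b = (if alive x i then \<langle>x, \<langle>r, i \<oplus> \<one>\<rangle>\<rangle> else if r = \<zero>
          then if R0 x (i \<ominus> \<one>) then \<langle>x, \<langle>\<one>, i\<rangle>\<rangle> else \<langle>x, \<langle>two, i\<rangle>\<rangle> else \<langle>x, \<langle>\<zero>, i\<rangle>\<rangle>)"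
        have "\<langle>x, \<langle>r', i'\<rangle>\<rangle> = b" if "D x r i r' i'" for r' i'
          using that False join0 join1 unfolding D_def b_def by (elim disjE conjE) simp_all
        moreover have "\<langle>x, \<langle>r', i'\<rangle>\<rangle> = a \<or> \<langle>x, \<langle>r', i'\<rangle>\<rangle> = b" if "D x r' i' r i" for r' i'
          using that False join0 join1 minus_eqI[of \<one> i' i] succ_neq_zero unfolding D_def a_def b_def
          by (elim disjE conjE) (simp_all add: add_comm)
        ultimately show ?thesis by blast
      qed
      then obtain a b where ab: "\<And>r' i'. D x r i r' i' \<or> D x r' i' r i \<Longrightarrow> \<langle>x, \<langle>r', i'\<rangle>\<rangle> = a \<or> \<langle>x, \<langle>r', i'\<rangle>\<rangle> = b" by blast
      have "w = a \<or> w = b" if "N v w" for w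
        using N_cases[OF that] ab unfolding v by auto
      then show ?thesis by blast
    qed
    then obtain a b where "\<And>w. adj M E v w \<Longrightarrow> w = a \<or> w = b" unfolding adj by blast
    from degree_le_two[OF E this] show "\<exists>d. has_degree M E v d \<and> d \<preceq> \<one> \<oplus> \<one>" by blast
  qed
  ultimately obtain C where C: "proper_edge_coloring M E two C"
    using coloring graph unfolding chromatic_index_le_def two_def by blast
  then have C_set: "C \<in> Sets M" unfolding proper_edge_coloring_def is_fun_def by blast
  define red where "red v w \<longleftrightarrow> \<langle>\<langle>v, w\<rangle>, \<one>\<rangle> \<in> C" for v w
  have red_sym: "red v w \<longleftrightarrow> red w v" for v w
    using C unfolding proper_edge_coloring_def red_def by blast
  have colors: "\<langle>\<langle>v, w\<rangle>, \<one>\<rangle> \<in> C \<or> \<langle>\<langle>v, w\<rangle>, two\<rangle> \<in> C" "\<not> (\<langle>\<langle>v, w\<rangle>, \<one>\<rangle> \<in> C \<and> \<langle>\<langle>v, w\<rangle>, two\<rangle> \<in> C)" if "N v w" for v w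
  proof -
    have "\<langle>v, w\<rangle> \<in> {pair M v w | v w. adj M E v w}" using that adj by blast
    then have ex1: "\<exists>!k. \<langle>\<langle>v, w\<rangle>, k\<rangle> \<in> C"
      using C unfolding proper_edge_coloring_def is_fun_def by blast
    then obtain k where k: "\<langle>\<langle>v, w\<rangle>, k\<rangle> \<in> C" by blast
    have "C \<subseteq> {\<langle>x, y\<rangle> | x y. x \<in> {pair M v w | v w. adj M E v w} \<and> y \<in> {c. \<one> \<preceq> c \<and> c \<preceq> two}}"
      using C unfolding proper_edge_coloring_def is_fun_def by blast
    then have "\<one> \<preceq> k" "k \<preceq> two" using k by auto
    then have "k = \<one> \<or> k = two" using less2[of k] not_less_zero zero_less_one less_trans less_irrefl by (auto simp: le_def)
    then show "\<langle>\<langle>v, w\<rangle>, \<one>\<rangle> \<in> C \<or> \<langle>\<langle>v, w\<rangle>, two\<rangle> \<in> C" using k by blast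
    show "\<not> (\<langle>\<langle>v, w\<rangle>, \<one>\<rangle> \<in> C \<and> \<langle>\<langle>v, w\<rangle>, two\<rangle> \<in> C)" using ex1 neq(4) by blast
  qed
  have red_alt: "red v w \<longleftrightarrow> \<not> red v w'" if "N v w" "N v w'" "w \<noteq> w'" for v w w'
    using C colors[OF that(1)] colors[OF that(2)] that(3)
    unfolding proper_edge_coloring_def red_def by blast
  define V where "V x r i = \<langle>x, \<langle>r, i\<rangle>\<rangle>" for x r i
  have V_eq: "V x r i = V x r' i' \<longleftrightarrow> r = r' \<and> i = i'" for x r i r' i' by (simp add: V_def)
  have ray: "N (V x r i) (V x r (i \<oplus> \<one>))" if "r = \<zero> \<or> r = \<one> \<or> r = two" "alive x i" for x r i
    using that unfolding V_def N_pair D_def by blast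
  \<comment> \<open>Colors flip at each step on ray 0 and on ray \<open>r\<close>, so whether the
    two rays agree at a height is the same for all heights reached.\<close>
  have invariant: "alive x i \<longrightarrow> ((red (V x \<zero> i) (V x \<zero> (i \<oplus> \<one>)) \<longleftrightarrow> red (V x r i) (V x r (i \<oplus> \<one>))) \<longleftrightarrow>
     (red (V x \<zero> \<zero>) (V x \<zero> (\<zero> \<oplus> \<one>)) \<longleftrightarrow> red (V x r \<zero>) (V x r (\<zero> \<oplus> \<one>))))" (is "?I i")
     if r: "r = \<one> \<or> r = two" for x r i
  proof -
    have "rec ?I" unfolding red_def V_def by (intro rec_intro rec_alive C_set)
    then show ?thesis
    proof (induct i rule: rec_induct)
      case (succ i)
      show ?case
      proof
        assume al: "alive x (i \<oplus> \<one>)"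
        have step: "red (V x r i) (V x r (i \<oplus> \<one>)) \<longleftrightarrow> \<not> red (V x r (i \<oplus> \<one>)) (V x r (i \<oplus> \<one> \<oplus> \<one>))"
          if r: "r = \<zero> \<or> r = \<one> \<or> r = two" for r
        proof -
          have "V x r i \<noteq> V x r (i \<oplus> \<one> \<oplus> \<one>)"
            using less_succ[of i i] less_succ[of i "i \<oplus> \<one>"] less_irrefl V_eq by metis
          from red_alt[OF N_sym[OF ray[OF r alive_mono[OF al]]] ray[OF r al] this]
          show ?thesis using red_sym by blast
        qed
        show "(red (V x \<zero> (i \<oplus> \<one>)) (V x \<zero> (i \<oplus> \<one> \<oplus> \<one>)) \<longleftrightarrow> red (V x r (i \<oplus> \<one>)) (V x r (i \<oplus> \<one> \<oplus> \<one>))) \<longleftrightarrow>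
          (red (V x \<zero> \<zero>) (V x \<zero> (\<zero> \<oplus> \<one>)) \<longleftrightarrow> red (V x r \<zero>) (V x r (\<zero> \<oplus> \<one>)))"
          using succ step[of \<zero>] step[of r] alive_mono[OF al] r by blast
      qed
    qed simp
  qed
  \<comment> \<open>The last edges of the two rays both meet the connecting edge, so with two colors
    they agree; the invariant carries this down to the first edges.\<close>
  have joined: "red (V x \<zero> \<zero>) (V x \<zero> (\<zero> \<oplus> \<one>)) \<longleftrightarrow> red (V x r \<zero>) (V x r (\<zero> \<oplus> \<one>))"
    if r: "r = \<one> \<or> r = two" and al: "alive x j" and e: "N (V x \<zero> (j \<oplus> \<one>)) (V x r (j \<oplus> \<one>))" for x r j
  proof -
    have "V x \<zero> j \<noteq> V x r (j \<oplus> \<one>)" "V x r j \<noteq> V x \<zero> (j \<oplus> \<one>)" using r V_eq by auto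
    then have "red (V x \<zero> (j \<oplus> \<one>)) (V x \<zero> j) \<longleftrightarrow> \<not> red (V x \<zero> (j \<oplus> \<one>)) (V x r (j \<oplus> \<one>))"
       "red (V x r (j \<oplus> \<one>)) (V x r j) \<longleftrightarrow> \<not> red (V x r (j \<oplus> \<one>)) (V x \<zero> (j \<oplus> \<one>))"
      using red_alt N_sym e ray[OF _ al] r by blast+
    then show ?thesis using invariant[OF r, of x j] al red_sym by blast
  qed
  \<comment> \<open>Decided by two edges at the start: does ray 0 agree with ray 1? Being joined to
    ray 1 forces agreement.\<close>
  define S where "S x \<longleftrightarrow> (red (V x \<zero> \<zero>) (V x \<zero> (\<zero> \<oplus> \<one>)) \<longleftrightarrow> red (V x \<one> \<zero>) (V x \<one> (\<zero> \<oplus> \<one>)))" for x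
  have first: "\<exists>j. alive x j \<and> (R0 x j \<or> R1 x j)" if "R0 x y \<or> R1 x y" for x y
  proof -
    have "rec (\<lambda>y. R0 x y \<or> R1 x y)" by (intro rec_intro rec_subst2[OF R0] rec_subst2[OF R1])
    from rec_least[OF this that] show ?thesis unfolding alive_def by metis
  qed
  show ?thesis
  proof (intro exI[of _ S] conjI allI impI)
    show "rec S" unfolding S_def red_def V_def by (intro rec_intro C_set)
    show "S x" if R: "R0 x y" for x y
    proof -
      obtain j where j: "alive x j" "R0 x j" using first disj R by blast
      then have "join R0 x (j \<oplus> \<one>)" unfolding join_def using less_succ by blast
      then have "N (V x \<zero> (j \<oplus> \<one>)) (V x \<one> (j \<oplus> \<one>))" unfolding V_def N_pair D_def by blast
      then show ?thesis unfolding S_def using joined[of \<one>] j by blast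
    qed
    show "\<not> S x" if R: "R1 x y" for x y
    proof -
      obtain j where j: "alive x j" "R1 x j" using first disj R by blast
      then have "join R1 x (j \<oplus> \<one>)" unfolding join_def using less_succ by blast
      then have "N (V x \<zero> (j \<oplus> \<one>)) (V x two (j \<oplus> \<one>))" unfolding V_def N_pair D_def by blast
      then have eq: "red (V x \<zero> \<zero>) (V x \<zero> (\<zero> \<oplus> \<one>)) \<longleftrightarrow> red (V x two \<zero>) (V x two (\<zero> \<oplus> \<one>))"
        using joined[of two] j by blast
      \<comment> \<open>The two edges at the middle vertex differ in color, and each differs from
        the first edge of its arm, so rays 1 and 2 start differently; agreement of ray 0 with ray 2
        then refutes \<open>S\<close>.\<close>
      have c: "N (V x three \<zero>) (V x \<one> \<zero>)" "N (V x three \<zero>) (V x two \<zero>)"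
        unfolding V_def N_pair D_def by blast+
      have neq: "V x \<one> \<zero> \<noteq> V x two \<zero>" "V x three \<zero> \<noteq> V x \<one> (\<zero> \<oplus> \<one>)" "V x three \<zero> \<noteq> V x two (\<zero> \<oplus> \<one>)"
        using V_eq by auto
      show ?thesis unfolding S_def
        using red_alt[OF c neq(1)] red_alt[OF N_sym[OF c(1)] ray[OF _ alive_zero] neq(2)]
          red_alt[OF N_sym[OF c(2)] ray[OF _ alive_zero] neq(3)] eq red_sym by blast
    qed
  qed
qed

section \<open>From separation to weak Koenig's lemma\<close>

text \<open>Recursion in which \<open>X i\<close> may depend on the whole code of \<open>X\<close>
  below \<open>i\<close>. Finite runs exist by \<open>\<Sigma>\<^sub>1\<close> induction and agree
  where they overlap, so "some run contains \<open>i\<close>" equals "every long enough run contains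
  \<open>i\<close>", and \<open>X\<close> is \<open>\<Delta>\<^sub>1\<close>.\<close>

lemma course_of_values:
  assumes S: "rec2 S"
  shows "\<exists>X. rec X \<and> (\<forall>i d. fin_code M d \<longrightarrow> (\<forall>j. mem d j \<longleftrightarrow> X j \<and> j \<prec> i) \<longrightarrow> (X i \<longleftrightarrow> S d i))"
proof -
  \<comment> \<open>Applies \<open>S\<close> to the canonical code of the part of \<open>c\<close>
    below \<open>i\<close>; the search for that code is bounded by
    \<open>code_bound i\<close>.\<close>
  define H where "H c i \<longleftrightarrow> (\<exists>d. d \<preceq> code_bound i \<and> fin_code M d \<and> (\<forall>j. j \<prec> d \<longrightarrow> mem d j \<longrightarrow> j \<prec> i) \<and>
      (\<forall>j. j \<prec> i \<longrightarrow> (mem d j \<longleftrightarrow> mem c j)) \<and> S d i)" for c i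
  have rH: "rec2 H" unfolding H_def by (intro rec_intro rec_subst2[OF S])
  have H_iff: "H c i \<longleftrightarrow> S d i" if d: "fin_code M d" "\<And>j. mem d j \<longleftrightarrow> mem c j \<and> j \<prec> i" for c d i
  proof -
    have "d' = d" if "fin_code M d'" "\<forall>j. j \<prec> d' \<longrightarrow> mem d' j \<longrightarrow> j \<prec> i" "\<forall>j. j \<prec> i \<longrightarrow> (mem d' j \<longleftrightarrow> mem c j)" for d'
      using fin_code_unique[OF that(1) d(1)] that(2,3) d(2) mem_less by blast
    moreover have "d \<preceq> code_bound i" using fin_code_le_bound d by blast
    ultimately show ?thesis unfolding H_def using d by blast
  qed
  have H_cong: "H c i \<longleftrightarrow> H c' i" if "\<And>j. j \<prec> i \<Longrightarrow> mem c j \<longleftrightarrow> mem c' j" for c c' i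
    unfolding H_def using that by (simp cong: conj_cong)
  define run where "run c l \<longleftrightarrow> (\<forall>i. i \<prec> l \<longrightarrow> (mem c i \<longleftrightarrow> H c i))" for c l
  have rrun: "recf f \<Longrightarrow> recf g \<Longrightarrow> rec (\<lambda>x. run (f x) (g x))" for f g
    by (rule rec_subst2) (unfold run_def, intro rec_intro rec_subst2[OF rH])
  have ex_run: "\<exists>c. run c l" for l
  proof -
    have "rec2 (\<lambda>l c. run c l)" by (intro rec_intro rrun)
    then show ?thesis
    proof (induct l rule: sig_induct)
      case zero
      show ?case unfolding run_def using not_less_zero by blast
    next
      case (succ l c)
      have "rec (\<lambda>j. j \<prec> l \<and> mem c j \<or> j = l \<and> H c l)" by (intro rec_intro rec_subst2[OF rH])
      from ex_code[OF this, of "l \<oplus> \<one>"]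
      obtain d where d: "\<And>j. mem d j \<longleftrightarrow> j \<prec> l \<and> mem c j \<or> j = l \<and> H c l" using less_succ by blast
      have lt: "mem d j \<longleftrightarrow> mem c j" if "j \<prec> l" for j using d that less_irrefl by blast
      have "mem d i \<longleftrightarrow> H d i" if "i \<prec> l \<oplus> \<one>" for i
      proof (cases "i = l")
        case True
        have "H d l \<longleftrightarrow> H c l" by (rule H_cong) (rule lt)
        then show ?thesis using d less_irrefl True by blast
      next
        case False
        then have i: "i \<prec> l" using that less_succ by blast
        have "H d i \<longleftrightarrow> H c i" by (rule H_cong) (use lt i less_trans in blast)
        then show ?thesis using succ lt[OF i] i unfolding run_def by blast
      qed
      then show ?case unfolding run_def by blast
    qed
  qed
  have unique: "mem c i \<longleftrightarrow> mem c' i" if "run c l" "run c' l'" "i \<prec> l" "i \<prec> l'" for c c' l l' i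
  proof (rule ccontr)
    assume "\<not> ?thesis"
    then have ne: "i \<prec> l \<and> i \<prec> l' \<and> \<not> (mem c i \<longleftrightarrow> mem c' i)" using that by blast
    have "rec (\<lambda>i. i \<prec> l \<and> i \<prec> l' \<and> \<not> (mem c i \<longleftrightarrow> mem c' i))" by (intro rec_intro)
    from rec_least[OF this ne] obtain k where k: "k \<prec> l" "k \<prec> l'" "\<not> (mem c k \<longleftrightarrow> mem c' k)"
      "\<And>j. j \<prec> k \<Longrightarrow> \<not> (j \<prec> l \<and> j \<prec> l' \<and> \<not> (mem c j \<longleftrightarrow> mem c' j))" by metis
    have "H c k \<longleftrightarrow> H c' k" by (rule H_cong) (use k less_trans in blast)
    then show False using k(1-3) that(1,2) unfolding run_def by blast
  qed
  define X where "X i \<longleftrightarrow> (\<exists>c. run c (i \<oplus> \<one>) \<and> mem c i)" for i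
  have X_run: "X j \<longleftrightarrow> mem c j" if "run c l" "j \<prec> l" for c l j
    unfolding X_def using unique[OF that(1) _ that(2), of _ "j \<oplus> \<one>"] ex_run[of "j \<oplus> \<one>"] less_succ[of j j] by blast
  have X_iff: "X i \<longleftrightarrow> (\<forall>c. run c (i \<oplus> \<one>) \<longrightarrow> mem c i)" for i
    using X_run[of _ "i \<oplus> \<one>" i] ex_run[of "i \<oplus> \<one>"] less_succ[of i i] by blast
  show ?thesis
  proof (intro exI[of _ X] conjI allI impI)
    show "rec X" unfolding X_def
    proof (rule rec_exI)
      show "rec2 (\<lambda>i c. run c (i \<oplus> \<one>) \<and> mem c i)" "rec2 (\<lambda>i c. run c (i \<oplus> \<one>) \<longrightarrow> mem c i)"
        by (intro rec_intro rrun)+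
      show "(\<exists>c. run c (i \<oplus> \<one>) \<and> mem c i) \<longleftrightarrow> (\<forall>c. run c (i \<oplus> \<one>) \<longrightarrow> mem c i)" for i
        using X_iff unfolding X_def by blast
    qed
    fix i d assume d: "fin_code M d" "\<forall>j. mem d j \<longleftrightarrow> X j \<and> j \<prec> i"
    obtain c where c: "run c (i \<oplus> \<one>)" using ex_run by blast
    have "mem d j \<longleftrightarrow> mem c j \<and> j \<prec> i" for j using d(2) X_run[OF c, of j] less_succ by blast
    then have "H c i \<longleftrightarrow> S d i" using H_iff d(1) by blast
    then show "X i \<longleftrightarrow> S d i" using c X_run[OF c, of i] less_succ[of i i] unfolding run_def by blast
  qed
qed

text \<open>Entries of a binary sequence of length at most \<open>l\<close> are pairs below
  \<open>\<langle>l, \<one>\<rangle>\<close>, so this bounds the codes of all such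
  sequences.\<close>

definition seq_bound :: "'m \<Rightarrow> 'm" where
  "seq_bound l = code_bound \<langle>l, \<one>\<rangle>"

lemma recf_seq_bound [rec_intro]: "recf f \<Longrightarrow> recf (\<lambda>x. seq_bound (f x))"
  unfolding seq_bound_def by (intro rec_intro)

lemma binary_seq_bound:
  assumes s: "is_seq M s k" "binary_seq M s" and "k \<preceq> l"
  shows "s \<preceq> seq_bound l"
  unfolding seq_bound_def
proof (rule fin_code_le_bound)
  show "fin_code M s" using is_seqD(1)[OF s(1)] .
  fix z assume z: "mem s z"
  then obtain i x where ix: "i \<prec> k" "z = \<langle>i, x\<rangle>" using is_seqD(5)[OF s(1)] by blast
  then have "x = \<zero> \<or> x = \<one>" using z s(2) unfolding binary_seq_def entry_def by blast
  then have "x \<preceq> \<one>" by auto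
  moreover have "i \<prec> l" using ix(1) assms(3) ar.less_le_trans by blast
  ultimately show "z \<prec> \<langle>l, \<one>\<rangle>" unfolding ix(2) by (intro pair_strict ar.add_less_le_mono)
qed

lemma binary_entry:
  assumes "is_seq M s l" "binary_seq M s" "i \<prec> l"
  shows "entry M s i \<zero> \<longleftrightarrow> \<not> entry M s i \<one>"
  using assms is_seqD(3,4)[OF assms(1)] zero_neq_one unfolding binary_seq_def by metis

theorem separation_imp_weak_Koenig:
  assumes sep: "\<And>R0 R1. rec2 R0 \<Longrightarrow> rec2 R1 \<Longrightarrow> (\<And>x y z. R0 x y \<Longrightarrow> R1 x z \<Longrightarrow> False) \<Longrightarrow>
    \<exists>S. rec S \<and> (\<forall>x y. R0 x y \<longrightarrow> S x) \<and> (\<forall>x y. R1 x y \<longrightarrow> \<not> S x)"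
  shows "weak_Koenig M"
  unfolding weak_Koenig_def
proof (intro allI impI)
  fix T assume "binary_tree M T \<and> infinite_in M T"
  then have T: "T \<in> Sets M" and bin: "\<And>t. t \<in> T \<Longrightarrow> binary_seq M t"
    and closed: "\<And>s t. t \<in> T \<Longrightarrow> initial_segment M s t \<Longrightarrow> s \<in> T"
    and inf: "\<And>k. \<exists>t\<in>T. k \<prec> t"
    unfolding binary_tree_def infinite_in_def by blast+
  \<comment> \<open>The node consists of the first \<open>l\<close> bits of \<open>P\<close>, and
    \<open>k\<close> is the length of an extension in \<open>T\<close>. The bound on
    \<open>u\<close> makes this recursive in \<open>k\<close> as well.\<close>
  define ext where "ext P l k \<longleftrightarrow> (\<exists>u. u \<preceq> seq_bound k \<and> u \<in> T \<and> is_seq M u k \<and>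
      (\<forall>i. i \<prec> l \<longrightarrow> (entry M u i \<one> \<longleftrightarrow> P i)))" for P l k
  have ext_iff: "ext P l k \<longleftrightarrow> (\<exists>u\<in>T. is_seq M u k \<and> (\<forall>i. i \<prec> l \<longrightarrow> (entry M u i \<one> \<longleftrightarrow> P i)))" for P l k
    unfolding ext_def using binary_seq_bound bin ar.order_refl by blast
  have ext_cong: "ext P l k \<longleftrightarrow> ext P' l k" if "\<And>i. i \<prec> l \<Longrightarrow> P i \<longleftrightarrow> P' i" for P P' l k
    unfolding ext_iff using that by (simp cong: conj_cong)
  have restrict: "ext P l k" if "is_seq M u k'" "u \<in> T" "l \<preceq> k" "k \<preceq> k'"
      "\<And>i. i \<prec> l \<Longrightarrow> entry M u i \<one> \<longleftrightarrow> P i" for P l k k' u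
  proof -
    have "rec (\<lambda>i. entry M u i \<one>)" by (intro rec_intro)
    then obtain s where s: "is_seq M s k" "\<And>i. i \<prec> k \<Longrightarrow> entry M s i \<one> \<longleftrightarrow> entry M u i \<one>"
      "\<And>i. i \<prec> k \<Longrightarrow> entry M s i \<zero> \<longleftrightarrow> \<not> entry M u i \<one>" "binary_seq M s"
      using ex_binary_seq by metis
    have "entry M s i x \<longleftrightarrow> entry M u i x" if i: "i \<prec> k" for i x
    proof -
      have "entry M s i \<zero> \<longleftrightarrow> entry M u i \<zero>"
        using s(3)[OF i] binary_entry[OF \<open>is_seq M u k'\<close> bin[OF \<open>u \<in> T\<close>]] i \<open>k \<preceq> k'\<close> ar.less_le_trans by blast
      then show ?thesis
        using s(2)[OF i] s(4) bin[OF \<open>u \<in> T\<close>] unfolding binary_seq_def by metis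
    qed
    then have "initial_segment M s u" unfolding initial_segment_def using s(1) that(1,4) by blast
    then have "s \<in> T" using closed that(2) by blast
    moreover have "entry M s i \<one> \<longleftrightarrow> P i" if "i \<prec> l" for i
      using s(2) that \<open>l \<preceq> k\<close> \<open>\<And>i. i \<prec> l \<Longrightarrow> entry M u i \<one> \<longleftrightarrow> P i\<close> ar.less_le_trans by blast
    ultimately show ?thesis unfolding ext_iff using s(1) by blast
  qed
  have ext_mono: "ext P l k" if "ext P l k'" "l \<preceq> k" "k \<preceq> k'" for P l k k'
    using that(1) restrict[OF _ _ that(2,3)] unfolding ext_iff[of P l k'] by blast
  have children: "ext (\<lambda>i. P i \<and> i \<noteq> l) (l \<oplus> \<one>) k \<or> ext (\<lambda>i. P i \<or> i = l) (l \<oplus> \<one>) k"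
    if e: "ext P l k" for P l k
  proof -
    obtain u where u: "u \<in> T" "is_seq M u k" "\<And>i. i \<prec> l \<Longrightarrow> entry M u i \<one> \<longleftrightarrow> P i"
      using e unfolding ext_iff by blast
    show ?thesis
    proof (cases "entry M u l \<one>")
      case True
      then have "entry M u i \<one> \<longleftrightarrow> P i \<or> i = l" if "i \<prec> l \<oplus> \<one>" for i
        using u(3) that less_succ by blast
      then show ?thesis unfolding ext_iff using u(1,2) by blast
    next
      case False
      then have "entry M u i \<one> \<longleftrightarrow> P i \<and> i \<noteq> l" if "i \<prec> l \<oplus> \<one>" for i
        using u(3) that less_succ less_irrefl by blast
      then show ?thesis unfolding ext_iff using u(1,2) by blast
    qed
  qed
  \<comment> \<open>\<open>x\<close> codes the node of length \<open>p2 x\<close> given by the finite set \<open>p1 x\<close>; \<open>e0\<close> and \<open>e1\<close> say that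
    its left or right child has an extension of length \<open>k\<close> in \<open>T\<close>.\<close>
  define e0 where "e0 x k \<longleftrightarrow> ext (\<lambda>i. mem (p1 x) i \<and> i \<noteq> p2 x) (p2 x \<oplus> \<one>) k" for x k
  define e1 where "e1 x k \<longleftrightarrow> ext (\<lambda>i. mem (p1 x) i \<or> i = p2 x) (p2 x \<oplus> \<one>) k" for x k
  have re: "rec2 e0" "rec2 e1" unfolding e0_def e1_def ext_def by (intro rec_intro T)+
  have mono: "e0 x k' \<Longrightarrow> p2 x \<prec> k \<Longrightarrow> k \<preceq> k' \<Longrightarrow> e0 x k" "e1 x k' \<Longrightarrow> p2 x \<prec> k \<Longrightarrow> k \<preceq> k' \<Longrightarrow> e1 x k" for x k k'
    unfolding e0_def e1_def using ext_mono succ_le by blast+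
  \<comment> \<open>Being alive at length \<open>k\<close> is inherited by shorter lengths, so the
    two relations exclude each other even with different witnesses. The separating set means: go
    right, because the left side dies first.\<close>
  let ?R0 = "\<lambda>x k. p2 x \<prec> k \<and> \<not> e0 x k \<and> e1 x k"
  let ?R1 = "\<lambda>x k. p2 x \<prec> k \<and> \<not> e1 x k \<and> e0 x k"
  have "rec2 ?R0" "rec2 ?R1" by (intro rec_intro rec_subst2[OF re(1)] rec_subst2[OF re(2)])+
  from sep[OF this] have "\<exists>S. rec S \<and> (\<forall>x y. ?R0 x y \<longrightarrow> S x) \<and> (\<forall>x y. ?R1 x y \<longrightarrow> \<not> S x)"
    using mono le_total by blast
  then obtain S where S: "rec S" "\<And>x y. ?R0 x y \<Longrightarrow> S x" "\<And>x y. ?R1 x y \<Longrightarrow> \<not> S x" by blast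
  have "rec2 (\<lambda>d i. S \<langle>d, i\<rangle>)" by (intro rec_intro rec_subst[OF S(1)])
  from course_of_values[OF this] obtain X where X: "rec X"
    "\<And>i d. fin_code M d \<Longrightarrow> (\<And>j. mem d j \<longleftrightarrow> X j \<and> j \<prec> i) \<Longrightarrow> X i \<longleftrightarrow> S \<langle>d, i\<rangle>" by blast
  have X_ext: "i \<preceq> k \<longrightarrow> ext X i k" for i k
  proof -
    \<comment> \<open>"Extendible to every length \<open>k\<close>" is \<open>\<Pi>\<^sub>1\<close>,
      hence induction on \<open>i\<close> by \<open>pi_induct\<close>.\<close>
    have "rec2 (\<lambda>i k. i \<preceq> k \<longrightarrow> ext X i k)" unfolding ext_def by (intro rec_intro T rec_subst[OF X(1)])
    then show ?thesis
    proof (induct i k rule: pi_induct)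
      case (zero k)
      \<comment> \<open>Sequences of length at most \<open>k\<close> have codes up to
        \<open>seq_bound k\<close>, so a larger code in \<open>T\<close> must be longer than
        that.\<close>
      obtain t where t: "t \<in> T" "seq_bound k \<prec> t" using inf by blast
      obtain l where l: "is_seq M t l" using bin[OF t(1)] unfolding binary_seq_def by blast
      have "k \<preceq> l"
      proof (rule ccontr)
        assume "\<not> k \<preceq> l"
        then have "l \<preceq> k" using le_total by blast
        then show False using binary_seq_bound[OF l bin[OF t(1)]] t(2) ar.not_less by blast
      qed
      then have "ext X \<zero> k" by (intro restrict[OF l t(1)]) (simp_all add: not_less_zero)
      then show ?case ..
    next
      case (succ i k)
      show ?case
      proof
        assume "i \<oplus> \<one> \<preceq> k"
        then have k: "i \<prec> k" by (simp add: succ_le)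
        then have e: "ext X i k" using succ le_def by metis
        have "rec (\<lambda>j. X j \<and> j \<prec> i)" by (intro rec_intro X)
        then obtain d where d: "fin_code M d" "\<And>j. mem d j \<longleftrightarrow> X j \<and> j \<prec> i"
          using ex_fin_code[of "\<lambda>j. X j \<and> j \<prec> i" i] by metis
        have Xi: "X i \<longleftrightarrow> S \<langle>d, i\<rangle>" using X(2) d by blast
        have "ext (mem d) i k \<longleftrightarrow> ext X i k" by (rule ext_cong) (use d(2) in blast)
        then have ch: "e0 \<langle>d, i\<rangle> k \<or> e1 \<langle>d, i\<rangle> k"
          using e children[of "mem d" i k] unfolding e0_def e1_def p1_pair p2_pair by blast
        \<comment> \<open>If the chosen child were dead at length \<open>k\<close>, its sibling
          would be alive there by \<open>ch\<close>, and \<open>k\<close> would be a witness forcing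
          the opposite value of \<open>S\<close>.\<close>
        show "ext X (i \<oplus> \<one>) k"
        proof (cases "X i")
          case True
          have "ext X (i \<oplus> \<one>) k \<longleftrightarrow> e1 \<langle>d, i\<rangle> k"
            unfolding e1_def p1_pair p2_pair by (rule ext_cong) (use d(2) True less_succ in blast)
          then show ?thesis using ch S(3)[of "\<langle>d, i\<rangle>" k] True Xi k unfolding p2_pair by blast
        next
          case False
          have "ext X (i \<oplus> \<one>) k \<longleftrightarrow> e0 \<langle>d, i\<rangle> k"
            unfolding e0_def p1_pair p2_pair by (rule ext_cong) (use d(2) False less_succ less_irrefl in blast)
          then show ?thesis using ch S(2)[of "\<langle>d, i\<rangle>" k] False Xi k unfolding p2_pair by blast
        qed
      qed
    qed
  qed
  define f where "f = {z. z = \<langle>p1 z, p2 z\<rangle> \<and> (p2 z = \<one> \<and> X (p1 z) \<or> p2 z = \<zero> \<and> \<not> X (p1 z))}"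
  have f: "\<langle>i, x\<rangle> \<in> f \<longleftrightarrow> x = \<one> \<and> X i \<or> x = \<zero> \<and> \<not> X i" for i x by (simp add: f_def)
  have "infinite_path M T f"
    unfolding infinite_path_def
  proof (intro conjI allI)
    have "f \<in> Sets M" unfolding f_def rec_def[symmetric] by (intro rec_intro rec_subst[OF X(1)])
    moreover have "\<exists>!y. \<langle>x, y\<rangle> \<in> f" for x unfolding f using zero_neq_one by blast
    moreover have "f \<subseteq> {\<langle>x, y\<rangle> | x y. x \<in> UNIV \<and> y \<in> {\<zero>, \<one>}}" unfolding f_def by blast
    ultimately show "is_fun M UNIV {\<zero>, \<one>} f" unfolding is_fun_def by blast
    fix l
    obtain t where t: "t \<in> T" "is_seq M t l" "\<And>i. i \<prec> l \<Longrightarrow> entry M t i \<one> \<longleftrightarrow> X i"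
      using X_ext[of l l] unfolding ext_iff by auto
    have "entry M t i x \<longleftrightarrow> \<langle>i, x\<rangle> \<in> f" if i: "i \<prec> l" for i x
      unfolding f using t(3)[OF i] binary_entry[OF t(2) bin[OF t(1)] i] bin[OF t(1)] zero_neq_one
      unfolding binary_seq_def by metis
    then show "\<exists>t\<in>T. is_seq M t l \<and> (\<forall>i. i \<prec> l \<longrightarrow> (\<forall>x. entry M t i x \<longleftrightarrow> \<langle>i, x\<rangle> \<in> f))"
      using t(1,2) by blast
  qed
  then show "\<exists>f. infinite_path M T f" ..
qed

end

theorem theorem3p5:
  fixes M :: "'m l2"
  assumes "RCA0 M"
  shows "(WKL0 M \<longleftrightarrow>
           (\<forall>n E. countable_graph M E \<and> bipartite M E \<and> degrees_at_most M E n
              \<longrightarrow> chromatic_index_le M E n))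
       \<and> ((\<forall>n E. countable_graph M E \<and> bipartite M E \<and> degrees_at_most M E n
              \<longrightarrow> chromatic_index_le M E n) \<longleftrightarrow>
           (\<forall>E. countable_graph M E \<and> bounded_graph M E \<and> bipartite M E
                \<and> degrees_at_most M E (\<one>\<^bsub>M\<^esub> \<oplus>\<^bsub>M\<^esub> \<one>\<^bsub>M\<^esub>)
              \<longrightarrow> chromatic_index_le M E (\<one>\<^bsub>M\<^esub> \<oplus>\<^bsub>M\<^esub> \<one>\<^bsub>M\<^esub>)))"
    (is "(_ \<longleftrightarrow> ?Any) \<and> (_ \<longleftrightarrow> ?Two)")
proof -
  interpret rca M by standard (rule assms)
  have "weak_Koenig M \<Longrightarrow> ?Any" using weak_Koenig_imp_chromatic_index by blast
  moreover have "?Any \<Longrightarrow> ?Two" by blast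
  moreover have "weak_Koenig M" if ?Two
    by (rule separation_imp_weak_Koenig, rule separation[OF that])
  ultimately show ?thesis using assms unfolding WKL0_def by blast
qed

end
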